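(* Let $G$ be a group, $g\in G$, and let $(\mathcal B,\langle\!\langle-\rangle\!\rangle)$ be a shadowed bicategory equipped with $G$-twisting data. Let $X\in\mathcal B^{G\text{-tw}}(A,B)$ and $Y\in\mathcal B^{G\text{-tw}}(B,C)$ be left dualizable, and let $f_X\colon X\Rightarrow X$ and $f_Y\colon Y\Rightarrow Y$ be 2-cells in $\mathcal B^{G\text{-tw}}$. Then $X\odot Y$ is left dualizable and $$\operatorname{tr}^g(f_X\odot f_Y)=\operatorname{tr}^g(f_X)\circ\operatorname{tr}^g(f_Y)\colon{}^g\langle\!\langle U_C\rangle\!\rangle\longrightarrow{}^g\langle\!\langle U_A\rangle\!\rangle.$$
   Context: **Bicategories.** For 1-cells $M\colon A\to B$, $N\colon B\to C$ the horizontal composite is written $M\odot N\colon A\to C$ (first $M$, then $N$); $U_A$ is the unit 1-cell; associators and unitors $\mathfrak a,\mathfrak l,\mathfrak r$ are suppressed where harmless. $\mathrm{Pic}_{\mathcal B}(A)$ is the monoidal groupoid (under $\odot$) of invertible 1-cells $A\to A$ and invertible 2-cells. **$G$-twisting data**: for each 0-cell $A$ a strong monoidal functor $\Theta_A\colon G\to\mathrm{Pic}_{\mathcal B}(A)$ with structure 2-cells $\mu^A_{g,h}\colon\Theta_A(g)\odot\Theta_A(h)\Rightarrow\Theta_A(gh)$, $\eta^A\colon U_A\Rightarrow\Theta_A(e)$. For $M\colon A\to B$: ${}^gM=\Theta_A(g^{-1})\odot M$, $M^g=M\odot\Theta_B(g)$; ${}^gf=\mathrm{id}\odot f$ for a 2-cell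 $f$. **Bicategory of $G$-twists $\mathcal B^{G\text{-tw}}$.** Same 0-cells. A 1-cell $A\to B$ is $(M,\tau)$ with $M\colon A\to B$ in $\mathcal B$ and invertible 2-cells $\tau_g\colon\Theta_A(g)\odot M\Rightarrow M\odot\Theta_B(g)$, $g\in G$, such that $\tau_e$ is the canonical isomorphism given by $\eta^A,\eta^B$ and unitors, and $\tau_{gh}=(\mathrm{id}_M\odot\mu^B_{g,h})(\tau_g\odot\mathrm{id})(\mathrm{id}\odot\tau_h)((\mu^A_{g,h})^{-1}\odot\mathrm{id}_M)$. A 2-cell $(M,\tau)\Rightarrow(N,\sigma)$ is a 2-cell $f\colon M\Rightarrow N$ with $\sigma_g(\mathrm{id}\odot f)=(f\odot\mathrm{id})\tau_g$ for all $g$. Composite: $(M\odot N,\tau\star\sigma)$, $(\tau\star\sigma)_g=(\mathrm{id}_M\odot\sigma_g)(\tau_g\odot\mathrm{id}_N)$. Unit: $U_A$ with $\mathfrak l^{-1}\mathfrak r$. Transport map: $g_M=(\tau_{g^{-1}})^{-1}\colon M^{g^{-1}}\Rightarrow{}^gM$. **Shadows.** A shadow on $\mathcal B$ with values in a category $\mathcal T$ is a family of functors $\langle\!\langle-\rangle\!\rangle_R\colon\mathcal B(R,R)\to\mathcal T$ with natural isomorphisms $\theta_{M,N}\colon\langle\!\langle M\odot N\rangle\!\rangle_R\cong\langle\!\langle N\odot M\rangle\!\rangle_S$ ($M\colon R\to S$, $N\colon S\to R$) such that, up to associators, $\theta_{M\odot N,P}=\theta_{N,P\odot M}\circ\theta_{M,N\odot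 P}$, and $\langle\!\langle\mathfrak l\rangle\!\rangle\circ\theta_{M,U_R}=\langle\!\langle\mathfrak r\rangle\!\rangle$, $\langle\!\langle\mathfrak r\rangle\!\rangle\circ\theta_{U_R,M}=\langle\!\langle\mathfrak l\rangle\!\rangle$. **Twisted shadow.** ${}^g\langle\!\langle(M,\tau)\rangle\!\rangle_R=\langle\!\langle{}^gM\rangle\!\rangle_R$, ${}^g\langle\!\langle f\rangle\!\rangle=\langle\!\langle{}^gf\rangle\!\rangle$. Twisted cyclicity ${}^g\theta_{M,N}$: $\langle\!\langle\Theta_R(g^{-1})\odot M\odot N\rangle\!\rangle_R\xrightarrow{\theta}\langle\!\langle N\odot\Theta_R(g^{-1})\odot M\rangle\!\rangle_S\xrightarrow{g_N\odot\mathrm{id}}\langle\!\langle\Theta_S(g^{-1})\odot N\odot M\rangle\!\rangle_S$. **Twisted trace.** $X\colon A\to B$ is left dualizable with left dual ${}^*X\colon B\to A$ if there are 2-cells $\bar\eta\colon U_B\Rightarrow{}^*X\odot X$, $\bar\epsilon\colon X\odot{}^*X\Rightarrow U_A$ (in $\mathcal B^{G\text{-tw}}$) satisfying the triangle identities. For $f\colon X\Rightarrow X$, $\operatorname{tr}^g(f)\colon{}^g\langle\!\langle U_B\rangle\!\rangle_B\to{}^g\langle\!\langle U_A\rangle\!\rangle_A$ is ${}^g\langle\!\langle U_B\rangle\!\rangle\xrightarrow{\bar\eta}{}^g\langle\!\langle{}^*X\odot X\rangle\!\rangle\xrightarrow{\mathrm{id}\odot f}{}^g\langle\!\langle{}^*X\odot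 X\rangle\!\rangle\xrightarrow{{}^g\theta}{}^g\langle\!\langle X\odot{}^*X\rangle\!\rangle\xrightarrow{\bar\epsilon}{}^g\langle\!\langle U_A\rangle\!\rangle$. *)

theory Defs
  imports "HOL-Algebra.Group"
begin

section \<open>Categories\<close>

record ('x, 'f) cat =
  Ob :: "'x set"
  Ar :: "'f set"
  Dom :: "'f \<Rightarrow> 'x"
  Cod :: "'f \<Rightarrow> 'x"
  ident :: "'x \<Rightarrow> 'f" ("\<ii>\<index>")
  comp :: "'f \<Rightarrow> 'f \<Rightarrow> 'f" (infixr "\<cdot>\<index>" 55)

text \<open>Composition is written in the applicative order: \<open>k \<cdot> f\<close> is \<open>k\<close> after \<open>f\<close>.\<close>

definition Hom :: "('x, 'f, 'z) cat_scheme \<Rightarrow> 'x \<Rightarrow> 'x \<Rightarrow> 'f set" where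
  "Hom C x y = {f \<in> Ar C. Dom C f = x \<and> Cod C f = y}"

definition are_inverse :: "('x, 'f, 'z) cat_scheme \<Rightarrow> 'f \<Rightarrow> 'f \<Rightarrow> bool" where
  "are_inverse C f k \<longleftrightarrow> f \<in> Ar C \<and> k \<in> Hom C (Cod C f) (Dom C f) \<and>
     k \<cdot>\<^bsub>C\<^esub> f = ident C (Dom C f) \<and> f \<cdot>\<^bsub>C\<^esub> k = ident C (Cod C f)"

definition is_iso :: "('x, 'f, 'z) cat_scheme \<Rightarrow> 'f \<Rightarrow> bool" where
  "is_iso C f \<longleftrightarrow> (\<exists>k. are_inverse C f k)"

definition inv_arr :: "('x, 'f, 'z) cat_scheme \<Rightarrow> 'f \<Rightarrow> 'f" where
  "inv_arr C f = (THE k. are_inverse C f k)"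

locale category =
  fixes C :: "('x, 'f, 'z) cat_scheme" (structure)
  assumes Dom_Ob: "f \<in> Ar C \<Longrightarrow> Dom C f \<in> Ob C"
    and Cod_Ob: "f \<in> Ar C \<Longrightarrow> Cod C f \<in> Ob C"
    and ident_Hom: "x \<in> Ob C \<Longrightarrow> \<ii> x \<in> Hom C x x"
    and comp_Hom: "\<lbrakk>f \<in> Hom C x y; k \<in> Hom C y z\<rbrakk> \<Longrightarrow> k \<cdot> f \<in> Hom C x z"
    and comp_ident: "f \<in> Hom C x y \<Longrightarrow> f \<cdot> \<ii> x = f"
    and ident_comp: "f \<in> Hom C x y \<Longrightarrow> \<ii> y \<cdot> f = f"
    and comp_assoc: "\<lbrakk>f \<in> Hom C w x; k \<in> Hom C x y; h \<in> Hom C y z\<rbrakk>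
      \<Longrightarrow> (h \<cdot> k) \<cdot> f = h \<cdot> (k \<cdot> f)"

section \<open>Bicategories\<close>

text \<open>
  A bicategory is presented by one category, the disjoint union of all its hom-categories:
  its objects are the 1-cells, its arrows the 2-cells, and its composition is the vertical
  composition.  Each 1-cell has a source and a target 0-cell, and \<open>\<B>(a, b)\<close> is the full
  subcategory on the 1-cells from \<open>a\<close> to \<open>b\<close>.  Horizontal composition is written in
  diagrammatic order, \<open>\<odot>\<close> on 1-cells and \<open>\<star>\<close> on 2-cells.  The directions of the constraints are
  \<open>\<aa> M N P : (M \<odot> N) \<odot> P \<Rightarrow> M \<odot> (N \<odot> P)\<close>, \<open>\<ll> M : U \<odot> M \<Rightarrow> M\<close> and \<open>\<rr> M : M \<odot> U \<Rightarrow> M\<close>.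
\<close>

record ('o, 'm, 'c) bicat = "('m, 'c) cat" +
  Obj0 :: "'o set"
  Src :: "'m \<Rightarrow> 'o"
  Trg :: "'m \<Rightarrow> 'o"
  unit1 :: "'o \<Rightarrow> 'm" ("\<U>\<index>")
  hcomp1 :: "'m \<Rightarrow> 'm \<Rightarrow> 'm" (infixl "\<odot>\<index>" 70)
  hcomp2 :: "'c \<Rightarrow> 'c \<Rightarrow> 'c" (infixl "\<star>\<index>" 70)
  asc :: "'m \<Rightarrow> 'm \<Rightarrow> 'm \<Rightarrow> 'c" ("\<aa>\<index>")
  lun :: "'m \<Rightarrow> 'c" ("\<ll>\<index>")
  run :: "'m \<Rightarrow> 'c" ("\<rr>\<index>")

definition cells1 :: "('o, 'm, 'c, 'z) bicat_scheme \<Rightarrow> 'o \<Rightarrow> 'o \<Rightarrow> 'm set" where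
  "cells1 B a b = {M \<in> Ob B. Src B M = a \<and> Trg B M = b}"

locale bicategory = category B
  for B :: "('o, 'm, 'c, 'z) bicat_scheme" (structure) +
  assumes Src_Obj0: "M \<in> Ob B \<Longrightarrow> Src B M \<in> Obj0 B"
    and Trg_Obj0: "M \<in> Ob B \<Longrightarrow> Trg B M \<in> Obj0 B"
    and Src_parallel: "f \<in> Ar B \<Longrightarrow> Src B (Dom B f) = Src B (Cod B f)"
    and Trg_parallel: "f \<in> Ar B \<Longrightarrow> Trg B (Dom B f) = Trg B (Cod B f)"
    and unit1_cell: "a \<in> Obj0 B \<Longrightarrow> \<U> a \<in> cells1 B a a"
    and hcomp1_cell: "\<lbrakk>M \<in> cells1 B a b; N \<in> cells1 B b c\<rbrakk> \<Longrightarrow> M \<odot> N \<in> cells1 B a c"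
    and hcomp2_Hom:
      "\<lbrakk>M \<in> cells1 B a b; N \<in> cells1 B b c; f \<in> Hom B M M'; k \<in> Hom B N N'\<rbrakk>
       \<Longrightarrow> f \<star> k \<in> Hom B (M \<odot> N) (M' \<odot> N')"
    and hcomp2_ident:
      "\<lbrakk>M \<in> cells1 B a b; N \<in> cells1 B b c\<rbrakk> \<Longrightarrow> \<ii> M \<star> \<ii> N = \<ii> (M \<odot> N)"
    and interchange:
      "\<lbrakk>M \<in> cells1 B a b; N \<in> cells1 B b c;
        f \<in> Hom B M M'; f' \<in> Hom B M' M''; k \<in> Hom B N N'; k' \<in> Hom B N' N''\<rbrakk>
       \<Longrightarrow> (f' \<cdot> f) \<star> (k' \<cdot> k) = (f' \<star> k') \<cdot> (f \<star> k)"
    and asc_Hom: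
      "\<lbrakk>M \<in> cells1 B a b; N \<in> cells1 B b c; P \<in> cells1 B c d\<rbrakk>
       \<Longrightarrow> \<aa> M N P \<in> Hom B ((M \<odot> N) \<odot> P) (M \<odot> (N \<odot> P))"
    and asc_iso:
      "\<lbrakk>M \<in> cells1 B a b; N \<in> cells1 B b c; P \<in> cells1 B c d\<rbrakk> \<Longrightarrow> is_iso B (\<aa> M N P)"
    and asc_natural:
      "\<lbrakk>M \<in> cells1 B a b; N \<in> cells1 B b c; P \<in> cells1 B c d;
        f \<in> Hom B M M'; k \<in> Hom B N N'; h \<in> Hom B P P'\<rbrakk>
       \<Longrightarrow> \<aa> M' N' P' \<cdot> ((f \<star> k) \<star> h) = (f \<star> (k \<star> h)) \<cdot> \<aa> M N P"
    and lun_Hom: "M \<in> cells1 B a b \<Longrightarrow> \<ll> M \<in> Hom B (\<U> a \<odot> M) M"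
    and lun_iso: "M \<in> cells1 B a b \<Longrightarrow> is_iso B (\<ll> M)"
    and lun_natural:
      "\<lbrakk>M \<in> cells1 B a b; f \<in> Hom B M M'\<rbrakk> \<Longrightarrow> \<ll> M' \<cdot> (\<ii> (\<U> a) \<star> f) = f \<cdot> \<ll> M"
    and run_Hom: "M \<in> cells1 B a b \<Longrightarrow> \<rr> M \<in> Hom B (M \<odot> \<U> b) M"
    and run_iso: "M \<in> cells1 B a b \<Longrightarrow> is_iso B (\<rr> M)"
    and run_natural:
      "\<lbrakk>M \<in> cells1 B a b; f \<in> Hom B M M'\<rbrakk> \<Longrightarrow> \<rr> M' \<cdot> (f \<star> \<ii> (\<U> b)) = f \<cdot> \<rr> M"
    and pentagon:
      "\<lbrakk>M \<in> cells1 B a b; N \<in> cells1 B b c; P \<in> cells1 B c d; Q \<in> cells1 B d e\<rbrakk>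
       \<Longrightarrow> \<aa> M N (P \<odot> Q) \<cdot> \<aa> (M \<odot> N) P Q
         = (\<ii> M \<star> \<aa> N P Q) \<cdot> \<aa> M (N \<odot> P) Q \<cdot> (\<aa> M N P \<star> \<ii> Q)"
    and triangle:
      "\<lbrakk>M \<in> cells1 B a b; N \<in> cells1 B b c\<rbrakk>
       \<Longrightarrow> (\<ii> M \<star> \<ll> N) \<cdot> \<aa> M (\<U> b) N = \<rr> M \<star> \<ii> N"

definition invertible1 :: "('o, 'm, 'c, 'z) bicat_scheme \<Rightarrow> 'o \<Rightarrow> 'm \<Rightarrow> bool" where
  "invertible1 B a M \<longleftrightarrow> M \<in> cells1 B a a \<and>
     (\<exists>N \<in> cells1 B a a.
        (\<exists>u \<in> Hom B (\<U>\<^bsub>B\<^esub> a) (M \<odot>\<^bsub>B\<^esub> N). is_iso B u) \<and>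
        (\<exists>v \<in> Hom B (N \<odot>\<^bsub>B\<^esub> M) (\<U>\<^bsub>B\<^esub> a). is_iso B v))"

context
  fixes B :: "('o, 'm, 'c, 'z) bicat_scheme" (structure)
begin

text \<open>
  \<open>left_dual a b X X' coev ev\<close>: the 1-cell \<open>X : a \<rightarrow> b\<close> has left dual \<open>X' : b \<rightarrow> a\<close>,
  with coevaluation \<open>coev : U\<^sub>b \<Rightarrow> X' \<odot> X\<close> and evaluation \<open>ev : X \<odot> X' \<Rightarrow> U\<^sub>a\<close>.
\<close>

definition left_dual :: "'o \<Rightarrow> 'o \<Rightarrow> 'm \<Rightarrow> 'm \<Rightarrow> 'c \<Rightarrow> 'c \<Rightarrow> bool" where
  "left_dual a b X X' coev ev \<longleftrightarrow>
     X \<in> cells1 B a b \<and> X' \<in> cells1 B b a \<and>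
     coev \<in> Hom B (\<U> b) (X' \<odot> X) \<and> ev \<in> Hom B (X \<odot> X') (\<U> a) \<and>
     \<ll> X \<cdot> (ev \<star> \<ii> X) \<cdot> inv_arr B (\<aa> X X' X) \<cdot> (\<ii> X \<star> coev) \<cdot> inv_arr B (\<rr> X) = \<ii> X \<and>
     \<rr> X' \<cdot> (\<ii> X' \<star> ev) \<cdot> \<aa> X' X X' \<cdot> (coev \<star> \<ii> X') \<cdot> inv_arr B (\<ll> X') = \<ii> X'"

definition left_dualizable :: "'o \<Rightarrow> 'o \<Rightarrow> 'm \<Rightarrow> bool" where
  "left_dualizable a b X \<longleftrightarrow> (\<exists>X' coev ev. left_dual a b X X' coev ev)"

end

section \<open>Shadows\<close>

text \<open>
  An endo-1-cell determines the 0-cell it lives on, so the functors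
  \<open>\<langle>\<langle>-\<rangle>\<rangle>\<^sub>R : \<B>(R, R) \<rightarrow> \<T>\<close> are given by one map \<open>sh\<close> on 1-cells and one map \<open>shm\<close> on 2-cells;
  \<open>cyc M N\<close> is the cyclicity isomorphism \<open>\<theta>\<^sub>M\<^sub>,\<^sub>N\<close>.
\<close>

record ('m, 'c, 'x, 'f) shadow_data =
  sh :: "'m \<Rightarrow> 'x"
  shm :: "'c \<Rightarrow> 'f"
  cyc :: "'m \<Rightarrow> 'm \<Rightarrow> 'f" ("\<theta>\<index>")

locale shadowed_bicategory = bicategory B + T: category T
  for B :: "('o, 'm, 'c, 'z) bicat_scheme" (structure)
    and T :: "('x, 'f, 'y) cat_scheme" +
  fixes S :: "('m, 'c, 'x, 'f) shadow_data"
  assumes sh_Ob: "M \<in> cells1 B r r \<Longrightarrow> sh S M \<in> Ob T"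
    and shm_Hom: "\<lbrakk>M \<in> cells1 B r r; f \<in> Hom B M N\<rbrakk> \<Longrightarrow> shm S f \<in> Hom T (sh S M) (sh S N)"
    and shm_ident: "M \<in> cells1 B r r \<Longrightarrow> shm S (\<ii> M) = \<ii>\<^bsub>T\<^esub> (sh S M)"
    and shm_comp:
      "\<lbrakk>M \<in> cells1 B r r; f \<in> Hom B M N; k \<in> Hom B N P\<rbrakk>
       \<Longrightarrow> shm S (k \<cdot> f) = shm S k \<cdot>\<^bsub>T\<^esub> shm S f"
    and cyc_Hom:
      "\<lbrakk>M \<in> cells1 B r s; N \<in> cells1 B s r\<rbrakk>
       \<Longrightarrow> \<theta>\<^bsub>S\<^esub> M N \<in> Hom T (sh S (M \<odot> N)) (sh S (N \<odot> M))"
    and cyc_iso: "\<lbrakk>M \<in> cells1 B r s; N \<in> cells1 B s r\<rbrakk> \<Longrightarrow> is_iso T (\<theta>\<^bsub>S\<^esub> M N)"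
    and cyc_natural:
      "\<lbrakk>M \<in> cells1 B r s; N \<in> cells1 B s r; f \<in> Hom B M M'; k \<in> Hom B N N'\<rbrakk>
       \<Longrightarrow> \<theta>\<^bsub>S\<^esub> M' N' \<cdot>\<^bsub>T\<^esub> shm S (f \<star> k) = shm S (k \<star> f) \<cdot>\<^bsub>T\<^esub> \<theta>\<^bsub>S\<^esub> M N"
    and cyc_hexagon:
      "\<lbrakk>M \<in> cells1 B r s; N \<in> cells1 B s t; P \<in> cells1 B t r\<rbrakk>
       \<Longrightarrow> \<theta>\<^bsub>S\<^esub> (M \<odot> N) P
         = shm S (\<aa> P M N) \<cdot>\<^bsub>T\<^esub> \<theta>\<^bsub>S\<^esub> N (P \<odot> M) \<cdot>\<^bsub>T\<^esub> shm S (\<aa> N P M)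
           \<cdot>\<^bsub>T\<^esub> \<theta>\<^bsub>S\<^esub> M (N \<odot> P) \<cdot>\<^bsub>T\<^esub> shm S (\<aa> M N P)"
    and cyc_unit_right:
      "M \<in> cells1 B r r \<Longrightarrow> shm S (\<ll> M) \<cdot>\<^bsub>T\<^esub> \<theta>\<^bsub>S\<^esub> M (\<U> r) = shm S (\<rr> M)"
    and cyc_unit_left:
      "M \<in> cells1 B r r \<Longrightarrow> shm S (\<rr> M) \<cdot>\<^bsub>T\<^esub> \<theta>\<^bsub>S\<^esub> (\<U> r) M = shm S (\<ll> M)"

section \<open>Twisting data and the bicategory of twists\<close>

record ('g, 'o, 'm, 'c) twist_data =
  tw :: "'o \<Rightarrow> 'g \<Rightarrow> 'm" ("\<Theta>\<index>")
  tw_mult :: "'o \<Rightarrow> 'g \<Rightarrow> 'g \<Rightarrow> 'c" ("\<mu>\<index>")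
  tw_unit :: "'o \<Rightarrow> 'c" ("\<eta>\<index>")

text \<open>
  \<open>G\<close> is regarded as a discrete monoidal category, so functoriality of \<open>\<Theta>\<^sub>a\<close> and naturality of
  its structure cells hold automatically; what remains of a strong monoidal functor to
  \<open>Pic(a)\<close> are invertible 1-cells, invertible structure 2-cells, and the coherence equations.
\<close>

locale twisting = bicategory B + G: group G
  for B :: "('o, 'm, 'c, 'z) bicat_scheme" (structure)
    and G :: "('g, 'y) monoid_scheme" +
  fixes K :: "('g, 'o, 'm, 'c) twist_data"
  assumes tw_invertible:
      "\<lbrakk>a \<in> Obj0 B; g \<in> carrier G\<rbrakk> \<Longrightarrow> invertible1 B a (\<Theta>\<^bsub>K\<^esub> a g)"
    and tw_mult_Hom:
      "\<lbrakk>a \<in> Obj0 B; g \<in> carrier G; h \<in> carrier G\<rbrakk>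
       \<Longrightarrow> \<mu>\<^bsub>K\<^esub> a g h \<in> Hom B (\<Theta>\<^bsub>K\<^esub> a g \<odot> \<Theta>\<^bsub>K\<^esub> a h) (\<Theta>\<^bsub>K\<^esub> a (g \<otimes>\<^bsub>G\<^esub> h))"
    and tw_mult_iso:
      "\<lbrakk>a \<in> Obj0 B; g \<in> carrier G; h \<in> carrier G\<rbrakk> \<Longrightarrow> is_iso B (\<mu>\<^bsub>K\<^esub> a g h)"
    and tw_unit_Hom: "a \<in> Obj0 B \<Longrightarrow> \<eta>\<^bsub>K\<^esub> a \<in> Hom B (\<U> a) (\<Theta>\<^bsub>K\<^esub> a \<one>\<^bsub>G\<^esub>)"
    and tw_unit_iso: "a \<in> Obj0 B \<Longrightarrow> is_iso B (\<eta>\<^bsub>K\<^esub> a)"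
    and tw_mult_assoc:
      "\<lbrakk>a \<in> Obj0 B; g \<in> carrier G; h \<in> carrier G; k \<in> carrier G\<rbrakk>
       \<Longrightarrow> \<mu>\<^bsub>K\<^esub> a (g \<otimes>\<^bsub>G\<^esub> h) k \<cdot> (\<mu>\<^bsub>K\<^esub> a g h \<star> \<ii> (\<Theta>\<^bsub>K\<^esub> a k))
         = \<mu>\<^bsub>K\<^esub> a g (h \<otimes>\<^bsub>G\<^esub> k) \<cdot> (\<ii> (\<Theta>\<^bsub>K\<^esub> a g) \<star> \<mu>\<^bsub>K\<^esub> a h k)
           \<cdot> \<aa> (\<Theta>\<^bsub>K\<^esub> a g) (\<Theta>\<^bsub>K\<^esub> a h) (\<Theta>\<^bsub>K\<^esub> a k)"
    and tw_unit_left: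
      "\<lbrakk>a \<in> Obj0 B; g \<in> carrier G\<rbrakk>
       \<Longrightarrow> \<mu>\<^bsub>K\<^esub> a \<one>\<^bsub>G\<^esub> g \<cdot> (\<eta>\<^bsub>K\<^esub> a \<star> \<ii> (\<Theta>\<^bsub>K\<^esub> a g)) = \<ll> (\<Theta>\<^bsub>K\<^esub> a g)"
    and tw_unit_right:
      "\<lbrakk>a \<in> Obj0 B; g \<in> carrier G\<rbrakk>
       \<Longrightarrow> \<mu>\<^bsub>K\<^esub> a g \<one>\<^bsub>G\<^esub> \<cdot> (\<ii> (\<Theta>\<^bsub>K\<^esub> a g) \<star> \<eta>\<^bsub>K\<^esub> a) = \<rr> (\<Theta>\<^bsub>K\<^esub> a g)"

text \<open>
  Types for the cells of the bicategory of twists.  A 1-cell is a pair \<open>(M, \<tau>)\<close>.  A 2-cell is a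
  triple \<open>(X, f, Y)\<close> recording its domain and codomain, since the underlying 2-cell \<open>f\<close> does not
  determine the twist structures.
\<close>

type_synonym ('g, 'm, 'c) twist1 = "'m \<times> ('g \<Rightarrow> 'c)"
type_synonym ('g, 'm, 'c) twist2 = "('g, 'm, 'c) twist1 \<times> 'c \<times> ('g, 'm, 'c) twist1"

context
  fixes B :: "('o, 'm, 'c, 'z) bicat_scheme" (structure)
begin

text \<open>
  The family \<open>\<tau>\<close> is indexed by \<open>carrier G\<close>; it is required to be extensional so that equal
  families are equal functions.
\<close>

definition twist_cells1 ::
  "('g, 'y) monoid_scheme \<Rightarrow> ('g, 'o, 'm, 'c) twist_data \<Rightarrow> ('g, 'm, 'c) twist1 set" where
  "twist_cells1 G K = {(M, \<tau>). \<exists>a b.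
     M \<in> cells1 B a b \<and> \<tau> \<in> extensional (carrier G) \<and>
     (\<forall>g \<in> carrier G.
        \<tau> g \<in> Hom B (\<Theta>\<^bsub>K\<^esub> a g \<odot> M) (M \<odot> \<Theta>\<^bsub>K\<^esub> b g) \<and> is_iso B (\<tau> g)) \<and>
     \<tau> \<one>\<^bsub>G\<^esub> = (\<ii> M \<star> \<eta>\<^bsub>K\<^esub> b) \<cdot> inv_arr B (\<rr> M) \<cdot> \<ll> M \<cdot> (inv_arr B (\<eta>\<^bsub>K\<^esub> a) \<star> \<ii> M) \<and>
     (\<forall>g \<in> carrier G. \<forall>h \<in> carrier G.
        \<tau> (g \<otimes>\<^bsub>G\<^esub> h) =
          (\<ii> M \<star> \<mu>\<^bsub>K\<^esub> b g h) \<cdot> \<aa> M (\<Theta>\<^bsub>K\<^esub> b g) (\<Theta>\<^bsub>K\<^esub> b h)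
          \<cdot> (\<tau> g \<star> \<ii> (\<Theta>\<^bsub>K\<^esub> b h)) \<cdot> inv_arr B (\<aa> (\<Theta>\<^bsub>K\<^esub> a g) M (\<Theta>\<^bsub>K\<^esub> b h))
          \<cdot> (\<ii> (\<Theta>\<^bsub>K\<^esub> a g) \<star> \<tau> h) \<cdot> \<aa> (\<Theta>\<^bsub>K\<^esub> a g) (\<Theta>\<^bsub>K\<^esub> a h) M
          \<cdot> (inv_arr B (\<mu>\<^bsub>K\<^esub> a g h) \<star> \<ii> M))}"

definition twist_compatible ::
  "('g, 'y) monoid_scheme \<Rightarrow> ('g, 'o, 'm, 'c) twist_data
    \<Rightarrow> ('g, 'm, 'c) twist1 \<Rightarrow> 'c \<Rightarrow> ('g, 'm, 'c) twist1 \<Rightarrow> bool" where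
  "twist_compatible G K X f Y \<longleftrightarrow>
     f \<in> Hom B (fst X) (fst Y) \<and>
     (\<forall>g \<in> carrier G.
        snd Y g \<cdot> (\<ii> (\<Theta>\<^bsub>K\<^esub> (Src B (fst X)) g) \<star> f)
        = (f \<star> \<ii> (\<Theta>\<^bsub>K\<^esub> (Trg B (fst X)) g)) \<cdot> snd X g)"

definition twist_comp1 ::
  "('g, 'y) monoid_scheme \<Rightarrow> ('g, 'o, 'm, 'c) twist_data
    \<Rightarrow> ('g, 'm, 'c) twist1 \<Rightarrow> ('g, 'm, 'c) twist1 \<Rightarrow> ('g, 'm, 'c) twist1" where
  "twist_comp1 G K = (\<lambda>(M, \<tau>) (N, \<sigma>).
     (M \<odot> N,
      \<lambda>g \<in> carrier G.
        inv_arr B (\<aa> M N (\<Theta>\<^bsub>K\<^esub> (Trg B N) g)) \<cdot> (\<ii> M \<star> \<sigma> g)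
        \<cdot> \<aa> M (\<Theta>\<^bsub>K\<^esub> (Src B N) g) N \<cdot> (\<tau> g \<star> \<ii> N)
        \<cdot> inv_arr B (\<aa> (\<Theta>\<^bsub>K\<^esub> (Src B M) g) M N)))"

definition twist_unit ::
  "('g, 'y) monoid_scheme \<Rightarrow> ('g, 'o, 'm, 'c) twist_data \<Rightarrow> 'o \<Rightarrow> ('g, 'm, 'c) twist1" where
  "twist_unit G K a =
     (\<U> a, \<lambda>g \<in> carrier G. inv_arr B (\<ll> (\<Theta>\<^bsub>K\<^esub> a g)) \<cdot> \<rr> (\<Theta>\<^bsub>K\<^esub> a g))"

definition twist_bicat ::
  "('g, 'y) monoid_scheme \<Rightarrow> ('g, 'o, 'm, 'c) twist_data
    \<Rightarrow> ('o, ('g, 'm, 'c) twist1, ('g, 'm, 'c) twist2) bicat" where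
  "twist_bicat G K =
     (let comp1 = twist_comp1 G K; unit = twist_unit G K in
      \<lparr>Ob = twist_cells1 G K,
       Ar = {(X, f, Y). X \<in> twist_cells1 G K \<and> Y \<in> twist_cells1 G K
                          \<and> twist_compatible G K X f Y},
       Dom = (\<lambda>(X, f, Y). X),
       Cod = (\<lambda>(X, f, Y). Y),
       ident = (\<lambda>X. (X, \<ii> (fst X), X)),
       comp = (\<lambda>(Y', k, Z) (X, f, Y). (X, k \<cdot> f, Z)),
       Obj0 = Obj0 B,
       Src = (\<lambda>X. Src B (fst X)),
       Trg = (\<lambda>X. Trg B (fst X)),
       unit1 = unit,
       hcomp1 = comp1,
       hcomp2 = (\<lambda>(X, f, X') (Y, k, Y'). (comp1 X Y, f \<star> k, comp1 X' Y')),
       asc = (\<lambda>X Y Z. (comp1 (comp1 X Y) Z, \<aa> (fst X) (fst Y) (fst Z), comp1 X (comp1 Y Z))),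
       lun = (\<lambda>X. (comp1 (unit (Src B (fst X))) X, \<ll> (fst X), X)),
       run = (\<lambda>X. (comp1 X (unit (Trg B (fst X))), \<rr> (fst X), X))\<rparr>)"

section \<open>Twisted shadow and twisted trace\<close>

definition twisted_sh ::
  "('g, 'y) monoid_scheme \<Rightarrow> ('g, 'o, 'm, 'c) twist_data
    \<Rightarrow> ('m, 'c, 'x, 'f) shadow_data \<Rightarrow> 'g \<Rightarrow> ('g, 'm, 'c) twist1 \<Rightarrow> 'x" where
  "twisted_sh G K S g X = sh S (\<Theta>\<^bsub>K\<^esub> (Src B (fst X)) (inv\<^bsub>G\<^esub> g) \<odot> fst X)"

definition twisted_shm ::
  "('g, 'y) monoid_scheme \<Rightarrow> ('g, 'o, 'm, 'c) twist_data
    \<Rightarrow> ('m, 'c, 'x, 'f) shadow_data \<Rightarrow> 'g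
    \<Rightarrow> ('g, 'm, 'c) twist2 \<Rightarrow> 'f" where
  "twisted_shm G K S g \<phi> =
     shm S (\<ii> (\<Theta>\<^bsub>K\<^esub> (Src B (fst (fst \<phi>))) (inv\<^bsub>G\<^esub> g)) \<star> fst (snd \<phi>))"

definition transport ::
  "('g, 'y) monoid_scheme \<Rightarrow> 'g \<Rightarrow> ('g, 'm, 'c) twist1 \<Rightarrow> 'c" where
  "transport G g X = inv_arr B (snd X (inv\<^bsub>G\<^esub> g))"

text \<open>
  For \<open>X = (M, _) : r \<rightarrow> s\<close> and \<open>Y = (N, _) : s \<rightarrow> r\<close>, with the associators written out:
  \<open>\<Theta>\<^sub>r \<odot> (M \<odot> N) \<rightarrow> (\<Theta>\<^sub>r \<odot> M) \<odot> N \<rightarrow> N \<odot> (\<Theta>\<^sub>r \<odot> M) \<rightarrow> (N \<odot> \<Theta>\<^sub>r) \<odot> M \<rightarrow> (\<Theta>\<^sub>s \<odot> N) \<odot> M \<rightarrow> \<Theta>\<^sub>s \<odot> (N \<odot> M)\<close>.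
\<close>

definition twisted_cyc ::
  "('g, 'y) monoid_scheme \<Rightarrow> ('g, 'o, 'm, 'c) twist_data
    \<Rightarrow> ('x, 'f, 'w) cat_scheme \<Rightarrow> ('m, 'c, 'x, 'f) shadow_data \<Rightarrow> 'g
    \<Rightarrow> ('g, 'm, 'c) twist1 \<Rightarrow> ('g, 'm, 'c) twist1 \<Rightarrow> 'f" where
  "twisted_cyc G K T S g X Y =
     (let M = fst X; N = fst Y;
          \<Theta>r = \<Theta>\<^bsub>K\<^esub> (Src B M) (inv\<^bsub>G\<^esub> g); \<Theta>s = \<Theta>\<^bsub>K\<^esub> (Src B N) (inv\<^bsub>G\<^esub> g) in
      shm S (\<aa> \<Theta>s N M) \<cdot>\<^bsub>T\<^esub> shm S (transport G g Y \<star> \<ii> M)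
      \<cdot>\<^bsub>T\<^esub> shm S (inv_arr B (\<aa> N \<Theta>r M)) \<cdot>\<^bsub>T\<^esub> \<theta>\<^bsub>S\<^esub> (\<Theta>r \<odot> M) N \<cdot>\<^bsub>T\<^esub> shm S (inv_arr B (\<aa> \<Theta>r M N)))"

text \<open>
  The trace of \<open>f : X \<Rightarrow> X\<close> is computed with explicit duality data \<open>(X', coev, ev)\<close> for \<open>X\<close>
  in the bicategory of twists.
\<close>

definition twisted_trace ::
  "('g, 'y) monoid_scheme \<Rightarrow> ('g, 'o, 'm, 'c) twist_data
    \<Rightarrow> ('x, 'f, 'w) cat_scheme \<Rightarrow> ('m, 'c, 'x, 'f) shadow_data \<Rightarrow> 'g
    \<Rightarrow> ('g, 'm, 'c) twist1 \<Rightarrow> ('g, 'm, 'c) twist1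
    \<Rightarrow> ('g, 'm, 'c) twist2 \<Rightarrow> ('g, 'm, 'c) twist2
    \<Rightarrow> ('g, 'm, 'c) twist2 \<Rightarrow> 'f" where
  "twisted_trace G K T S g X X' coev ev f =
     (let W = twist_bicat G K in
      twisted_shm G K S g ev \<cdot>\<^bsub>T\<^esub> twisted_cyc G K T S g X' X
      \<cdot>\<^bsub>T\<^esub> twisted_shm G K S g (ident W X' \<star>\<^bsub>W\<^esub> f) \<cdot>\<^bsub>T\<^esub> twisted_shm G K S g coev)"

end

end

theory Submission
  imports Defs
begin

text \<open>
  Suppress the constraint cells, let \<open>\<Theta>\<close> be the twisting 1-cell at the inverse of \<open>g\<close>, and let
  \<open>t : X \<odot> \<Theta> \<Rightarrow> \<Theta> \<odot> X\<close> be the transport of \<open>X\<close>.  The twisted trace of \<open>f\<close> on \<open>X\<close> creates \<open>X' \<odot> X\<close> next to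
  \<open>\<Theta>\<close>, applies \<open>f\<close>, rotates \<open>\<Theta> \<odot> X'\<close> past \<open>X\<close>, moves \<open>\<Theta>\<close> back to the left by \<open>t\<close>, and contracts \<open>X \<odot> X'\<close>.
  The twisted cyclicity does not satisfy the hexagon in general, as the two successive rotations on
  one side twist a cell more often than the single rotation on the other.  The proof therefore
  works with the cyclicity of the given shadow and treats \<open>t\<close> as an arbitrary 2-cell.

  First, the hexagon and the unit axiom show that \<open>\<Theta>\<close> need not move in the rotation: the trace is
  a rotation of \<open>X'\<close> alone past \<open>X \<odot> \<Theta>\<close>, between a half \<open>trace_in\<close> that creates \<open>X' \<odot> X\<close> and a half
  \<open>trace_out\<close> that contracts \<open>X \<odot> X'\<close> (\<open>shadow_trace_eq\<close>).  The composite \<open>X \<odot> Y\<close> has dual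
  \<open>Y' \<odot> X'\<close>, and its transport passes \<open>Y\<close> and then \<open>X\<close>.  By the hexagon, the rotation of \<open>Y' \<odot> X'\<close> is
  that of \<open>Y'\<close> followed by that of \<open>X'\<close>.  Naturality of the two rotations delays the creation of
  \<open>X' \<odot> X\<close> until after the first, and advances the contraction of \<open>Y \<odot> Y'\<close> to before the second.
  Between the rotations creation and contraction take place in different parts of the word and
  can be exchanged, so that the loop of \<open>Y\<close> is closed before the loop of \<open>X\<close> is opened
  (\<open>shadow_trace_composite\<close>).  This is the composite of the two traces.

  Any other dual of \<open>X \<odot> Y\<close> gives the same trace: two duals are related by a 2-cell compatible
  with units and counits, which naturality carries through the rotation
  (\<open>shadow_trace_dual_unique\<close>).

  The dual of \<open>X \<odot> Y\<close> exists already among twisted 1-cells, since composites of twists are twists and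
  all cells involved in the construction are compatible with them (\<open>left_dual_twist_comp\<close>).

  The remaining work is coherence.  It is done by a faithful strict form of pasting diagrams
  (\<open>strict_faithful\<close>), in which associators and unitors are identities and the equations above are
  calculations with naturality and the zigzag identities only.
\<close>

section \<open>Categories: composable arrows and inverses\<close>

context category
begin

lemma ident_typing [simp]:
  assumes "x \<in> Ob C"
  shows "\<ii> x \<in> Ar C" "Dom C (\<ii> x) = x" "Cod C (\<ii> x) = x"
  using ident_Hom[OF assms] by (auto simp: Hom_def)

lemma comp_typing [simp]:
  assumes "k \<in> Ar C" "f \<in> Ar C" "Dom C k = Cod C f"
  shows "k \<cdot> f \<in> Ar C" "Dom C (k \<cdot> f) = Dom C f" "Cod C (k \<cdot> f) = Cod C k"
  using comp_Hom[of f "Dom C f" "Cod C f" k "Cod C k"] assms by (auto simp: Hom_def)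

lemma comp_ident_Dom [simp]: "f \<in> Ar C \<Longrightarrow> Dom C f = x \<Longrightarrow> f \<cdot> \<ii> x = f"
  by (rule comp_ident[of f x "Cod C f"]) (auto simp: Hom_def)

lemma ident_Cod_comp [simp]: "f \<in> Ar C \<Longrightarrow> Cod C f = x \<Longrightarrow> \<ii> x \<cdot> f = f"
  by (rule ident_comp[of f "Dom C f" x]) (auto simp: Hom_def)

text \<open>
  Typing is phrased through \<open>Dom\<close> and \<open>Cod\<close> rather than through \<open>Hom\<close>, so that composability is a
  set of equations the simplifier can discharge by itself; composites are then kept nested to the
  right.
\<close>
lemma comp_assoc_composable [simp]:
  assumes "f \<in> Ar C" "k \<in> Ar C" "h \<in> Ar C" "Dom C k = Cod C f" "Dom C h = Cod C k"
  shows "(h \<cdot> k) \<cdot> f = h \<cdot> k \<cdot> f"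
  by (rule comp_assoc[of f "Dom C f" "Cod C f" k "Cod C k" h "Cod C h"])
    (use assms in \<open>auto simp: Hom_def\<close>)

lemmas Dom_Cod_Ob [simp] = Dom_Ob Cod_Ob

lemma are_inverse_unique: "are_inverse C f k \<Longrightarrow> are_inverse C f k' \<Longrightarrow> k = k'"
  unfolding are_inverse_def Hom_def
  by (metis (mono_tags, lifting) comp_assoc_composable comp_ident_Dom ident_Cod_comp mem_Collect_eq)

lemma are_inverse_imp_inv_arr: "are_inverse C f k \<Longrightarrow> inv_arr C f = k"
  unfolding inv_arr_def by (rule the_equality) (auto intro: are_inverse_unique)

lemma is_iso_inverse: "is_iso C f \<Longrightarrow> are_inverse C f (inv_arr C f)"
  unfolding is_iso_def using are_inverse_imp_inv_arr by metis

lemma inv_arr_typing [simp]: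
  assumes "is_iso C f"
  shows "inv_arr C f \<in> Ar C" "Dom C (inv_arr C f) = Cod C f" "Cod C (inv_arr C f) = Dom C f"
    "inv_arr C f \<cdot> f = \<ii> (Dom C f)" "f \<cdot> inv_arr C f = \<ii> (Cod C f)"
  using is_iso_inverse[OF assms] by (auto simp: are_inverse_def Hom_def)

lemma is_iso_Ar: "is_iso C f \<Longrightarrow> f \<in> Ar C"
  by (auto simp: is_iso_def are_inverse_def)

lemma inv_arr_cancel [simp]:
  assumes "is_iso C f" "x \<in> Ar C"
  shows "Cod C x = Dom C f \<Longrightarrow> inv_arr C f \<cdot> f \<cdot> x = x"
    "Cod C x = Cod C f \<Longrightarrow> f \<cdot> inv_arr C f \<cdot> x = x"
  using assms is_iso_Ar[OF assms(1)] by (simp_all flip: comp_assoc_composable)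

lemma inv_arrI:
  assumes "f \<in> Ar C" "k \<in> Ar C" "Dom C k = Cod C f" "Cod C k = Dom C f"
    "k \<cdot> f = \<ii> (Dom C f)" "f \<cdot> k = \<ii> (Cod C f)"
  shows "is_iso C f" "inv_arr C f = k"
proof -
  have "are_inverse C f k" using assms by (auto simp: are_inverse_def Hom_def)
  then show "is_iso C f" "inv_arr C f = k"
    by (auto simp: is_iso_def are_inverse_imp_inv_arr)
qed

lemma is_iso_ident [simp]: "x \<in> Ob C \<Longrightarrow> is_iso C (\<ii> x)" "x \<in> Ob C \<Longrightarrow> inv_arr C (\<ii> x) = \<ii> x"
  by (simp_all add: inv_arrI[of "\<ii> x" "\<ii> x"])

lemma is_iso_comp:
  assumes "is_iso C f" "is_iso C k" "Dom C k = Cod C f"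
  shows "is_iso C (k \<cdot> f)" "inv_arr C (k \<cdot> f) = inv_arr C f \<cdot> inv_arr C k"
  using assms by (auto intro!: inv_arrI[of _ "inv_arr C f \<cdot> inv_arr C k"] simp: is_iso_Ar)

lemma iso_inv_arr: "is_iso C f \<Longrightarrow> is_iso C (inv_arr C f)"
  by (rule inv_arrI(1)[of _ f]) (auto simp: is_iso_Ar)

lemma iso_cancel_right:
  assumes "is_iso C f" "x \<in> Ar C" "y \<in> Ar C" "Dom C x = Cod C f" "Dom C y = Cod C f"
    "x \<cdot> f = y \<cdot> f"
  shows "x = y"
proof -
  have "(x \<cdot> f) \<cdot> inv_arr C f = (y \<cdot> f) \<cdot> inv_arr C f" by (simp only: assms(6))
  then show ?thesis using assms(1-5) is_iso_Ar[OF assms(1)] by simp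
qed

lemma iso_cancel_left:
  assumes "is_iso C f" "x \<in> Ar C" "y \<in> Ar C" "Cod C x = Dom C f" "Cod C y = Dom C f"
    "f \<cdot> x = f \<cdot> y"
  shows "x = y"
proof -
  have "inv_arr C f \<cdot> f \<cdot> x = inv_arr C f \<cdot> f \<cdot> y" by (simp only: assms(6))
  then show ?thesis using assms(1-5) by simp
qed

end

section \<open>Bicategories: typing and whiskering\<close>

context bicategory
begin

lemma Src_Trg_Obj0 [simp]: "M \<in> Ob B \<Longrightarrow> Src B M \<in> Obj0 B" "M \<in> Ob B \<Longrightarrow> Trg B M \<in> Obj0 B"
  by (auto intro: Src_Obj0 Trg_Obj0)

lemma Src_Trg_Cod [simp]:
  "f \<in> Ar B \<Longrightarrow> Src B (Cod B f) = Src B (Dom B f)"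
  "f \<in> Ar B \<Longrightarrow> Trg B (Cod B f) = Trg B (Dom B f)"
  by (auto simp: Src_parallel Trg_parallel)

lemma unit1_typing [simp]:
  assumes "a \<in> Obj0 B"
  shows "\<U> a \<in> Ob B" "Src B (\<U> a) = a" "Trg B (\<U> a) = a"
  using unit1_cell[OF assms] by (auto simp: cells1_def)

lemma hcomp1_typing [simp]:
  assumes "M \<in> Ob B" "N \<in> Ob B" "Trg B M = Src B N"
  shows "M \<odot> N \<in> Ob B" "Src B (M \<odot> N) = Src B M" "Trg B (M \<odot> N) = Trg B N"
  using hcomp1_cell[of M "Src B M" "Trg B M" N "Trg B N"] assms by (auto simp: cells1_def)

lemma hcomp2_typing [simp]:
  assumes "f \<in> Ar B" "k \<in> Ar B" "Trg B (Dom B f) = Src B (Dom B k)"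
  shows "f \<star> k \<in> Ar B" "Dom B (f \<star> k) = Dom B f \<odot> Dom B k" "Cod B (f \<star> k) = Cod B f \<odot> Cod B k"
  using hcomp2_Hom[of "Dom B f" "Src B (Dom B f)" "Trg B (Dom B f)" "Dom B k" "Trg B (Dom B k)"
      f "Cod B f" k "Cod B k"] assms
  by (auto simp: cells1_def Hom_def)

lemma ident_hcomp2_ident [simp]:
  "M \<in> Ob B \<Longrightarrow> N \<in> Ob B \<Longrightarrow> Trg B M = Src B N \<Longrightarrow> \<ii> M \<star> \<ii> N = \<ii> (M \<odot> N)"
  by (rule hcomp2_ident) (auto simp: cells1_def)

lemma comp_hcomp2_comp:
  assumes "f \<in> Ar B" "f' \<in> Ar B" "k \<in> Ar B" "k' \<in> Ar B"
    "Dom B f' = Cod B f" "Dom B k' = Cod B k" "Trg B (Dom B f) = Src B (Dom B k)"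
  shows "(f' \<star> k') \<cdot> (f \<star> k) = (f' \<cdot> f) \<star> (k' \<cdot> k)"
  by (rule interchange[symmetric, of "Dom B f" "Src B (Dom B f)" "Trg B (Dom B f)" "Dom B k"
        "Trg B (Dom B k)" _ "Cod B f" _ "Cod B f'" _ "Cod B k" _ "Cod B k'"])
    (use assms in \<open>auto simp: cells1_def Hom_def\<close>)

lemma comp_hcomp2_comp_rest:
  assumes "f \<in> Ar B" "f' \<in> Ar B" "k \<in> Ar B" "k' \<in> Ar B"
    "Dom B f' = Cod B f" "Dom B k' = Cod B k" "Trg B (Dom B f) = Src B (Dom B k)"
    "x \<in> Ar B" "Cod B x = Dom B f \<odot> Dom B k"
  shows "(f' \<star> k') \<cdot> (f \<star> k) \<cdot> x = ((f' \<cdot> f) \<star> (k' \<cdot> k)) \<cdot> x"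
  using assms by (simp flip: comp_hcomp2_comp)

lemma whisker_comp:
  assumes "M \<in> Ob B" "f \<in> Ar B" "k \<in> Ar B" "Dom B k = Cod B f"
  shows "Trg B M = Src B (Dom B f) \<Longrightarrow> \<ii> M \<star> (k \<cdot> f) = (\<ii> M \<star> k) \<cdot> (\<ii> M \<star> f)"
    "Trg B (Dom B f) = Src B M \<Longrightarrow> (k \<cdot> f) \<star> \<ii> M = (k \<star> \<ii> M) \<cdot> (f \<star> \<ii> M)"
  using assms by (simp_all add: comp_hcomp2_comp)

lemma is_iso_hcomp2:
  assumes "is_iso B f" "is_iso B k" "Trg B (Dom B f) = Src B (Dom B k)"
  shows "is_iso B (f \<star> k)" "inv_arr B (f \<star> k) = inv_arr B f \<star> inv_arr B k"
  using assms
  by (auto intro!: inv_arrI[of _ "inv_arr B f \<star> inv_arr B k"] simp: is_iso_Ar comp_hcomp2_comp)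

lemma asc_typing [simp]:
  assumes "M \<in> Ob B" "N \<in> Ob B" "P \<in> Ob B" "Trg B M = Src B N" "Trg B N = Src B P"
  shows "\<aa> M N P \<in> Ar B" "Dom B (\<aa> M N P) = M \<odot> N \<odot> P" "Cod B (\<aa> M N P) = M \<odot> (N \<odot> P)"
    "is_iso B (\<aa> M N P)"
  using asc_Hom[of M "Src B M" "Trg B M" N "Trg B N" P "Trg B P"]
    asc_iso[of M "Src B M" "Trg B M" N "Trg B N" P "Trg B P"] assms
  by (auto simp: cells1_def Hom_def)

lemma unitor_typing [simp]:
  assumes "M \<in> Ob B"
  shows "\<ll> M \<in> Ar B" "Dom B (\<ll> M) = \<U> (Src B M) \<odot> M" "Cod B (\<ll> M) = M"
    "is_iso B (\<ll> M)"
    "\<rr> M \<in> Ar B" "Dom B (\<rr> M) = M \<odot> \<U> (Trg B M)" "Cod B (\<rr> M) = M" "is_iso B (\<rr> M)"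
  using lun_Hom[of M "Src B M" "Trg B M"] lun_iso[of M "Src B M" "Trg B M"]
    run_Hom[of M "Src B M" "Trg B M"] run_iso[of M "Src B M" "Trg B M"] assms
  by (auto simp: cells1_def Hom_def)

lemma asc_nat:
  assumes "f \<in> Ar B" "k \<in> Ar B" "h \<in> Ar B"
    "Trg B (Dom B f) = Src B (Dom B k)" "Trg B (Dom B k) = Src B (Dom B h)"
  shows "\<aa> (Cod B f) (Cod B k) (Cod B h) \<cdot> ((f \<star> k) \<star> h)
    = (f \<star> (k \<star> h)) \<cdot> \<aa> (Dom B f) (Dom B k) (Dom B h)"
  by (rule asc_natural[of "Dom B f" "Src B (Dom B f)" "Trg B (Dom B f)" "Dom B k" "Trg B (Dom B k)"
        "Dom B h" "Trg B (Dom B h)"]) (use assms in \<open>auto simp: cells1_def Hom_def\<close>)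

lemma lun_nat: "f \<in> Ar B \<Longrightarrow> \<ll> (Cod B f) \<cdot> (\<ii> (\<U> (Src B (Dom B f))) \<star> f) = f \<cdot> \<ll> (Dom B f)"
  by (rule lun_natural[of "Dom B f" "Src B (Dom B f)" "Trg B (Dom B f)"])
    (auto simp: cells1_def Hom_def)

lemma run_nat: "f \<in> Ar B \<Longrightarrow> \<rr> (Cod B f) \<cdot> (f \<star> \<ii> (\<U> (Trg B (Dom B f)))) = f \<cdot> \<rr> (Dom B f)"
  by (rule run_natural[of "Dom B f" "Src B (Dom B f)" "Trg B (Dom B f)"])
    (auto simp: cells1_def Hom_def)

lemma pentagon_Ob:
  assumes "M \<in> Ob B" "N \<in> Ob B" "P \<in> Ob B" "Q \<in> Ob B"
    "Trg B M = Src B N" "Trg B N = Src B P" "Trg B P = Src B Q"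
  shows "\<aa> M N (P \<odot> Q) \<cdot> \<aa> (M \<odot> N) P Q
         = (\<ii> M \<star> \<aa> N P Q) \<cdot> \<aa> M (N \<odot> P) Q \<cdot> (\<aa> M N P \<star> \<ii> Q)"
  by (rule pentagon[of M "Src B M" "Trg B M" N "Trg B N" P "Trg B P" Q "Trg B Q"])
    (use assms in \<open>auto simp: cells1_def\<close>)

lemma triangle_Ob:
  assumes "M \<in> Ob B" "N \<in> Ob B" "Trg B M = Src B N"
  shows "(\<ii> M \<star> \<ll> N) \<cdot> \<aa> M (\<U> (Src B N)) N = \<rr> M \<star> \<ii> N"
  by (rule triangle[of M "Src B M" "Src B N" N "Trg B N"])
    (use assms in \<open>auto simp: cells1_def\<close>)

lemma unit_whisker_faithful:
  assumes "f \<in> Ar B" "k \<in> Ar B" "Dom B f = Dom B k" "Cod B f = Cod B k"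
  shows "\<ii> (\<U> (Src B (Dom B f))) \<star> f = \<ii> (\<U> (Src B (Dom B f))) \<star> k \<Longrightarrow> f = k"
    "f \<star> \<ii> (\<U> (Trg B (Dom B f))) = k \<star> \<ii> (\<U> (Trg B (Dom B f))) \<Longrightarrow> f = k"
proof -
  show "f = k" if "\<ii> (\<U> (Src B (Dom B f))) \<star> f = \<ii> (\<U> (Src B (Dom B f))) \<star> k"
    using lun_nat[of f] lun_nat[of k] assms that
    by (intro iso_cancel_right[of "\<ll> (Dom B f)" f k]) auto
  show "f = k" if "f \<star> \<ii> (\<U> (Trg B (Dom B f))) = k \<star> \<ii> (\<U> (Trg B (Dom B f)))"
    using run_nat[of f] run_nat[of k] assms that
    by (intro iso_cancel_right[of "\<rr> (Dom B f)" f k]) auto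
qed

text \<open>
  The compatibility of the left unitor with the associator is not an axiom but a consequence of
  the pentagon and the triangle, by Kelly's argument: after whiskering with the unit 1-cell, both
  sides appear in a pentagon whose other faces commute, and whiskering with a unit is faithful.
\<close>

lemma lun_hcomp1:
  assumes [simp]: "M \<in> Ob B" "N \<in> Ob B" "Trg B M = Src B N"
  shows "\<ll> (M \<odot> N) \<cdot> \<aa> (\<U> (Src B M)) M N = \<ll> M \<star> \<ii> N"
proof -
  define U where "U = \<U> (Src B M)"
  have U [simp]: "U \<in> Ob B" "Src B U = Src B M" "Trg B U = Src B M" by (simp_all add: U_def)
  have dl [simp]: "Dom B (\<ll> M) = U \<odot> M" "Dom B (\<ll> (M \<odot> N)) = U \<odot> (M \<odot> N)"
    by (simp_all add: U_def)
  have "((\<ii> U \<star> \<ll> (M \<odot> N)) \<cdot> (\<ii> U \<star> \<aa> U M N)) \<cdot> \<aa> U (U \<odot> M) N \<cdot> (\<aa> U U M \<star> \<ii> N)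
      = (\<ii> U \<star> \<ll> (M \<odot> N)) \<cdot> \<aa> U U (M \<odot> N) \<cdot> \<aa> (U \<odot> U) M N"
    by (simp add: pentagon_Ob)
  also have "\<dots> = ((\<ii> U \<star> \<ll> (M \<odot> N)) \<cdot> \<aa> U U (M \<odot> N)) \<cdot> \<aa> (U \<odot> U) M N"
    by simp
  also have "\<dots> = (\<rr> U \<star> (\<ii> M \<star> \<ii> N)) \<cdot> \<aa> (U \<odot> U) M N"
    using triangle_Ob[of U "M \<odot> N"] by (simp add: U_def)
  also have "\<dots> = \<aa> U M N \<cdot> ((\<rr> U \<star> \<ii> M) \<star> \<ii> N)"
    using asc_nat[of "\<rr> U" "\<ii> M" "\<ii> N"] by (simp add: U_def)
  also have "\<dots> = \<aa> U M N \<cdot> ((\<ii> U \<star> \<ll> M) \<star> \<ii> N) \<cdot> (\<aa> U U M \<star> \<ii> N)"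
    using triangle_Ob[of U M] by (simp add: U_def comp_hcomp2_comp)
  also have "\<dots> = (\<aa> U M N \<cdot> ((\<ii> U \<star> \<ll> M) \<star> \<ii> N)) \<cdot> (\<aa> U U M \<star> \<ii> N)"
    by simp
  also have "\<dots> = (\<ii> U \<star> (\<ll> M \<star> \<ii> N)) \<cdot> \<aa> U (U \<odot> M) N \<cdot> (\<aa> U U M \<star> \<ii> N)"
    using asc_nat[of "\<ii> U" "\<ll> M" "\<ii> N"] by simp
  finally have "(\<ii> U \<star> \<ll> (M \<odot> N)) \<cdot> (\<ii> U \<star> \<aa> U M N) = \<ii> U \<star> (\<ll> M \<star> \<ii> N)"
    by (rule iso_cancel_right[rotated -1]) (simp_all add: is_iso_comp is_iso_hcomp2)
  then have "\<ii> U \<star> (\<ll> (M \<odot> N) \<cdot> \<aa> U M N) = \<ii> U \<star> (\<ll> M \<star> \<ii> N)"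
    by (simp add: comp_hcomp2_comp)
  then show ?thesis
    using unit_whisker_faithful(1)[of "\<ll> (M \<odot> N) \<cdot> \<aa> U M N" "\<ll> M \<star> \<ii> N"]
    by (simp add: U_def)
qed

end

section \<open>Coherence\<close>

text \<open>
  Every bracketed word \<open>s\<close> of 1-cells acts on the 1-cells \<open>P\<close> that can follow it: \<open>act1 s P\<close> puts the
  letters of \<open>s\<close> one after another in front of \<open>P\<close>, forgetting the brackets and the units of \<open>s\<close>.
  The cells \<open>rebracket s P\<close> from \<open>cell s \<odot> P\<close> to \<open>act1 s P\<close> are isomorphisms, natural in \<open>P\<close>, and
  conjugating a whiskered 2-cell \<open>f \<star> \<ii> P\<close> with them yields its strict form.  In strict form all
  associators and unitors are identities; for the associator this is the pentagon, for the left
  unitor Kelly's lemma and for the right unitor the triangle.  As a 2-cell is determined by its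
  strict forms, an equation between pasted 2-cells may be checked after all constraint cells have
  been erased.  The variable 1-cell \<open>P\<close> on the right is what makes this work without strictifying
  the bicategory: horizontal composition becomes composition of actions, which is strictly
  associative, and the interchange law becomes naturality in \<open>P\<close>.

  \<open>Empt\<close> carries its 0-cell, because the unit 1-cell it stands for depends on it.
\<close>
datatype ('o, 'm) bword =
  Atom 'm
| Empt 'o
| Join "('o, 'm) bword" "('o, 'm) bword" (infixl "\<diamondop>" 70)

context bicategory
begin

primrec cell :: "('o, 'm) bword \<Rightarrow> 'm" where
  "cell (Atom M) = M"
| "cell (Empt a) = \<U> a"
| "cell (s \<diamondop> t) = cell s \<odot> cell t"

primrec wf_word :: "('o, 'm) bword \<Rightarrow> bool" where
  "wf_word (Atom M) \<longleftrightarrow> M \<in> Ob B"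
| "wf_word (Empt a) \<longleftrightarrow> a \<in> Obj0 B"
| "wf_word (s \<diamondop> t) \<longleftrightarrow> wf_word s \<and> wf_word t \<and> Trg B (cell s) = Src B (cell t)"

primrec act1 :: "('o, 'm) bword \<Rightarrow> 'm \<Rightarrow> 'm" where
  "act1 (Atom M) P = M \<odot> P"
| "act1 (Empt a) P = P"
| "act1 (s \<diamondop> t) P = act1 s (act1 t P)"

primrec act2 :: "('o, 'm) bword \<Rightarrow> 'c \<Rightarrow> 'c" where
  "act2 (Atom M) h = \<ii> M \<star> h"
| "act2 (Empt a) h = h"
| "act2 (s \<diamondop> t) h = act2 s (act2 t h)"

primrec rebracket :: "('o, 'm) bword \<Rightarrow> 'm \<Rightarrow> 'c" where
  "rebracket (Atom M) P = \<ii> (M \<odot> P)"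
| "rebracket (Empt a) P = \<ll> P"
| "rebracket (s \<diamondop> t) P
     = rebracket s (act1 t P) \<cdot> (\<ii> (cell s) \<star> rebracket t P) \<cdot> \<aa> (cell s) (cell t) P"

lemma cell_Ob [simp]: "wf_word s \<Longrightarrow> cell s \<in> Ob B"
  by (induction s) auto

lemma act1_typing [simp]:
  assumes "wf_word s" "P \<in> Ob B" "Src B P = Trg B (cell s)"
  shows "act1 s P \<in> Ob B" "Src B (act1 s P) = Src B (cell s)" "Trg B (act1 s P) = Trg B P"
  using assms by (induction s arbitrary: P) auto

lemma act2_typing [simp]:
  assumes "wf_word s" "h \<in> Ar B" "Src B (Dom B h) = Trg B (cell s)"
  shows "act2 s h \<in> Ar B" "Dom B (act2 s h) = act1 s (Dom B h)"
    "Cod B (act2 s h) = act1 s (Cod B h)"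
  using assms by (induction s arbitrary: h) auto

lemma act2_ident [simp]:
  assumes "wf_word s" "P \<in> Ob B" "Src B P = Trg B (cell s)"
  shows "act2 s (\<ii> P) = \<ii> (act1 s P)"
  using assms by (induction s arbitrary: P) auto

lemma rebracket_typing [simp]:
  assumes "wf_word s" "P \<in> Ob B" "Src B P = Trg B (cell s)"
  shows "rebracket s P \<in> Ar B" "Dom B (rebracket s P) = cell s \<odot> P"
    "Cod B (rebracket s P) = act1 s P" "is_iso B (rebracket s P)"
  using assms by (induction s arbitrary: P) (auto simp: is_iso_hcomp2 is_iso_comp)

text \<open>
  Naturality in the 1-cell acted on is inherited along the bracketing from naturality of the
  associator and the left unitor.
\<close>
lemma rebracket_nat:
  assumes "wf_word s" "h \<in> Ar B" "Src B (Dom B h) = Trg B (cell s)"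
  shows "rebracket s (Cod B h) \<cdot> (\<ii> (cell s) \<star> h) = act2 s h \<cdot> rebracket s (Dom B h)"
  using assms
proof (induction s arbitrary: h)
  case (Empt a)
  then show ?case using lun_nat[of h] by simp
next
  case (Join s t)
  then have [simp]: "wf_word s" "wf_word t" "Trg B (cell s) = Src B (cell t)" "h \<in> Ar B"
    "Src B (Dom B h) = Trg B (cell t)" by auto
  let ?P = "Dom B h" and ?P' = "Cod B h"
  have "rebracket (s \<diamondop> t) ?P' \<cdot> (\<ii> (cell (s \<diamondop> t)) \<star> h)
      = rebracket s (act1 t ?P') \<cdot> (\<ii> (cell s) \<star> rebracket t ?P')
        \<cdot> \<aa> (cell s) (cell t) ?P' \<cdot> ((\<ii> (cell s) \<star> \<ii> (cell t)) \<star> h)"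
    by simp
  also have "\<dots> = rebracket s (act1 t ?P') \<cdot> (\<ii> (cell s) \<star> rebracket t ?P')
        \<cdot> (\<ii> (cell s) \<star> (\<ii> (cell t) \<star> h)) \<cdot> \<aa> (cell s) (cell t) ?P"
    using asc_nat[of "\<ii> (cell s)" "\<ii> (cell t)" h] by simp
  also have "\<dots> = rebracket s (act1 t ?P') \<cdot> (\<ii> (cell s) \<star> act2 t h)
        \<cdot> (\<ii> (cell s) \<star> rebracket t ?P) \<cdot> \<aa> (cell s) (cell t) ?P"
    using Join.IH(2)[of h] by (simp add: comp_hcomp2_comp_rest)
  also have "\<dots> = (rebracket s (act1 t ?P') \<cdot> (\<ii> (cell s) \<star> act2 t h))
        \<cdot> (\<ii> (cell s) \<star> rebracket t ?P) \<cdot> \<aa> (cell s) (cell t) ?P"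
    by simp
  also have "\<dots> = act2 (s \<diamondop> t) h \<cdot> rebracket (s \<diamondop> t) ?P"
    using Join.IH(1)[of "act2 t h"] by simp
  finally show ?case .
qed simp

end

text \<open>
  Formal pastings of 2-cells.  A generator records the words it goes between, since a 1-cell can be
  bracketed in several ways.  Vertical composition is written in the applicative order.
\<close>
datatype ('o, 'm, 'c) diagram =
  Gen "('o, 'm) bword" 'c "('o, 'm) bword"
| Idd "('o, 'm) bword"
| Vert "('o, 'm, 'c) diagram" "('o, 'm, 'c) diagram" (infixr "\<bullet>" 55)
| Horz "('o, 'm, 'c) diagram" "('o, 'm, 'c) diagram" (infixl "\<diamond>" 70)
| Asc "('o, 'm) bword" "('o, 'm) bword" "('o, 'm) bword"
| Lun 'o "('o, 'm) bword"
| Run 'o "('o, 'm) bword"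
| Inv "('o, 'm, 'c) diagram"

fun dom_cod :: "('o, 'm, 'c) diagram \<Rightarrow> ('o, 'm) bword \<times> ('o, 'm) bword" where
  "dom_cod (Gen s f t) = (s, t)"
| "dom_cod (Idd s) = (s, s)"
| "dom_cod (k \<bullet> f) = (fst (dom_cod f), snd (dom_cod k))"
| "dom_cod (f \<diamond> k) = (fst (dom_cod f) \<diamondop> fst (dom_cod k), snd (dom_cod f) \<diamondop> snd (dom_cod k))"
| "dom_cod (Asc s t u) = (s \<diamondop> t \<diamondop> u, s \<diamondop> (t \<diamondop> u))"
| "dom_cod (Lun a s) = (Empt a \<diamondop> s, s)"
| "dom_cod (Run a s) = (s \<diamondop> Empt a, s)"
| "dom_cod (Inv d) = (snd (dom_cod d), fst (dom_cod d))"

abbreviation src_word :: "('o, 'm, 'c) diagram \<Rightarrow> ('o, 'm) bword"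
  where "src_word d \<equiv> fst (dom_cod d)"

abbreviation trg_word :: "('o, 'm, 'c) diagram \<Rightarrow> ('o, 'm) bword"
  where "trg_word d \<equiv> snd (dom_cod d)"

context bicategory
begin

primrec val :: "('o, 'm, 'c) diagram \<Rightarrow> 'c" where
  "val (Gen s f t) = f"
| "val (Idd s) = \<ii> (cell s)"
| "val (k \<bullet> f) = val k \<cdot> val f"
| "val (f \<diamond> k) = val f \<star> val k"
| "val (Asc s t u) = \<aa> (cell s) (cell t) (cell u)"
| "val (Lun a s) = \<ll> (cell s)"
| "val (Run a s) = \<rr> (cell s)"
| "val (Inv d) = inv_arr B (val d)"

primrec wf_diagram :: "('o, 'm, 'c) diagram \<Rightarrow> bool" where
  "wf_diagram (Gen s f t) \<longleftrightarrow> wf_word s \<and> wf_word t \<and> f \<in> Ar B \<and> Dom B f = cell s \<and> Cod B f = cell t"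
| "wf_diagram (Idd s) \<longleftrightarrow> wf_word s"
| "wf_diagram (k \<bullet> f) \<longleftrightarrow> wf_diagram k \<and> wf_diagram f \<and> src_word k = trg_word f"
| "wf_diagram (f \<diamond> k) \<longleftrightarrow> wf_diagram f \<and> wf_diagram k
     \<and> Trg B (cell (src_word f)) = Src B (cell (src_word k))"
| "wf_diagram (Asc s t u) \<longleftrightarrow> wf_word (s \<diamondop> t \<diamondop> u)"
| "wf_diagram (Lun a s) \<longleftrightarrow> wf_word s \<and> Src B (cell s) = a"
| "wf_diagram (Run a s) \<longleftrightarrow> wf_word s \<and> Trg B (cell s) = a"
| "wf_diagram (Inv d) \<longleftrightarrow> wf_diagram d \<and> is_iso B (val d)"

lemma wf_diagram_typing [simp]:
  assumes "wf_diagram d"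
  shows "wf_word (src_word d)" "wf_word (trg_word d)" "val d \<in> Ar B"
    "Dom B (val d) = cell (src_word d)" "Cod B (val d) = cell (trg_word d)"
    "Src B (cell (trg_word d)) = Src B (cell (src_word d))"
    "Trg B (cell (trg_word d)) = Trg B (cell (src_word d))"
proof -
  have "wf_word (src_word d) \<and> wf_word (trg_word d) \<and> val d \<in> Ar B \<and>
     Dom B (val d) = cell (src_word d) \<and> Cod B (val d) = cell (trg_word d) \<and>
     Src B (cell (trg_word d)) = Src B (cell (src_word d)) \<and>
     Trg B (cell (trg_word d)) = Trg B (cell (src_word d))"
    using assms
  proof (induction d)
    case (Gen s f t)
    then show ?case using Src_Trg_Cod[of f] by auto
  qed auto
  then show "wf_word (src_word d)" "wf_word (trg_word d)" "val d \<in> Ar B"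
    "Dom B (val d) = cell (src_word d)" "Cod B (val d) = cell (trg_word d)"
    "Src B (cell (trg_word d)) = Src B (cell (src_word d))"
    "Trg B (cell (trg_word d)) = Trg B (cell (src_word d))" by auto
qed

definition strict :: "('o, 'm, 'c) diagram \<Rightarrow> 'm \<Rightarrow> 'c" where
  "strict d P = rebracket (trg_word d) P \<cdot> (val d \<star> \<ii> P) \<cdot> inv_arr B (rebracket (src_word d) P)"

lemma strict_typing [simp]:
  assumes "wf_diagram d" "P \<in> Ob B" "Src B P = Trg B (cell (src_word d))"
  shows "strict d P \<in> Ar B" "Dom B (strict d P) = act1 (src_word d) P"
    "Cod B (strict d P) = act1 (trg_word d) P"
  using assms by (simp_all add: strict_def)

text \<open>
  As the rebracketing cells are invertible, a strict form is recognised by a single commuting square.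
\<close>
lemma strict_unique:
  assumes "wf_diagram d" "P \<in> Ob B" "Src B P = Trg B (cell (src_word d))"
    "x \<in> Ar B" "Dom B x = act1 (src_word d) P" "Cod B x = act1 (trg_word d) P"
    "rebracket (trg_word d) P \<cdot> (val d \<star> \<ii> P) = x \<cdot> rebracket (src_word d) P"
  shows "strict d P = x"
proof -
  have "strict d P = (rebracket (trg_word d) P \<cdot> (val d \<star> \<ii> P)) \<cdot> inv_arr B (rebracket (src_word d) P)"
    using assms(1-6) by (simp add: strict_def)
  also have "\<dots> = x" using assms(1-6) by (simp add: assms(7))
  finally show ?thesis .
qed

lemma strict_rebracket:
  assumes "wf_diagram d" "P \<in> Ob B" "Src B P = Trg B (cell (src_word d))"
  shows "rebracket (trg_word d) P \<cdot> (val d \<star> \<ii> P) = strict d P \<cdot> rebracket (src_word d) P"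
  using assms by (simp add: strict_def)

text \<open>
  In strict form, sliding a 2-cell \<open>h\<close> past a diagram standing to its left is naturality in the
  1-cell acted on.
\<close>
lemma strict_nat:
  assumes d: "wf_diagram d" and h: "h \<in> Ar B" "Src B (Dom B h) = Trg B (cell (src_word d))"
  shows "strict d (Cod B h) \<cdot> act2 (src_word d) h = act2 (trg_word d) h \<cdot> strict d (Dom B h)"
proof (rule iso_cancel_right[of "rebracket (src_word d) (Dom B h)"])
  let ?s = "src_word d" and ?t = "trg_word d" and ?P = "Dom B h" and ?P' = "Cod B h"
  have "(strict d ?P' \<cdot> act2 ?s h) \<cdot> rebracket ?s ?P
      = (strict d ?P' \<cdot> rebracket ?s ?P') \<cdot> (\<ii> (cell ?s) \<star> h)"
    using assms rebracket_nat[of ?s h] by simp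
  also have "\<dots> = rebracket ?t ?P' \<cdot> (val d \<star> h)"
    using assms by (simp add: strict_rebracket[symmetric] comp_hcomp2_comp)
  also have "\<dots> = (rebracket ?t ?P' \<cdot> (\<ii> (cell ?t) \<star> h)) \<cdot> (val d \<star> \<ii> ?P)"
    using assms by (simp add: comp_hcomp2_comp)
  also have "\<dots> = (act2 ?t h \<cdot> strict d ?P) \<cdot> rebracket ?s ?P"
    using assms rebracket_nat[of ?t h] by (simp add: strict_rebracket)
  finally show "(strict d ?P' \<cdot> act2 ?s h) \<cdot> rebracket ?s ?P
      = (act2 ?t h \<cdot> strict d ?P) \<cdot> rebracket ?s ?P" .
qed (use assms in simp_all)

lemma strict_Idd [simp]:
  assumes "wf_word s" "P \<in> Ob B" "Src B P = Trg B (cell s)"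
  shows "strict (Idd s) P = \<ii> (act1 s P)"
  using assms by (intro strict_unique) auto

lemma strict_Vert [simp]:
  assumes "wf_diagram (k \<bullet> f)" "P \<in> Ob B" "Src B P = Trg B (cell (src_word f))"
  shows "strict (k \<bullet> f) P = strict k P \<cdot> strict f P"
proof (rule strict_unique)
  have [simp]: "wf_diagram k" "wf_diagram f" "src_word k = trg_word f" using assms by auto
  have "rebracket (trg_word (k \<bullet> f)) P \<cdot> (val (k \<bullet> f) \<star> \<ii> P)
      = (rebracket (trg_word k) P \<cdot> (val k \<star> \<ii> P)) \<cdot> (val f \<star> \<ii> P)"
    using assms by (simp add: whisker_comp)
  also have "\<dots> = strict k P \<cdot> strict f P \<cdot> rebracket (src_word f) P"
    using assms strict_rebracket[of k P] strict_rebracket[of f P] by simp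
  finally show "rebracket (trg_word (k \<bullet> f)) P \<cdot> (val (k \<bullet> f) \<star> \<ii> P)
      = (strict k P \<cdot> strict f P) \<cdot> rebracket (src_word (k \<bullet> f)) P"
    using assms by simp
qed (use assms in simp_all)

text \<open>
  In a horizontal composite the right factor is applied first, under the source word of the left
  factor, and the left factor then acts on the target word of the right one.
\<close>
lemma strict_Horz [simp]:
  assumes "wf_diagram (f \<diamond> k)" "P \<in> Ob B" "Src B P = Trg B (cell (src_word k))"
  shows "strict (f \<diamond> k) P = strict f (act1 (trg_word k) P) \<cdot> act2 (src_word f) (strict k P)"
proof (rule strict_unique)
  let ?s = "src_word f" and ?s' = "trg_word f" and ?t = "src_word k" and ?t' = "trg_word k"
  have [simp]: "wf_diagram f" "wf_diagram k" "Trg B (cell ?s) = Src B (cell ?t)" using assms by auto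
  note P = assms(2,3)
  have "rebracket (trg_word (f \<diamond> k)) P \<cdot> (val (f \<diamond> k) \<star> \<ii> P)
      = rebracket ?s' (act1 ?t' P) \<cdot> (\<ii> (cell ?s') \<star> rebracket ?t' P)
        \<cdot> \<aa> (cell ?s') (cell ?t') P \<cdot> ((val f \<star> val k) \<star> \<ii> P)"
    using P by simp
  also have "\<dots> = rebracket ?s' (act1 ?t' P) \<cdot> (\<ii> (cell ?s') \<star> rebracket ?t' P)
        \<cdot> (val f \<star> (val k \<star> \<ii> P)) \<cdot> \<aa> (cell ?s) (cell ?t) P"
    using P asc_nat[of "val f" "val k" "\<ii> P"] by simp
  also have "\<dots> = rebracket ?s' (act1 ?t' P) \<cdot> (val f \<star> (strict k P \<cdot> rebracket ?t P))
        \<cdot> \<aa> (cell ?s) (cell ?t) P"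
    using P by (simp add: comp_hcomp2_comp_rest strict_rebracket)
  also have "\<dots> = (rebracket ?s' (act1 ?t' P) \<cdot> (val f \<star> \<ii> (act1 ?t' P)))
        \<cdot> (\<ii> (cell ?s) \<star> strict k P) \<cdot> (\<ii> (cell ?s) \<star> rebracket ?t P) \<cdot> \<aa> (cell ?s) (cell ?t) P"
    using P by (simp add: comp_hcomp2_comp_rest comp_hcomp2_comp)
  also have "\<dots> = strict f (act1 ?t' P) \<cdot> (rebracket ?s (act1 ?t' P) \<cdot> (\<ii> (cell ?s) \<star> strict k P))
        \<cdot> (\<ii> (cell ?s) \<star> rebracket ?t P) \<cdot> \<aa> (cell ?s) (cell ?t) P"
    using P by (simp add: strict_rebracket)
  also have "\<dots> = (strict f (act1 ?t' P) \<cdot> act2 ?s (strict k P)) \<cdot> rebracket (src_word (f \<diamond> k)) P"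
    using P rebracket_nat[of ?s "strict k P"] by simp
  finally show "rebracket (trg_word (f \<diamond> k)) P \<cdot> (val (f \<diamond> k) \<star> \<ii> P)
      = (strict f (act1 ?t' P) \<cdot> act2 ?s (strict k P)) \<cdot> rebracket (src_word (f \<diamond> k)) P" .
qed (use assms in simp_all)

text \<open>
  The two rebracketings of a threefold word differ by the associator; this is the pentagon.
\<close>
lemma strict_Asc [simp]:
  assumes "wf_word (s \<diamondop> t \<diamondop> u)" "P \<in> Ob B" "Src B P = Trg B (cell u)"
  shows "strict (Asc s t u) P = \<ii> (act1 s (act1 t (act1 u P)))"
proof (rule strict_unique)
  have w [simp]: "wf_word s" "wf_word t" "wf_word u" "Trg B (cell s) = Src B (cell t)"
    "Trg B (cell t) = Src B (cell u)" using assms by auto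
  let ?S = "cell s" and ?T = "cell t" and ?U = "cell u"
  let ?x = "rebracket s (act1 t (act1 u P))" and ?y = "rebracket t (act1 u P)" and ?z = "rebracket u P"
  have "rebracket (s \<diamondop> t \<diamondop> u) P
      = ?x \<cdot> (\<ii> ?S \<star> ?y) \<cdot> (\<aa> ?S ?T (act1 u P) \<cdot> ((\<ii> ?S \<star> \<ii> ?T) \<star> ?z)) \<cdot> \<aa> (?S \<odot> ?T) ?U P"
    using assms by simp
  also have "\<dots> = ?x \<cdot> (\<ii> ?S \<star> ?y) \<cdot> (\<ii> ?S \<star> (\<ii> ?T \<star> ?z)) \<cdot> \<aa> ?S ?T (?U \<odot> P) \<cdot> \<aa> (?S \<odot> ?T) ?U P"
    using assms(2,3) asc_nat[of "\<ii> ?S" "\<ii> ?T" ?z] by simp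
  also have "\<dots> = ?x \<cdot> (\<ii> ?S \<star> ?y) \<cdot> (\<ii> ?S \<star> (\<ii> ?T \<star> ?z))
      \<cdot> (\<ii> ?S \<star> \<aa> ?T ?U P) \<cdot> \<aa> ?S (?T \<odot> ?U) P \<cdot> (\<aa> ?S ?T ?U \<star> \<ii> P)"
    using assms(2,3) by (simp add: pentagon_Ob)
  also have "\<dots> = rebracket (s \<diamondop> (t \<diamondop> u)) P \<cdot> (\<aa> ?S ?T ?U \<star> \<ii> P)"
    using assms(2,3) by (simp add: comp_hcomp2_comp_rest)
  finally show "rebracket (trg_word (Asc s t u)) P \<cdot> (val (Asc s t u) \<star> \<ii> P)
    = \<ii> (act1 s (act1 t (act1 u P))) \<cdot> rebracket (src_word (Asc s t u)) P"
    using assms by simp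
qed (use assms in auto)

lemma strict_Lun [simp]:
  assumes "wf_word s" "Src B (cell s) = a" "P \<in> Ob B" "Src B P = Trg B (cell s)"
  shows "strict (Lun a s) P = \<ii> (act1 s P)"
proof (rule strict_unique)
  have "rebracket (src_word (Lun a s)) P
      = (\<ll> (act1 s P) \<cdot> (\<ii> (\<U> a) \<star> rebracket s P)) \<cdot> \<aa> (\<U> a) (cell s) P"
    using assms by auto
  also have "\<dots> = rebracket s P \<cdot> \<ll> (cell s \<odot> P) \<cdot> \<aa> (\<U> a) (cell s) P"
    using assms lun_nat[of "rebracket s P"] by auto
  also have "\<dots> = rebracket s P \<cdot> (\<ll> (cell s) \<star> \<ii> P)"
    using assms lun_hcomp1[of "cell s" P] by auto
  finally show "rebracket (trg_word (Lun a s)) P \<cdot> (val (Lun a s) \<star> \<ii> P)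
    = \<ii> (act1 s P) \<cdot> rebracket (src_word (Lun a s)) P"
    using assms by auto
qed (use assms in auto)

lemma strict_Run [simp]:
  assumes "wf_word s" "Trg B (cell s) = a" "P \<in> Ob B" "Src B P = a"
  shows "strict (Run a s) P = \<ii> (act1 s P)"
proof (rule strict_unique)
  have "rebracket (src_word (Run a s)) P
      = rebracket s P \<cdot> (\<ii> (cell s) \<star> \<ll> P) \<cdot> \<aa> (cell s) (\<U> a) P"
    using assms by auto
  also have "\<dots> = rebracket s P \<cdot> (\<rr> (cell s) \<star> \<ii> P)"
    using assms triangle_Ob[of "cell s" P] by auto
  finally show "rebracket (trg_word (Run a s)) P \<cdot> (val (Run a s) \<star> \<ii> P)
    = \<ii> (act1 s P) \<cdot> rebracket (src_word (Run a s)) P"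
    using assms by auto
qed (use assms in auto)

lemma strict_iso:
  assumes "wf_diagram d" "is_iso B (val d)" "P \<in> Ob B" "Src B P = Trg B (cell (src_word d))"
  shows "is_iso B (strict d P)"
  using assms by (simp add: strict_def is_iso_comp is_iso_hcomp2 iso_inv_arr)

lemma strict_Inv [simp]:
  assumes d: "wf_diagram (Inv d)" and P: "P \<in> Ob B" "Src B P = Trg B (cell (src_word d))"
  shows "strict (Inv d) P = inv_arr B (strict d P)"
proof (rule inv_arrI(2)[symmetric])
  have [simp]: "wf_diagram d" "is_iso B (val d)" using d by auto
  have "strict (Inv d) P \<cdot> strict d P = strict (Inv d \<bullet> d) P" using P by simp
  also have "\<dots> = strict (Idd (src_word d)) P"
    using P by (simp add: strict_def del: strict_Vert strict_Idd)
  finally show "strict (Inv d) P \<cdot> strict d P = \<ii> (Dom B (strict d P))" using P by simp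
  have "strict d P \<cdot> strict (Inv d) P = strict (d \<bullet> Inv d) P" using P by simp
  also have "\<dots> = strict (Idd (trg_word d)) P"
    using P by (simp add: strict_def del: strict_Vert strict_Idd)
  finally show "strict d P \<cdot> strict (Inv d) P = \<ii> (Cod B (strict d P))" using P by simp
qed (use assms in simp_all)

text \<open>
  It is enough to look at \<open>P = \<U>\<close>: the rebracketing cells are invertible, and whiskering with a unit
  1-cell is faithful by naturality of the right unitor.
\<close>
theorem strict_faithful:
  assumes "wf_diagram d" "wf_diagram d'" "src_word d' = src_word d" "trg_word d' = trg_word d"
    and eq: "\<And>P. P \<in> Ob B \<Longrightarrow> Src B P = Trg B (cell (src_word d)) \<Longrightarrow> strict d P = strict d' P"
  shows "val d = val d'"
proof -
  define P where "P = \<U> (Trg B (cell (src_word d)))"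
  have P: "P \<in> Ob B" "Src B P = Trg B (cell (src_word d))" using assms(1) by (simp_all add: P_def)
  have *: "rebracket (trg_word d) P \<cdot> (val d \<star> \<ii> P) = rebracket (trg_word d) P \<cdot> (val d' \<star> \<ii> P)"
    using strict_rebracket[of d P] strict_rebracket[of d' P] eq[of P] assms(1-4) P by simp
  have "val d \<star> \<ii> P = val d' \<star> \<ii> P"
    using assms(1-4) P by (intro iso_cancel_left[OF _ _ _ _ _ *]) simp_all
  then show ?thesis using assms(1-4)
    by (intro unit_whisker_faithful(2)[of "val d" "val d'"]) (simp_all add: P_def)
qed

text \<open>
  The strict form depends only on the value of a diagram and on its boundary words, so a known
  equation between 2-cells can be transported to strict forms.
\<close>
lemma strict_cong:
  "val d = val d' \<Longrightarrow> src_word d' = src_word d \<Longrightarrow> trg_word d' = trg_word d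
    \<Longrightarrow> strict d P = strict d' P"
  by (simp add: strict_def)

end

section \<open>Duals\<close>

context bicategory
begin

text \<open>
  Without constraint cells the triangle identities are the two zigzag equations of an adjunction.
  The dual pair is presented by words, so that composite 1-cells are covered as well.
\<close>
lemma left_dual_strict:
  assumes [simp]: "wf_word s" "wf_word s'" "Src B (cell s) = a" "Trg B (cell s) = b"
    "Src B (cell s') = b" "Trg B (cell s') = a" "a \<in> Obj0 B" "b \<in> Obj0 B"
    and n [simp]: "n \<in> Ar B" "Dom B n = \<U> b" "Cod B n = cell s' \<odot> cell s"
    and e [simp]: "e \<in> Ar B" "Dom B e = cell s \<odot> cell s'" "Cod B e = \<U> a"
  shows "left_dual B a b (cell s) (cell s') n e \<longleftrightarrow>
    (\<forall>P. P \<in> Ob B \<longrightarrow> Src B P = b \<longrightarrow>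
       strict (Gen (s \<diamondop> s') e (Empt a)) (act1 s P) \<cdot> act2 s (strict (Gen (Empt b) n (s' \<diamondop> s)) P)
         = \<ii> (act1 s P)) \<and>
    (\<forall>P. P \<in> Ob B \<longrightarrow> Src B P = a \<longrightarrow>
       act2 s' (strict (Gen (s \<diamondop> s') e (Empt a)) P) \<cdot> strict (Gen (Empt b) n (s' \<diamondop> s)) (act1 s' P)
         = \<ii> (act1 s' P))"
proof -
  let ?e = "Gen (s \<diamondop> s') e (Empt a)" and ?n = "Gen (Empt b) n (s' \<diamondop> s)"
  let ?d = "Lun a s \<bullet> ?e \<diamond> Idd s \<bullet> Inv (Asc s s' s) \<bullet> Idd s \<diamond> ?n \<bullet> Inv (Run b s)"
  let ?d' = "Run a s' \<bullet> Idd s' \<diamond> ?e \<bullet> Asc s' s s' \<bullet> ?n \<diamond> Idd s' \<bullet> Inv (Lun b s')"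
  have s: "strict ?d P = strict ?e (act1 s P) \<cdot> act2 s (strict ?n P)"
    if "P \<in> Ob B" "Src B P = b" for P using that by simp
  have s': "strict ?d' P = act2 s' (strict ?e P) \<cdot> strict ?n (act1 s' P)"
    if "P \<in> Ob B" "Src B P = a" for P using that by simp
  have d: "val ?d = val (Idd s) \<longleftrightarrow> (\<forall>P. P \<in> Ob B \<longrightarrow> Src B P = b \<longrightarrow>
       strict ?e (act1 s P) \<cdot> act2 s (strict ?n P) = \<ii> (act1 s P))" (is "?v \<longleftrightarrow> ?z")
  proof
    assume v: ?v
    show ?z
    proof (intro allI impI)
      fix P assume P: "P \<in> Ob B" "Src B P = b"
      have "strict ?d P = strict (Idd s) P" by (rule strict_cong[OF v]) simp_all
      then show "strict ?e (act1 s P) \<cdot> act2 s (strict ?n P) = \<ii> (act1 s P)"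
        unfolding s[OF P] using P by simp
    qed
  next
    assume ?z
    then show ?v by (intro strict_faithful) (simp_all add: s del: strict_Vert strict_Horz)
  qed
  have d': "val ?d' = val (Idd s') \<longleftrightarrow> (\<forall>P. P \<in> Ob B \<longrightarrow> Src B P = a \<longrightarrow>
       act2 s' (strict ?e P) \<cdot> strict ?n (act1 s' P) = \<ii> (act1 s' P))" (is "?v \<longleftrightarrow> ?z")
  proof
    assume v: ?v
    show ?z
    proof (intro allI impI)
      fix P assume P: "P \<in> Ob B" "Src B P = a"
      have "strict ?d' P = strict (Idd s') P" by (rule strict_cong[OF v]) simp_all
      then show "act2 s' (strict ?e P) \<cdot> strict ?n (act1 s' P) = \<ii> (act1 s' P)"
        unfolding s'[OF P] using P by simp
    qed
  next
    assume ?z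
    then show ?v by (intro strict_faithful) (simp_all add: s' del: strict_Vert strict_Horz)
  qed
  have "left_dual B a b (cell s) (cell s') n e \<longleftrightarrow> val ?d = val (Idd s) \<and> val ?d' = val (Idd s')"
    by (simp add: left_dual_def cells1_def Hom_def)
  then show ?thesis unfolding d d' .
qed

lemma left_dual_typing:
  assumes "left_dual B a b X X' n e"
  shows "X \<in> Ob B" "X' \<in> Ob B" "Src B X = a" "Trg B X = b" "Src B X' = b" "Trg B X' = a"
    "a \<in> Obj0 B" "b \<in> Obj0 B" "n \<in> Ar B" "Dom B n = \<U> b" "Cod B n = X' \<odot> X"
    "e \<in> Ar B" "Dom B e = X \<odot> X'" "Cod B e = \<U> a"
  using assms by (auto simp: left_dual_def cells1_def Hom_def)

lemma left_dual_zigzag: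
  assumes "left_dual B a b X X' n e"
  shows "P \<in> Ob B \<Longrightarrow> Src B P = b \<Longrightarrow>
       strict (Gen (Atom X \<diamondop> Atom X') e (Empt a)) (X \<odot> P)
         \<cdot> (\<ii> X \<star> strict (Gen (Empt b) n (Atom X' \<diamondop> Atom X)) P) = \<ii> (X \<odot> P)"
    and "P \<in> Ob B \<Longrightarrow> Src B P = a \<Longrightarrow>
       (\<ii> X' \<star> strict (Gen (Atom X \<diamondop> Atom X') e (Empt a)) P)
         \<cdot> strict (Gen (Empt b) n (Atom X' \<diamondop> Atom X)) (X' \<odot> P) = \<ii> (X' \<odot> P)"
  using left_dual_strict[of "Atom X" "Atom X'" a b n e] assms left_dual_typing[OF assms] by auto

text \<open>
  The unit and counit of the composite adjunction: the pair \<open>X' \<odot> X\<close> is created inside \<open>Y' \<odot> Y\<close>, and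
  \<open>Y \<odot> Y'\<close> is contracted inside \<open>X \<odot> X'\<close>.
\<close>
definition comp_coev :: "'m \<Rightarrow> 'm \<Rightarrow> 'm \<Rightarrow> 'm \<Rightarrow> 'c \<Rightarrow> 'c \<Rightarrow> 'c" where
  "comp_coev X X' Y Y' n m = inv_arr B (\<aa> Y' X' (X \<odot> Y)) \<cdot> (\<ii> Y' \<star> \<aa> X' X Y)
     \<cdot> (\<ii> Y' \<star> (n \<star> \<ii> Y)) \<cdot> (\<ii> Y' \<star> inv_arr B (\<ll> Y)) \<cdot> m"

definition comp_ev :: "'m \<Rightarrow> 'm \<Rightarrow> 'm \<Rightarrow> 'm \<Rightarrow> 'c \<Rightarrow> 'c \<Rightarrow> 'c" where
  "comp_ev X X' Y Y' e f = e \<cdot> (\<ii> X \<star> \<ll> X') \<cdot> (\<ii> X \<star> (f \<star> \<ii> X'))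
     \<cdot> (\<ii> X \<star> inv_arr B (\<aa> Y Y' X')) \<cdot> \<aa> X Y (Y' \<odot> X')"

text \<open>
  In each zigzag of the composite, naturality slides the counit of one pair past the unit of the
  other, after which one zigzag of each pair remains.
\<close>
lemma left_dual_comp:
  assumes dX: "left_dual B a b X X' n e" and dY: "left_dual B b c Y Y' m f"
  shows "left_dual B a c (X \<odot> Y) (Y' \<odot> X') (comp_coev X X' Y Y' n m) (comp_ev X X' Y Y' e f)"
proof -
  note [simp] = left_dual_typing[OF dX] left_dual_typing[OF dY]
  let ?X = "Atom X" and ?X' = "Atom X'" and ?Y = "Atom Y" and ?Y' = "Atom Y'"
  let ?n = "Gen (Empt b) n (?X' \<diamondop> ?X)" and ?e = "Gen (?X \<diamondop> ?X') e (Empt a)"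
  let ?m = "Gen (Empt c) m (?Y' \<diamondop> ?Y)" and ?f = "Gen (?Y \<diamondop> ?Y') f (Empt b)"
  let ?N = "Inv (Asc ?Y' ?X' (?X \<diamondop> ?Y)) \<bullet> Idd ?Y' \<diamond> Asc ?X' ?X ?Y
     \<bullet> Idd ?Y' \<diamond> (?n \<diamond> Idd ?Y) \<bullet> Idd ?Y' \<diamond> Inv (Lun b ?Y) \<bullet> ?m"
  let ?E = "?e \<bullet> Idd ?X \<diamond> Lun b ?X' \<bullet> Idd ?X \<diamond> (?f \<diamond> Idd ?X')
     \<bullet> Idd ?X \<diamond> Inv (Asc ?Y ?Y' ?X') \<bullet> Asc ?X ?Y (?Y' \<diamondop> ?X')"
  have N: "val ?N = comp_coev X X' Y Y' n m" and E: "val ?E = comp_ev X X' Y Y' e f"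
    unfolding comp_coev_def comp_ev_def by simp_all
  have wN: "wf_diagram ?N" and wE: "wf_diagram ?E" by simp_all
  note wf_diagram_typing[OF wN, unfolded N, simp] wf_diagram_typing[OF wE, unfolded E, simp]
  have sN: "strict (Gen (Empt c) (comp_coev X X' Y Y' n m) (?Y' \<diamondop> ?X' \<diamondop> (?X \<diamondop> ?Y))) P
      = (\<ii> Y' \<star> strict ?n (Y \<odot> P)) \<cdot> strict ?m P" if "P \<in> Ob B" "Src B P = c" for P
  proof -
    have "strict (Gen (Empt c) (comp_coev X X' Y Y' n m) (?Y' \<diamondop> ?X' \<diamondop> (?X \<diamondop> ?Y))) P = strict ?N P"
      by (rule strict_cong) (simp_all add: comp_coev_def)
    also have "\<dots> = (\<ii> Y' \<star> strict ?n (Y \<odot> P)) \<cdot> strict ?m P" using that by simp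
    finally show ?thesis .
  qed
  have sE: "strict (Gen (?X \<diamondop> ?Y \<diamondop> (?Y' \<diamondop> ?X')) (comp_ev X X' Y Y' e f) (Empt a)) P
      = strict ?e P \<cdot> (\<ii> X \<star> strict ?f (X' \<odot> P))" if "P \<in> Ob B" "Src B P = a" for P
  proof -
    have "strict (Gen (?X \<diamondop> ?Y \<diamondop> (?Y' \<diamondop> ?X')) (comp_ev X X' Y Y' e f) (Empt a)) P = strict ?E P"
      by (rule strict_cong) (simp_all add: comp_ev_def)
    also have "\<dots> = strict ?e P \<cdot> (\<ii> X \<star> strict ?f (X' \<odot> P))" using that by simp
    finally show ?thesis .
  qed
  have zig: "strict ?e (X \<odot> (Y \<odot> P)) \<cdot> (\<ii> X \<star> strict ?f (X' \<odot> (X \<odot> (Y \<odot> P))))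
      \<cdot> (\<ii> X \<star> (\<ii> Y \<star> ((\<ii> Y' \<star> strict ?n (Y \<odot> P)) \<cdot> strict ?m P))) = \<ii> (X \<odot> (Y \<odot> P))" 
      (is "?l = _") if P [simp]: "P \<in> Ob B" "Src B P = c" for P
  proof -
    have "?l = strict ?e (X \<odot> (Y \<odot> P))
        \<cdot> (\<ii> X \<star> ((strict ?f (X' \<odot> (X \<odot> (Y \<odot> P))) \<cdot> (\<ii> Y \<star> (\<ii> Y' \<star> strict ?n (Y \<odot> P))))
             \<cdot> (\<ii> Y \<star> strict ?m P)))"
      by (simp add: whisker_comp)
    also have "\<dots> = strict ?e (X \<odot> (Y \<odot> P))
        \<cdot> (\<ii> X \<star> (strict ?n (Y \<odot> P) \<cdot> strict ?f (Y \<odot> P) \<cdot> (\<ii> Y \<star> strict ?m P)))"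
      using strict_nat[of ?f "strict ?n (Y \<odot> P)"] by simp
    also have "\<dots> = strict ?e (X \<odot> (Y \<odot> P)) \<cdot> (\<ii> X \<star> strict ?n (Y \<odot> P))"
      by (simp add: left_dual_zigzag[OF dY])
    also have "\<dots> = \<ii> (X \<odot> (Y \<odot> P))" by (simp add: left_dual_zigzag[OF dX])
    finally show ?thesis .
  qed
  have zag: "(\<ii> Y' \<star> (\<ii> X' \<star> (strict ?e P \<cdot> (\<ii> X \<star> strict ?f (X' \<odot> P)))))
      \<cdot> (\<ii> Y' \<star> strict ?n (Y \<odot> (Y' \<odot> (X' \<odot> P)))) \<cdot> strict ?m (Y' \<odot> (X' \<odot> P)) = \<ii> (Y' \<odot> (X' \<odot> P))" 
      (is "?l = _") if P [simp]: "P \<in> Ob B" "Src B P = a" for P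
  proof -
    have "?l = (\<ii> Y' \<star> ((\<ii> X' \<star> strict ?e P) \<cdot> (\<ii> X' \<star> (\<ii> X \<star> strict ?f (X' \<odot> P)))
             \<cdot> strict ?n (Y \<odot> (Y' \<odot> (X' \<odot> P)))))
        \<cdot> strict ?m (Y' \<odot> (X' \<odot> P))"
      by (simp add: whisker_comp)
    also have "\<dots> = (\<ii> Y' \<star> (((\<ii> X' \<star> strict ?e P) \<cdot> strict ?n (X' \<odot> P)) \<cdot> strict ?f (X' \<odot> P)))
        \<cdot> strict ?m (Y' \<odot> (X' \<odot> P))"
      using strict_nat[of ?n "strict ?f (X' \<odot> P)"] by simp
    also have "\<dots> = (\<ii> Y' \<star> strict ?f (X' \<odot> P)) \<cdot> strict ?m (Y' \<odot> (X' \<odot> P))"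
      by (simp only: left_dual_zigzag[OF dX] P) simp
    also have "\<dots> = \<ii> (Y' \<odot> (X' \<odot> P))" by (simp add: left_dual_zigzag[OF dY])
    finally show ?thesis .
  qed
  have "left_dual B a c (cell (?X \<diamondop> ?Y)) (cell (?Y' \<diamondop> ?X')) (comp_coev X X' Y Y' n m)
      (comp_ev X X' Y Y' e f)"
    using zig zag by (subst left_dual_strict) (simp_all add: sN sE)
  then show ?thesis by simp
qed

text \<open>
  The comparison is the mate of the identity, \<open>X' \<Rightarrow> Y' \<odot> X \<odot> X' \<Rightarrow> Y'\<close>.  Its compatibility with the
  units uses the zigzag of the first pair, and that with the counits the zigzag of the second.
\<close>
lemma left_dual_unique:
  assumes d1: "left_dual B a b X X' n e" and d2: "left_dual B a b X Y' m f"
  obtains \<phi> where "\<phi> \<in> Hom B X' Y'" "(\<phi> \<star> \<ii> X) \<cdot> n = m" "f \<cdot> (\<ii> X \<star> \<phi>) = e"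
proof -
  note [simp] = left_dual_typing[OF d1] left_dual_typing[OF d2]
  let ?X = "Atom X" and ?X' = "Atom X'" and ?Y' = "Atom Y'"
  let ?n = "Gen (Empt b) n (?X' \<diamondop> ?X)" and ?e = "Gen (?X \<diamondop> ?X') e (Empt a)"
  let ?m = "Gen (Empt b) m (?Y' \<diamondop> ?X)" and ?f = "Gen (?X \<diamondop> ?Y') f (Empt a)"
  let ?\<phi> = "Run a ?Y' \<bullet> Idd ?Y' \<diamond> ?e \<bullet> Asc ?Y' ?X ?X' \<bullet> ?m \<diamond> Idd ?X' \<bullet> Inv (Lun b ?X')"
  have w: "wf_diagram ?\<phi>" by simp
  have s: "strict ?\<phi> P = (\<ii> Y' \<star> strict ?e P) \<cdot> strict ?m (X' \<odot> P)" if "P \<in> Ob B" "Src B P = a" for P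
    using that by simp
  have "val (?\<phi> \<diamond> Idd ?X \<bullet> ?n) = val ?m"
  proof (rule strict_faithful)
    fix P assume "P \<in> Ob B" "Src B P = Trg B (cell (src_word (?\<phi> \<diamond> Idd ?X \<bullet> ?n)))"
    then have P [simp]: "P \<in> Ob B" "Src B P = b" by simp_all
    have "strict (?\<phi> \<diamond> Idd ?X \<bullet> ?n) P
        = (\<ii> Y' \<star> strict ?e (X \<odot> P)) \<cdot> strict ?m (X' \<odot> (X \<odot> P)) \<cdot> strict ?n P" by simp
    also have "\<dots> = (\<ii> Y' \<star> (strict ?e (X \<odot> P) \<cdot> (\<ii> X \<star> strict ?n P))) \<cdot> strict ?m P"
      using strict_nat[of ?m "strict ?n P"] by (simp add: whisker_comp)
    also have "\<dots> = strict ?m P" by (simp add: left_dual_zigzag[OF d1])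
    finally show "strict (?\<phi> \<diamond> Idd ?X \<bullet> ?n) P = strict ?m P" .
  qed simp_all
  moreover have "val (?f \<bullet> Idd ?X \<diamond> ?\<phi>) = val ?e"
  proof (rule strict_faithful)
    fix P assume "P \<in> Ob B" "Src B P = Trg B (cell (src_word (?f \<bullet> Idd ?X \<diamond> ?\<phi>)))"
    then have P [simp]: "P \<in> Ob B" "Src B P = a" by simp_all
    have "strict (?f \<bullet> Idd ?X \<diamond> ?\<phi>) P
        = (strict ?f P \<cdot> (\<ii> X \<star> (\<ii> Y' \<star> strict ?e P))) \<cdot> (\<ii> X \<star> strict ?m (X' \<odot> P))"
      by (simp add: whisker_comp)
    also have "\<dots> = strict ?e P \<cdot> strict ?f (X \<odot> (X' \<odot> P)) \<cdot> (\<ii> X \<star> strict ?m (X' \<odot> P))"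
      using strict_nat[of ?f "strict ?e P"] by simp
    also have "\<dots> = strict ?e P" by (simp add: left_dual_zigzag[OF d2])
    finally show "strict (?f \<bullet> Idd ?X \<diamond> ?\<phi>) P = strict ?e P" .
  qed simp_all
  ultimately show ?thesis
    using wf_diagram_typing[OF w] by (intro that[of "val ?\<phi>"]) (simp_all add: Hom_def)
qed

end

section \<open>Composing twists\<close>

context bicategory
begin

text \<open>
  The formula for a twist at a product, solved for the twist, contains the inverse of the
  multiplication cell \<open>p\<close>.  In strict form it is convenient to move \<open>p\<close> to the other side: a twist
  is then a distributive law past the letters of \<open>s\<close> that respects multiplication.
\<close>
lemma twist_mult_strict:
  assumes [simp]: "wf_word s" "A \<in> Ob B" "A' \<in> Ob B" "A'' \<in> Ob B" "C \<in> Ob B" "C' \<in> Ob B" "C'' \<in> Ob B"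
    and [simp]: "Src B A = Src B (cell s)" "Trg B A = Src B (cell s)" "Src B A' = Src B (cell s)"
      "Trg B A' = Src B (cell s)" "Src B A'' = Src B (cell s)" "Trg B A'' = Src B (cell s)"
    and [simp]: "Src B C = Trg B (cell s)" "Trg B C = Trg B (cell s)" "Src B C' = Trg B (cell s)"
      "Trg B C' = Trg B (cell s)" "Src B C'' = Trg B (cell s)" "Trg B C'' = Trg B (cell s)"
    and [simp]: "is_iso B p" "Dom B p = A \<odot> A'" "Cod B p = A''"
    and [simp]: "q \<in> Ar B" "Dom B q = C \<odot> C'" "Cod B q = C''"
    and [simp]: "t \<in> Ar B" "Dom B t = A \<odot> cell s" "Cod B t = cell s \<odot> C"
      "t' \<in> Ar B" "Dom B t' = A' \<odot> cell s" "Cod B t' = cell s \<odot> C'"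
      "t'' \<in> Ar B" "Dom B t'' = A'' \<odot> cell s" "Cod B t'' = cell s \<odot> C''"
  shows "t'' = (\<ii> (cell s) \<star> q) \<cdot> \<aa> (cell s) C C' \<cdot> (t \<star> \<ii> C') \<cdot> inv_arr B (\<aa> A (cell s) C')
          \<cdot> (\<ii> A \<star> t') \<cdot> \<aa> A A' (cell s) \<cdot> (inv_arr B p \<star> \<ii> (cell s)) \<longleftrightarrow>
    (\<forall>P. P \<in> Ob B \<longrightarrow> Src B P = Trg B (cell s) \<longrightarrow>
       strict (Gen (Atom A'' \<diamondop> s) t'' (s \<diamondop> Atom C'')) P
         \<cdot> strict (Gen (Atom A \<diamondop> Atom A') p (Atom A'')) (act1 s P)
       = act2 s (strict (Gen (Atom C \<diamondop> Atom C') q (Atom C'')) P)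
         \<cdot> strict (Gen (Atom A \<diamondop> s) t (s \<diamondop> Atom C)) (C' \<odot> P)
         \<cdot> (\<ii> A \<star> strict (Gen (Atom A' \<diamondop> s) t' (s \<diamondop> Atom C')) P))"
    (is "_ \<longleftrightarrow> ?S")
proof -
  have [simp]: "p \<in> Ar B" by (simp add: is_iso_Ar)
  let ?p = "Gen (Atom A \<diamondop> Atom A') p (Atom A'')" and ?q = "Gen (Atom C \<diamondop> Atom C') q (Atom C'')"
  let ?t = "Gen (Atom A \<diamondop> s) t (s \<diamondop> Atom C)" and ?t' = "Gen (Atom A' \<diamondop> s) t' (s \<diamondop> Atom C')"
  let ?t'' = "Gen (Atom A'' \<diamondop> s) t'' (s \<diamondop> Atom C'')"
  let ?d = "Idd s \<diamond> ?q \<bullet> Asc s (Atom C) (Atom C') \<bullet> ?t \<diamond> Idd (Atom C')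
    \<bullet> Inv (Asc (Atom A) s (Atom C')) \<bullet> Idd (Atom A) \<diamond> ?t' \<bullet> Asc (Atom A) (Atom A') s
    \<bullet> Inv ?p \<diamond> Idd s"
  have iso: "is_iso B (strict ?p (act1 s P))" if "P \<in> Ob B" "Src B P = Trg B (cell s)" for P
    using that by (intro strict_iso) simp_all
  have st: "strict ?t'' P = strict ?d P \<longleftrightarrow> strict ?t'' P \<cdot> strict ?p (act1 s P)
      = act2 s (strict ?q P) \<cdot> strict ?t (C' \<odot> P) \<cdot> (\<ii> A \<star> strict ?t' P)"
    if P: "P \<in> Ob B" "Src B P = Trg B (cell s)" for P
  proof -
    have *: "strict ?d P \<cdot> strict ?p (act1 s P)
        = act2 s (strict ?q P) \<cdot> strict ?t (C' \<odot> P) \<cdot> (\<ii> A \<star> strict ?t' P)"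
      using P iso[OF P] by simp
    show ?thesis
      unfolding *[symmetric]
    proof
      assume "strict ?t'' P \<cdot> strict ?p (act1 s P) = strict ?d P \<cdot> strict ?p (act1 s P)"
      then show "strict ?t'' P = strict ?d P"
        by (rule iso_cancel_right[rotated -1])
          (use P iso[OF P] in \<open>simp_all del: strict_Vert strict_Horz\<close>)
    qed simp
  qed
  have "val ?t'' = val ?d \<longleftrightarrow> ?S"
  proof
    assume v: "val ?t'' = val ?d"
    show ?S
    proof (intro allI impI)
      fix P assume P: "P \<in> Ob B" "Src B P = Trg B (cell s)"
      have "strict ?t'' P = strict ?d P" by (rule strict_cong[OF v]) simp_all
      then show "strict ?t'' P \<cdot> strict ?p (act1 s P)
          = act2 s (strict ?q P) \<cdot> strict ?t (C' \<odot> P) \<cdot> (\<ii> A \<star> strict ?t' P)"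
        unfolding st[OF P] .
    qed
  next
    assume S: ?S
    show "val ?t'' = val ?d"
    proof (rule strict_faithful)
      fix P assume "P \<in> Ob B" "Src B P = Trg B (cell (src_word ?t''))"
      then have P: "P \<in> Ob B" "Src B P = Trg B (cell s)" by simp_all
      show "strict ?t'' P = strict ?d P"
        unfolding st[OF P] using S P by blast
    qed simp_all
  qed
  then show ?thesis by simp
qed

lemma twist_unit_strict:
  assumes [simp]: "wf_word s" "A \<in> Ob B" "C \<in> Ob B"
    and [simp]: "Src B A = Src B (cell s)" "Trg B A = Src B (cell s)"
      "Src B C = Trg B (cell s)" "Trg B C = Trg B (cell s)"
    and [simp]: "is_iso B p" "Dom B p = \<U> (Src B (cell s))" "Cod B p = A"
    and [simp]: "q \<in> Ar B" "Dom B q = \<U> (Trg B (cell s))" "Cod B q = C"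
    and [simp]: "t \<in> Ar B" "Dom B t = A \<odot> cell s" "Cod B t = cell s \<odot> C"
  shows "t = (\<ii> (cell s) \<star> q) \<cdot> inv_arr B (\<rr> (cell s)) \<cdot> \<ll> (cell s)
          \<cdot> (inv_arr B p \<star> \<ii> (cell s)) \<longleftrightarrow>
    (\<forall>P. P \<in> Ob B \<longrightarrow> Src B P = Trg B (cell s) \<longrightarrow>
       strict (Gen (Atom A \<diamondop> s) t (s \<diamondop> Atom C)) P
         \<cdot> strict (Gen (Empt (Src B (cell s))) p (Atom A)) (act1 s P)
       = act2 s (strict (Gen (Empt (Trg B (cell s))) q (Atom C)) P))"
    (is "_ \<longleftrightarrow> ?S")
proof -
  have [simp]: "p \<in> Ar B" by (simp add: is_iso_Ar)
  let ?a = "Src B (cell s)" and ?b = "Trg B (cell s)"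
  let ?p = "Gen (Empt ?a) p (Atom A)" and ?q = "Gen (Empt ?b) q (Atom C)"
  let ?t = "Gen (Atom A \<diamondop> s) t (s \<diamondop> Atom C)"
  let ?d = "Idd s \<diamond> ?q \<bullet> Inv (Run ?b s) \<bullet> Lun ?a s \<bullet> Inv ?p \<diamond> Idd s"
  have iso: "is_iso B (strict ?p (act1 s P))" if "P \<in> Ob B" "Src B P = Trg B (cell s)" for P
    using that by (intro strict_iso) simp_all
  have st: "strict ?t P = strict ?d P \<longleftrightarrow>
      strict ?t P \<cdot> strict ?p (act1 s P) = act2 s (strict ?q P)"
    if P: "P \<in> Ob B" "Src B P = Trg B (cell s)" for P
  proof -
    have *: "strict ?d P \<cdot> strict ?p (act1 s P) = act2 s (strict ?q P)"
      using P iso[OF P] by simp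
    show ?thesis
      unfolding *[symmetric]
    proof
      assume "strict ?t P \<cdot> strict ?p (act1 s P) = strict ?d P \<cdot> strict ?p (act1 s P)"
      then show "strict ?t P = strict ?d P"
        by (rule iso_cancel_right[rotated -1])
          (use P iso[OF P] in \<open>simp_all del: strict_Vert strict_Horz\<close>)
    qed simp
  qed
  have "val ?t = val ?d \<longleftrightarrow> ?S"
  proof
    assume v: "val ?t = val ?d"
    show ?S
    proof (intro allI impI)
      fix P assume P: "P \<in> Ob B" "Src B P = Trg B (cell s)"
      have "strict ?t P = strict ?d P" by (rule strict_cong[OF v]) simp_all
      then show "strict ?t P \<cdot> strict ?p (act1 s P) = act2 s (strict ?q P)"
        unfolding st[OF P] .
    qed
  next
    assume S: ?S
    show "val ?t = val ?d"
    proof (rule strict_faithful)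
      fix P assume "P \<in> Ob B" "Src B P = Trg B (cell (src_word ?t))"
      then have P: "P \<in> Ob B" "Src B P = Trg B (cell s)" by simp_all
      show "strict ?t P = strict ?d P"
        unfolding st[OF P] using S P by blast
    qed simp_all
  qed
  then show ?thesis by simp
qed

text \<open>
  The twist of a composite 1-cell: the twisting 1-cell passes first \<open>M\<close>, then \<open>N\<close>.
\<close>
definition paste_twist :: "'m \<Rightarrow> 'm \<Rightarrow> 'm \<Rightarrow> 'm \<Rightarrow> 'm \<Rightarrow> 'c \<Rightarrow> 'c \<Rightarrow> 'c" where
  "paste_twist A C D M N t u = inv_arr B (\<aa> M N D) \<cdot> (\<ii> M \<star> u) \<cdot> \<aa> M C N \<cdot> (t \<star> \<ii> N)
     \<cdot> inv_arr B (\<aa> A M N)"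

abbreviation paste_diagram ::
  "'m \<Rightarrow> 'm \<Rightarrow> 'm \<Rightarrow> ('o, 'm) bword \<Rightarrow> ('o, 'm) bword \<Rightarrow> ('o, 'm, 'c) diagram \<Rightarrow> ('o, 'm, 'c) diagram
    \<Rightarrow> ('o, 'm, 'c) diagram" where
  "paste_diagram A C D m n t u \<equiv> Inv (Asc m n (Atom D)) \<bullet> Idd m \<diamond> u \<bullet> Asc m (Atom C) n
     \<bullet> t \<diamond> Idd n \<bullet> Inv (Asc (Atom A) m n)"

lemma paste_twist_typing:
  assumes [simp]: "A \<in> Ob B" "C \<in> Ob B" "D \<in> Ob B" "M \<in> Ob B" "N \<in> Ob B"
    "Src B A = Src B M" "Trg B A = Src B M" "Src B C = Trg B M" "Trg B C = Trg B M"
    "Src B D = Trg B N" "Trg B D = Trg B N" "Src B N = Trg B M"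
    and [simp]: "t \<in> Ar B" "Dom B t = A \<odot> M" "Cod B t = M \<odot> C"
    and [simp]: "u \<in> Ar B" "Dom B u = C \<odot> N" "Cod B u = N \<odot> D"
  shows "paste_twist A C D M N t u \<in> Ar B"
    "Dom B (paste_twist A C D M N t u) = A \<odot> (M \<odot> N)"
    "Cod B (paste_twist A C D M N t u) = M \<odot> N \<odot> D"
    "is_iso B t \<Longrightarrow> is_iso B u \<Longrightarrow> is_iso B (paste_twist A C D M N t u)"
  by (simp_all add: paste_twist_def is_iso_comp is_iso_hcomp2 iso_inv_arr)

lemma strict_paste:
  assumes [simp]: "A \<in> Ob B" "C \<in> Ob B" "D \<in> Ob B" "M \<in> Ob B" "N \<in> Ob B"
    "Src B A = Src B M" "Trg B A = Src B M" "Src B C = Trg B M" "Trg B C = Trg B M"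
    "Src B D = Trg B N" "Trg B D = Trg B N" "Src B N = Trg B M"
    and [simp]: "t \<in> Ar B" "Dom B t = A \<odot> M" "Cod B t = M \<odot> C"
    and [simp]: "u \<in> Ar B" "Dom B u = C \<odot> N" "Cod B u = N \<odot> D"
    and P: "P \<in> Ob B" "Src B P = Trg B N"
  shows "strict (Gen (Atom A \<diamondop> (Atom M \<diamondop> Atom N)) (paste_twist A C D M N t u)
        (Atom M \<diamondop> Atom N \<diamondop> Atom D)) P
      = (\<ii> M \<star> strict (Gen (Atom C \<diamondop> Atom N) u (Atom N \<diamondop> Atom D)) P)
        \<cdot> strict (Gen (Atom A \<diamondop> Atom M) t (Atom M \<diamondop> Atom C)) (N \<odot> P)" (is "?l = ?r")
proof -
  have "?l = strict (paste_diagram A C D (Atom M) (Atom N) (Gen (Atom A \<diamondop> Atom M) t (Atom M \<diamondop> Atom C))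
      (Gen (Atom C \<diamondop> Atom N) u (Atom N \<diamondop> Atom D))) P"
    by (rule strict_cong) (simp_all add: paste_twist_def)
  then show ?thesis using P by simp
qed

end

context twisting
begin

lemma tw_typing [simp]:
  assumes "a \<in> Obj0 B" "g \<in> carrier G"
  shows "\<Theta>\<^bsub>K\<^esub> a g \<in> Ob B" "Src B (\<Theta>\<^bsub>K\<^esub> a g) = a" "Trg B (\<Theta>\<^bsub>K\<^esub> a g) = a"
  using tw_invertible[OF assms] by (auto simp: invertible1_def cells1_def)

lemma tw_mult_typing [simp]:
  assumes "a \<in> Obj0 B" "g \<in> carrier G" "h \<in> carrier G"
  shows "\<mu>\<^bsub>K\<^esub> a g h \<in> Ar B" "Dom B (\<mu>\<^bsub>K\<^esub> a g h) = \<Theta>\<^bsub>K\<^esub> a g \<odot> \<Theta>\<^bsub>K\<^esub> a h"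
    "Cod B (\<mu>\<^bsub>K\<^esub> a g h) = \<Theta>\<^bsub>K\<^esub> a (g \<otimes>\<^bsub>G\<^esub> h)" "is_iso B (\<mu>\<^bsub>K\<^esub> a g h)"
  using tw_mult_Hom[OF assms] tw_mult_iso[OF assms] by (auto simp: Hom_def)

lemma tw_unit_typing [simp]:
  assumes "a \<in> Obj0 B"
  shows "\<eta>\<^bsub>K\<^esub> a \<in> Ar B" "Dom B (\<eta>\<^bsub>K\<^esub> a) = \<U> a" "Cod B (\<eta>\<^bsub>K\<^esub> a) = \<Theta>\<^bsub>K\<^esub> a \<one>\<^bsub>G\<^esub>"
    "is_iso B (\<eta>\<^bsub>K\<^esub> a)"
  using tw_unit_Hom[OF assms] tw_unit_iso[OF assms] by (auto simp: Hom_def)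

abbreviation twisted_gen :: "'g \<Rightarrow> 'm \<Rightarrow> ('g \<Rightarrow> 'c) \<Rightarrow> ('o, 'm, 'c) diagram" where
  "twisted_gen g M \<tau> \<equiv> Gen (Atom (\<Theta>\<^bsub>K\<^esub> (Src B M) g) \<diamondop> Atom M) (\<tau> g) (Atom M \<diamondop> Atom (\<Theta>\<^bsub>K\<^esub> (Trg B M) g))"

lemma twist_cells1D:
  assumes "X \<in> twist_cells1 B G K"
  shows "fst X \<in> Ob B"
    and "g \<in> carrier G \<Longrightarrow> snd X g \<in> Ar B"
    and "g \<in> carrier G \<Longrightarrow> Dom B (snd X g) = \<Theta>\<^bsub>K\<^esub> (Src B (fst X)) g \<odot> fst X"
    and "g \<in> carrier G \<Longrightarrow> Cod B (snd X g) = fst X \<odot> \<Theta>\<^bsub>K\<^esub> (Trg B (fst X)) g"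
    and "g \<in> carrier G \<Longrightarrow> is_iso B (snd X g)"
  using assms by (auto simp: twist_cells1_def cells1_def Hom_def)

lemma twist_cells1_strict:
  assumes X: "X \<in> twist_cells1 B G K" and P: "P \<in> Ob B" "Src B P = Trg B (fst X)"
  shows "strict (twisted_gen \<one>\<^bsub>G\<^esub> (fst X) (snd X)) P
      \<cdot> strict (Gen (Empt (Src B (fst X))) (\<eta>\<^bsub>K\<^esub> (Src B (fst X))) (Atom (\<Theta>\<^bsub>K\<^esub> (Src B (fst X)) \<one>\<^bsub>G\<^esub>))) (fst X \<odot> P)
    = \<ii> (fst X) \<star> strict (Gen (Empt (Trg B (fst X))) (\<eta>\<^bsub>K\<^esub> (Trg B (fst X))) (Atom (\<Theta>\<^bsub>K\<^esub> (Trg B (fst X)) \<one>\<^bsub>G\<^esub>))) P"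
    and "g \<in> carrier G \<Longrightarrow> h \<in> carrier G \<Longrightarrow>
      strict (twisted_gen (g \<otimes>\<^bsub>G\<^esub> h) (fst X) (snd X)) P
      \<cdot> strict (Gen (Atom (\<Theta>\<^bsub>K\<^esub> (Src B (fst X)) g) \<diamondop> Atom (\<Theta>\<^bsub>K\<^esub> (Src B (fst X)) h)) (\<mu>\<^bsub>K\<^esub> (Src B (fst X)) g h)
          (Atom (\<Theta>\<^bsub>K\<^esub> (Src B (fst X)) (g \<otimes>\<^bsub>G\<^esub> h)))) (fst X \<odot> P)
    = (\<ii> (fst X) \<star> strict (Gen (Atom (\<Theta>\<^bsub>K\<^esub> (Trg B (fst X)) g) \<diamondop> Atom (\<Theta>\<^bsub>K\<^esub> (Trg B (fst X)) h)) (\<mu>\<^bsub>K\<^esub> (Trg B (fst X)) g h)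
          (Atom (\<Theta>\<^bsub>K\<^esub> (Trg B (fst X)) (g \<otimes>\<^bsub>G\<^esub> h)))) P)
      \<cdot> strict (twisted_gen g (fst X) (snd X)) (\<Theta>\<^bsub>K\<^esub> (Trg B (fst X)) h \<odot> P)
      \<cdot> (\<ii> (\<Theta>\<^bsub>K\<^esub> (Src B (fst X)) g) \<star> strict (twisted_gen h (fst X) (snd X)) P)"
proof -
  note [simp] = twist_cells1D[OF X]
  let ?M = "fst X" and ?\<tau> = "snd X"
  let ?a = "Src B ?M" and ?b = "Trg B ?M"
  have eqs: "?\<tau> \<one>\<^bsub>G\<^esub> = (\<ii> ?M \<star> \<eta>\<^bsub>K\<^esub> ?b) \<cdot> inv_arr B (\<rr> ?M) \<cdot> \<ll> ?M \<cdot> (inv_arr B (\<eta>\<^bsub>K\<^esub> ?a) \<star> \<ii> ?M)"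
    "g \<in> carrier G \<Longrightarrow> h \<in> carrier G \<Longrightarrow>
        ?\<tau> (g \<otimes>\<^bsub>G\<^esub> h) =
          (\<ii> ?M \<star> \<mu>\<^bsub>K\<^esub> ?b g h) \<cdot> \<aa> ?M (\<Theta>\<^bsub>K\<^esub> ?b g) (\<Theta>\<^bsub>K\<^esub> ?b h)
          \<cdot> (?\<tau> g \<star> \<ii> (\<Theta>\<^bsub>K\<^esub> ?b h)) \<cdot> inv_arr B (\<aa> (\<Theta>\<^bsub>K\<^esub> ?a g) ?M (\<Theta>\<^bsub>K\<^esub> ?b h))
          \<cdot> (\<ii> (\<Theta>\<^bsub>K\<^esub> ?a g) \<star> ?\<tau> h) \<cdot> \<aa> (\<Theta>\<^bsub>K\<^esub> ?a g) (\<Theta>\<^bsub>K\<^esub> ?a h) ?M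
          \<cdot> (inv_arr B (\<mu>\<^bsub>K\<^esub> ?a g h) \<star> \<ii> ?M)" for g h
    using X by (auto simp: twist_cells1_def cells1_def)
  show "strict (twisted_gen \<one>\<^bsub>G\<^esub> ?M ?\<tau>) P
      \<cdot> strict (Gen (Empt ?a) (\<eta>\<^bsub>K\<^esub> ?a) (Atom (\<Theta>\<^bsub>K\<^esub> ?a \<one>\<^bsub>G\<^esub>))) (?M \<odot> P)
    = \<ii> ?M \<star> strict (Gen (Empt ?b) (\<eta>\<^bsub>K\<^esub> ?b) (Atom (\<Theta>\<^bsub>K\<^esub> ?b \<one>\<^bsub>G\<^esub>))) P"
    using twist_unit_strict[of "Atom ?M" "\<Theta>\<^bsub>K\<^esub> ?a \<one>\<^bsub>G\<^esub>" "\<Theta>\<^bsub>K\<^esub> ?b \<one>\<^bsub>G\<^esub>" "\<eta>\<^bsub>K\<^esub> ?a" "\<eta>\<^bsub>K\<^esub> ?b" "?\<tau> \<one>\<^bsub>G\<^esub>"] eqs(1) P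
    by simp
  show "strict (twisted_gen (g \<otimes>\<^bsub>G\<^esub> h) ?M ?\<tau>) P
      \<cdot> strict (Gen (Atom (\<Theta>\<^bsub>K\<^esub> ?a g) \<diamondop> Atom (\<Theta>\<^bsub>K\<^esub> ?a h)) (\<mu>\<^bsub>K\<^esub> ?a g h) (Atom (\<Theta>\<^bsub>K\<^esub> ?a (g \<otimes>\<^bsub>G\<^esub> h)))) (?M \<odot> P)
    = (\<ii> ?M \<star> strict (Gen (Atom (\<Theta>\<^bsub>K\<^esub> ?b g) \<diamondop> Atom (\<Theta>\<^bsub>K\<^esub> ?b h)) (\<mu>\<^bsub>K\<^esub> ?b g h) (Atom (\<Theta>\<^bsub>K\<^esub> ?b (g \<otimes>\<^bsub>G\<^esub> h)))) P)
      \<cdot> strict (twisted_gen g ?M ?\<tau>) (\<Theta>\<^bsub>K\<^esub> ?b h \<odot> P)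
      \<cdot> (\<ii> (\<Theta>\<^bsub>K\<^esub> ?a g) \<star> strict (twisted_gen h ?M ?\<tau>) P)"
    if "g \<in> carrier G" "h \<in> carrier G"
    using twist_mult_strict[of "Atom ?M" "\<Theta>\<^bsub>K\<^esub> ?a g" "\<Theta>\<^bsub>K\<^esub> ?a h" "\<Theta>\<^bsub>K\<^esub> ?a (g \<otimes>\<^bsub>G\<^esub> h)"
        "\<Theta>\<^bsub>K\<^esub> ?b g" "\<Theta>\<^bsub>K\<^esub> ?b h" "\<Theta>\<^bsub>K\<^esub> ?b (g \<otimes>\<^bsub>G\<^esub> h)" "\<mu>\<^bsub>K\<^esub> ?a g h" "\<mu>\<^bsub>K\<^esub> ?b g h"
        "?\<tau> g" "?\<tau> h" "?\<tau> (g \<otimes>\<^bsub>G\<^esub> h)"] eqs(2)[OF that] P that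
    by simp
qed

lemma snd_twist_comp1:
  "g \<in> carrier G \<Longrightarrow> snd (twist_comp1 B G K X Y) g
    = paste_twist (\<Theta>\<^bsub>K\<^esub> (Src B (fst X)) g) (\<Theta>\<^bsub>K\<^esub> (Src B (fst Y)) g) (\<Theta>\<^bsub>K\<^esub> (Trg B (fst Y)) g)
        (fst X) (fst Y) (snd X g) (snd Y g)"
  by (simp add: twist_comp1_def paste_twist_def split: prod.split)

lemma fst_twist_comp1 [simp]: "fst (twist_comp1 B G K X Y) = fst X \<odot> fst Y"
  by (simp add: twist_comp1_def split: prod.split)

text \<open>
  Distributive laws compose.  For the product of \<open>g\<close> and \<open>h\<close>, the laws of both factors are applied and
  the twist of \<open>Y\<close> at \<open>h\<close> is then exchanged with the twist of \<open>X\<close> at \<open>g\<close>, which act on disjoint parts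
  of the word.
\<close>
lemma twist_comp1_cell:
  assumes X: "X \<in> twist_cells1 B G K" and Y: "Y \<in> twist_cells1 B G K"
    and XY [simp]: "Src B (fst Y) = Trg B (fst X)"
  shows "twist_comp1 B G K X Y \<in> twist_cells1 B G K"
proof -
  note [simp] = twist_cells1D[OF X] twist_cells1D[OF Y] paste_twist_typing snd_twist_comp1
  let ?M = "fst X" and ?\<tau> = "snd X" and ?N = "fst Y" and ?\<sigma> = "snd Y"
  let ?a = "Src B ?M" and ?b = "Trg B ?M" and ?c = "Trg B ?N"
  let ?\<rho> = "snd (twist_comp1 B G K X Y)" and ?s = "Atom ?M \<diamondop> Atom ?N"
  let ?R = "\<lambda>g. Gen (Atom (\<Theta>\<^bsub>K\<^esub> ?a g) \<diamondop> ?s) (?\<rho> g) (?s \<diamondop> Atom (\<Theta>\<^bsub>K\<^esub> ?c g))"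
  let ?\<eta> = "\<lambda>a. Gen (Empt a) (\<eta>\<^bsub>K\<^esub> a) (Atom (\<Theta>\<^bsub>K\<^esub> a \<one>\<^bsub>G\<^esub>))"
  let ?\<mu> = "\<lambda>a g h. Gen (Atom (\<Theta>\<^bsub>K\<^esub> a g) \<diamondop> Atom (\<Theta>\<^bsub>K\<^esub> a h)) (\<mu>\<^bsub>K\<^esub> a g h) (Atom (\<Theta>\<^bsub>K\<^esub> a (g \<otimes>\<^bsub>G\<^esub> h)))"
  let ?T = "\<lambda>g. twisted_gen g ?M ?\<tau>" and ?S = "\<lambda>g. twisted_gen g ?N ?\<sigma>"
  have sR: "strict (?R g) P = (\<ii> ?M \<star> strict (?S g) P) \<cdot> strict (?T g) (?N \<odot> P)"
    if "g \<in> carrier G" "P \<in> Ob B" "Src B P = ?c" for g P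
    using that strict_paste[of "\<Theta>\<^bsub>K\<^esub> ?a g" "\<Theta>\<^bsub>K\<^esub> ?b g" "\<Theta>\<^bsub>K\<^esub> ?c g" ?M ?N "?\<tau> g" "?\<sigma> g" P] by simp
  have unit: "strict (?R \<one>\<^bsub>G\<^esub>) P \<cdot> strict (?\<eta> ?a) (?M \<odot> (?N \<odot> P)) = \<ii> ?M \<star> (\<ii> ?N \<star> strict (?\<eta> ?c) P)"
    if P [simp]: "P \<in> Ob B" "Src B P = ?c" for P
  proof -
    have "strict (?R \<one>\<^bsub>G\<^esub>) P \<cdot> strict (?\<eta> ?a) (?M \<odot> (?N \<odot> P))
        = (\<ii> ?M \<star> strict (?S \<one>\<^bsub>G\<^esub>) P) \<cdot> strict (?T \<one>\<^bsub>G\<^esub>) (?N \<odot> P) \<cdot> strict (?\<eta> ?a) (?M \<odot> (?N \<odot> P))"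
      by (simp add: sR del: snd_twist_comp1)
    also have "\<dots> = \<ii> ?M \<star> (strict (?S \<one>\<^bsub>G\<^esub>) P \<cdot> strict (?\<eta> ?b) (?N \<odot> P))"
      using twist_cells1_strict(1)[OF X, of "?N \<odot> P"] by (simp add: whisker_comp)
    also have "\<dots> = \<ii> ?M \<star> (\<ii> ?N \<star> strict (?\<eta> ?c) P)"
      using twist_cells1_strict(1)[OF Y, of P] by simp
    finally show ?thesis .
  qed
  have mult: "strict (?R (g \<otimes>\<^bsub>G\<^esub> h)) P \<cdot> strict (?\<mu> ?a g h) (?M \<odot> (?N \<odot> P))
      = (\<ii> ?M \<star> (\<ii> ?N \<star> strict (?\<mu> ?c g h) P)) \<cdot> strict (?R g) (\<Theta>\<^bsub>K\<^esub> ?c h \<odot> P)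
        \<cdot> (\<ii> (\<Theta>\<^bsub>K\<^esub> ?a g) \<star> strict (?R h) P)"
    if P [simp]: "P \<in> Ob B" "Src B P = ?c" and gh [simp]: "g \<in> carrier G" "h \<in> carrier G" for P g h
  proof -
    let ?Ag = "\<Theta>\<^bsub>K\<^esub> ?a g" and ?Bh = "\<Theta>\<^bsub>K\<^esub> ?b h" and ?Ch = "\<Theta>\<^bsub>K\<^esub> ?c h" and ?Bg = "\<Theta>\<^bsub>K\<^esub> ?b g"
    have nat: "((\<ii> ?M \<star> (\<ii> ?Bg \<star> strict (?S h) P)) \<cdot> strict (?T g) (?Bh \<odot> (?N \<odot> P))) \<cdot> x
        = strict (?T g) (?N \<odot> (?Ch \<odot> P)) \<cdot> (\<ii> ?Ag \<star> (\<ii> ?M \<star> strict (?S h) P)) \<cdot> x"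
      if "x \<in> Ar B" "Cod B x = ?Ag \<odot> (?M \<odot> (?Bh \<odot> (?N \<odot> P)))" for x
      using that strict_nat[of "?T g" "strict (?S h) P", symmetric]
      by (simp flip: comp_assoc_composable)
    have "strict (?R (g \<otimes>\<^bsub>G\<^esub> h)) P \<cdot> strict (?\<mu> ?a g h) (?M \<odot> (?N \<odot> P))
        = (\<ii> ?M \<star> strict (?S (g \<otimes>\<^bsub>G\<^esub> h)) P) \<cdot> strict (?T (g \<otimes>\<^bsub>G\<^esub> h)) (?N \<odot> P)
          \<cdot> strict (?\<mu> ?a g h) (?M \<odot> (?N \<odot> P))"
      by (simp add: sR del: snd_twist_comp1)
    also have "\<dots> = (\<ii> ?M \<star> (strict (?S (g \<otimes>\<^bsub>G\<^esub> h)) P \<cdot> strict (?\<mu> ?b g h) (?N \<odot> P)))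
          \<cdot> strict (?T g) (?Bh \<odot> (?N \<odot> P)) \<cdot> (\<ii> ?Ag \<star> strict (?T h) (?N \<odot> P))"
      using twist_cells1_strict(2)[OF X, of "?N \<odot> P" g h] by (simp add: whisker_comp)
    also have "\<dots> = (\<ii> ?M \<star> (\<ii> ?N \<star> strict (?\<mu> ?c g h) P)) \<cdot> (\<ii> ?M \<star> strict (?S g) (?Ch \<odot> P))
          \<cdot> ((\<ii> ?M \<star> (\<ii> ?Bg \<star> strict (?S h) P)) \<cdot> strict (?T g) (?Bh \<odot> (?N \<odot> P)))
          \<cdot> (\<ii> ?Ag \<star> strict (?T h) (?N \<odot> P))"
      using twist_cells1_strict(2)[OF Y, of P g h] by (simp add: whisker_comp)
    also have "\<dots> = (\<ii> ?M \<star> (\<ii> ?N \<star> strict (?\<mu> ?c g h) P)) \<cdot> (\<ii> ?M \<star> strict (?S g) (?Ch \<odot> P))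
          \<cdot> strict (?T g) (?N \<odot> (?Ch \<odot> P)) \<cdot> (\<ii> ?Ag \<star> (\<ii> ?M \<star> strict (?S h) P))
          \<cdot> (\<ii> ?Ag \<star> strict (?T h) (?N \<odot> P))"
      by (subst nat) simp_all
    also have "\<dots> = (\<ii> ?M \<star> (\<ii> ?N \<star> strict (?\<mu> ?c g h) P)) \<cdot> strict (?R g) (?Ch \<odot> P)
        \<cdot> (\<ii> ?Ag \<star> strict (?R h) P)"
      by (simp add: sR whisker_comp del: snd_twist_comp1)
    finally show ?thesis .
  qed
  have e1: "?\<rho> \<one>\<^bsub>G\<^esub> = (\<ii> (?M \<odot> ?N) \<star> \<eta>\<^bsub>K\<^esub> ?c) \<cdot> inv_arr B (\<rr> (?M \<odot> ?N)) \<cdot> \<ll> (?M \<odot> ?N)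
      \<cdot> (inv_arr B (\<eta>\<^bsub>K\<^esub> ?a) \<star> \<ii> (?M \<odot> ?N))"
    using twist_unit_strict[of ?s "\<Theta>\<^bsub>K\<^esub> ?a \<one>\<^bsub>G\<^esub>" "\<Theta>\<^bsub>K\<^esub> ?c \<one>\<^bsub>G\<^esub>" "\<eta>\<^bsub>K\<^esub> ?a" "\<eta>\<^bsub>K\<^esub> ?c" "?\<rho> \<one>\<^bsub>G\<^esub>"] unit
    by simp
  have e2: "?\<rho> (g \<otimes>\<^bsub>G\<^esub> h) =
          (\<ii> (?M \<odot> ?N) \<star> \<mu>\<^bsub>K\<^esub> ?c g h) \<cdot> \<aa> (?M \<odot> ?N) (\<Theta>\<^bsub>K\<^esub> ?c g) (\<Theta>\<^bsub>K\<^esub> ?c h)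
          \<cdot> (?\<rho> g \<star> \<ii> (\<Theta>\<^bsub>K\<^esub> ?c h)) \<cdot> inv_arr B (\<aa> (\<Theta>\<^bsub>K\<^esub> ?a g) (?M \<odot> ?N) (\<Theta>\<^bsub>K\<^esub> ?c h))
          \<cdot> (\<ii> (\<Theta>\<^bsub>K\<^esub> ?a g) \<star> ?\<rho> h) \<cdot> \<aa> (\<Theta>\<^bsub>K\<^esub> ?a g) (\<Theta>\<^bsub>K\<^esub> ?a h) (?M \<odot> ?N)
          \<cdot> (inv_arr B (\<mu>\<^bsub>K\<^esub> ?a g h) \<star> \<ii> (?M \<odot> ?N))"
    if [simp]: "g \<in> carrier G" "h \<in> carrier G" for g h
    using twist_mult_strict[of ?s "\<Theta>\<^bsub>K\<^esub> ?a g" "\<Theta>\<^bsub>K\<^esub> ?a h" "\<Theta>\<^bsub>K\<^esub> ?a (g \<otimes>\<^bsub>G\<^esub> h)"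
        "\<Theta>\<^bsub>K\<^esub> ?c g" "\<Theta>\<^bsub>K\<^esub> ?c h" "\<Theta>\<^bsub>K\<^esub> ?c (g \<otimes>\<^bsub>G\<^esub> h)" "\<mu>\<^bsub>K\<^esub> ?a g h" "\<mu>\<^bsub>K\<^esub> ?c g h"
        "?\<rho> g" "?\<rho> h" "?\<rho> (g \<otimes>\<^bsub>G\<^esub> h)"] mult[OF _ _ that]
    by simp
  have ext: "?\<rho> \<in> extensional (carrier G)"
    by (auto simp: twist_comp1_def split: prod.split)
  have "(?M \<odot> ?N, ?\<rho>) \<in> twist_cells1 B G K"
    unfolding twist_cells1_def mem_Collect_eq prod.case
    using e1 e2 ext by (intro exI[of _ ?a] exI[of _ ?c]) (simp add: cells1_def Hom_def)
  then show ?thesis by (metis fst_twist_comp1 prod.collapse)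
qed

end

section \<open>The bicategory of twists\<close>

context twisting
begin

abbreviation W where "W \<equiv> twist_bicat B G K"

lemma twist_bicat_simps:
  "Ob W = twist_cells1 B G K"
  "Obj0 W = Obj0 B"
  "Src W X = Src B (fst X)"
  "Trg W X = Trg B (fst X)"
  "\<U>\<^bsub>W\<^esub> a = twist_unit B G K a"
  "X \<odot>\<^bsub>W\<^esub> Y = twist_comp1 B G K X Y"
  "ident W X = (X, \<ii> (fst X), X)"
  "\<aa>\<^bsub>W\<^esub> X Y Z = ((X \<odot>\<^bsub>W\<^esub> Y) \<odot>\<^bsub>W\<^esub> Z, \<aa> (fst X) (fst Y) (fst Z), X \<odot>\<^bsub>W\<^esub> (Y \<odot>\<^bsub>W\<^esub> Z))"
  "\<ll>\<^bsub>W\<^esub> X = (\<U>\<^bsub>W\<^esub> (Src B (fst X)) \<odot>\<^bsub>W\<^esub> X, \<ll> (fst X), X)"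
  "\<rr>\<^bsub>W\<^esub> X = (X \<odot>\<^bsub>W\<^esub> \<U>\<^bsub>W\<^esub> (Trg B (fst X)), \<rr> (fst X), X)"
  "Dom W \<phi> = fst \<phi>"
  "Cod W \<phi> = snd (snd \<phi>)"
  "\<psi> \<cdot>\<^bsub>W\<^esub> \<phi> = (fst \<phi>, fst (snd \<psi>) \<cdot> fst (snd \<phi>), snd (snd \<psi>))"
  "\<phi> \<star>\<^bsub>W\<^esub> \<psi> = (fst \<phi> \<odot>\<^bsub>W\<^esub> fst \<psi>, fst (snd \<phi>) \<star> fst (snd \<psi>), snd (snd \<phi>) \<odot>\<^bsub>W\<^esub> snd (snd \<psi>))"
  "\<phi> \<in> Ar W \<longleftrightarrow> fst \<phi> \<in> twist_cells1 B G K \<and> snd (snd \<phi>) \<in> twist_cells1 B G K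
    \<and> twist_compatible B G K (fst \<phi>) (fst (snd \<phi>)) (snd (snd \<phi>))"
  by (auto simp: twist_bicat_def Let_def split: prod.splits)

lemma twist_compatible_typing:
  assumes "twist_compatible B G K X f Y"
  shows "f \<in> Ar B" "Dom B f = fst X" "Cod B f = fst Y"
  using assms by (auto simp: twist_compatible_def Hom_def)

lemma twist_compatible_strict:
  assumes X: "X \<in> twist_cells1 B G K" and Y: "Y \<in> twist_cells1 B G K"
    and f: "twist_compatible B G K X f Y" and [simp]: "g \<in> carrier G"
    and P: "P \<in> Ob B" "Src B P = Trg B (fst X)"
  shows "strict (twisted_gen g (fst Y) (snd Y)) P
      \<cdot> (\<ii> (\<Theta>\<^bsub>K\<^esub> (Src B (fst X)) g) \<star> strict (Gen (Atom (fst X)) f (Atom (fst Y))) P)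
    = strict (Gen (Atom (fst X)) f (Atom (fst Y))) (\<Theta>\<^bsub>K\<^esub> (Trg B (fst X)) g \<odot> P)
      \<cdot> strict (twisted_gen g (fst X) (snd X)) P"
proof -
  note [simp] = twist_cells1D[OF X] twist_cells1D[OF Y] twist_compatible_typing[OF f]
  have [simp]: "Src B (fst Y) = Src B (fst X)" "Trg B (fst Y) = Trg B (fst X)"
    using Src_Trg_Cod[of f] by simp_all
  let ?F = "Gen (Atom (fst X)) f (Atom (fst Y))"
  let ?d = "twisted_gen g (fst Y) (snd Y) \<bullet> Idd (Atom (\<Theta>\<^bsub>K\<^esub> (Src B (fst X)) g)) \<diamond> ?F"
  let ?d' = "?F \<diamond> Idd (Atom (\<Theta>\<^bsub>K\<^esub> (Trg B (fst X)) g)) \<bullet> twisted_gen g (fst X) (snd X)"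
  have "val ?d = val ?d'" using f by (simp add: twist_compatible_def)
  then have "strict ?d P = strict ?d' P" by (rule strict_cong) simp_all
  then show ?thesis using P by simp
qed

lemma twist_compatible_comp:
  assumes X: "X \<in> twist_cells1 B G K" and Y: "Y \<in> twist_cells1 B G K" and Z: "Z \<in> twist_cells1 B G K"
    and f: "twist_compatible B G K X f Y" and k: "twist_compatible B G K Y k Z"
  shows "twist_compatible B G K X (k \<cdot> f) Z"
proof -
  note [simp] = twist_cells1D[OF X] twist_cells1D[OF Y] twist_cells1D[OF Z]
    twist_compatible_typing[OF f] twist_compatible_typing[OF k]
  let ?a = "Src B (fst X)" and ?b = "Trg B (fst X)"
  have [simp]: "Src B (fst Y) = ?a" "Trg B (fst Y) = ?b" "Src B (fst Z) = ?a" "Trg B (fst Z) = ?b"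
    using Src_Trg_Cod[of f] Src_Trg_Cod[of k] by simp_all
  have "snd Z g \<cdot> (\<ii> (\<Theta>\<^bsub>K\<^esub> ?a g) \<star> (k \<cdot> f)) = ((k \<cdot> f) \<star> \<ii> (\<Theta>\<^bsub>K\<^esub> ?b g)) \<cdot> snd X g"
    if [simp]: "g \<in> carrier G" for g
  proof -
    have "snd Z g \<cdot> (\<ii> (\<Theta>\<^bsub>K\<^esub> ?a g) \<star> (k \<cdot> f))
        = (snd Z g \<cdot> (\<ii> (\<Theta>\<^bsub>K\<^esub> ?a g) \<star> k)) \<cdot> (\<ii> (\<Theta>\<^bsub>K\<^esub> ?a g) \<star> f)"
      by (simp add: whisker_comp)
    also have "\<dots> = ((k \<star> \<ii> (\<Theta>\<^bsub>K\<^esub> ?b g)) \<cdot> snd Y g) \<cdot> (\<ii> (\<Theta>\<^bsub>K\<^esub> ?a g) \<star> f)"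
      using k by (simp add: twist_compatible_def)
    also have "\<dots> = (k \<star> \<ii> (\<Theta>\<^bsub>K\<^esub> ?b g)) \<cdot> (f \<star> \<ii> (\<Theta>\<^bsub>K\<^esub> ?b g)) \<cdot> snd X g"
      using f by (simp add: twist_compatible_def)
    finally show ?thesis by (simp add: whisker_comp)
  qed
  then show ?thesis by (simp add: twist_compatible_def Hom_def)
qed

lemma twist_compatible_ident: "X \<in> twist_cells1 B G K \<Longrightarrow> twist_compatible B G K X (\<ii> (fst X)) X"
  using twist_cells1D[of X] by (simp add: twist_compatible_def Hom_def)

lemma twist_compatible_inv:
  assumes X: "X \<in> twist_cells1 B G K" and Y: "Y \<in> twist_cells1 B G K"
    and f: "twist_compatible B G K X f Y" and iso [simp]: "is_iso B f"
  shows "twist_compatible B G K Y (inv_arr B f) X"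
proof -
  note [simp] = twist_cells1D[OF X] twist_cells1D[OF Y] twist_compatible_typing[OF f]
  let ?a = "Src B (fst X)" and ?b = "Trg B (fst X)"
  have [simp]: "Src B (fst Y) = ?a" "Trg B (fst Y) = ?b"
    using Src_Trg_Cod[of f] by simp_all
  have "snd X g \<cdot> (\<ii> (\<Theta>\<^bsub>K\<^esub> ?a g) \<star> inv_arr B f) = (inv_arr B f \<star> \<ii> (\<Theta>\<^bsub>K\<^esub> ?b g)) \<cdot> snd Y g"
    (is "?l = ?r") if [simp]: "g \<in> carrier G" for g
  proof (rule iso_cancel_left[of "f \<star> \<ii> (\<Theta>\<^bsub>K\<^esub> ?b g)"])
    have "(f \<star> \<ii> (\<Theta>\<^bsub>K\<^esub> ?b g)) \<cdot> ?l
        = ((f \<star> \<ii> (\<Theta>\<^bsub>K\<^esub> ?b g)) \<cdot> snd X g) \<cdot> (\<ii> (\<Theta>\<^bsub>K\<^esub> ?a g) \<star> inv_arr B f)" by simp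
    also have "\<dots> = (snd Y g \<cdot> (\<ii> (\<Theta>\<^bsub>K\<^esub> ?a g) \<star> f)) \<cdot> (\<ii> (\<Theta>\<^bsub>K\<^esub> ?a g) \<star> inv_arr B f)"
      using f by (simp add: twist_compatible_def)
    also have "\<dots> = (f \<star> \<ii> (\<Theta>\<^bsub>K\<^esub> ?b g)) \<cdot> ?r"
      by (simp add: comp_hcomp2_comp comp_hcomp2_comp_rest)
    finally show "(f \<star> \<ii> (\<Theta>\<^bsub>K\<^esub> ?b g)) \<cdot> ?l = (f \<star> \<ii> (\<Theta>\<^bsub>K\<^esub> ?b g)) \<cdot> ?r" .
  qed (simp_all add: is_iso_hcomp2)
  then show ?thesis by (simp add: twist_compatible_def Hom_def)
qed

text \<open>
  The two 2-cells pass the pasted twist one after the other; in between, each is exchanged with the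
  part of the twist that concerns the other 1-cell.
\<close>
lemma twist_compatible_hcomp:
  assumes X: "X \<in> twist_cells1 B G K" and Y: "Y \<in> twist_cells1 B G K"
    and X': "X' \<in> twist_cells1 B G K" and Y': "Y' \<in> twist_cells1 B G K"
    and f: "twist_compatible B G K X f X'" and k: "twist_compatible B G K Y k Y'"
    and XY [simp]: "Src B (fst Y) = Trg B (fst X)"
  shows "twist_compatible B G K (twist_comp1 B G K X Y) (f \<star> k) (twist_comp1 B G K X' Y')"
proof -
  note [simp] = twist_cells1D[OF X] twist_cells1D[OF Y] twist_cells1D[OF X'] twist_cells1D[OF Y']
    twist_compatible_typing[OF f] twist_compatible_typing[OF k] paste_twist_typing
  let ?M = "fst X" and ?M' = "fst X'" and ?N = "fst Y" and ?N' = "fst Y'"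
  let ?a = "Src B ?M" and ?b = "Trg B ?M" and ?c = "Trg B ?N"
  have [simp]: "Src B ?M' = ?a" "Trg B ?M' = ?b" "Src B ?N' = ?b" "Trg B ?N' = ?c"
    using Src_Trg_Cod[of f] Src_Trg_Cod[of k] by simp_all
  have "snd (twist_comp1 B G K X' Y') g \<cdot> (\<ii> (\<Theta>\<^bsub>K\<^esub> ?a g) \<star> (f \<star> k))
      = ((f \<star> k) \<star> \<ii> (\<Theta>\<^bsub>K\<^esub> ?c g)) \<cdot> snd (twist_comp1 B G K X Y) g"
    if [simp]: "g \<in> carrier G" for g
  proof -
    let ?A = "\<Theta>\<^bsub>K\<^esub> ?a g" and ?C = "\<Theta>\<^bsub>K\<^esub> ?b g" and ?D = "\<Theta>\<^bsub>K\<^esub> ?c g"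
    let ?T = "twisted_gen g ?M (snd X)" and ?T' = "twisted_gen g ?M' (snd X')"
    let ?S = "twisted_gen g ?N (snd Y)" and ?S' = "twisted_gen g ?N' (snd Y')"
    let ?F = "Gen (Atom ?M) f (Atom ?M')" and ?K = "Gen (Atom ?N) k (Atom ?N')"
    let ?d = "paste_diagram ?A ?C ?D (Atom ?M') (Atom ?N') ?T' ?S' \<bullet> Idd (Atom ?A) \<diamond> (?F \<diamond> ?K)"
    let ?d' = "(?F \<diamond> ?K) \<diamond> Idd (Atom ?D) \<bullet> paste_diagram ?A ?C ?D (Atom ?M) (Atom ?N) ?T ?S"
    have "val ?d = val ?d'"
    proof (rule strict_faithful)
      fix P assume "P \<in> Ob B" "Src B P = Trg B (cell (src_word ?d))"
      then have P [simp]: "P \<in> Ob B" "Src B P = ?c" by simp_all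
      have fc: "strict ?T' (?N' \<odot> P) \<cdot> (\<ii> ?A \<star> strict ?F (?N' \<odot> P))
          = strict ?F (?C \<odot> (?N' \<odot> P)) \<cdot> strict ?T (?N' \<odot> P)"
        using twist_compatible_strict[OF X X' f \<open>g \<in> carrier G\<close>, of "?N' \<odot> P"] by simp
      have nF: "(\<ii> ?M' \<star> strict ?S' P) \<cdot> strict ?F (?C \<odot> (?N' \<odot> P))
          = strict ?F (?N' \<odot> (?D \<odot> P)) \<cdot> (\<ii> ?M \<star> strict ?S' P)"
        using strict_nat[of ?F "strict ?S' P"] by simp
      have "strict ?d P = (\<ii> ?M' \<star> strict ?S' P)
          \<cdot> (strict ?T' (?N' \<odot> P) \<cdot> (\<ii> ?A \<star> strict ?F (?N' \<odot> P))) \<cdot> (\<ii> ?A \<star> (\<ii> ?M \<star> strict ?K P))"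
        by (simp add: whisker_comp)
      also have "\<dots> = (\<ii> ?M' \<star> strict ?S' P) \<cdot> strict ?F (?C \<odot> (?N' \<odot> P))
          \<cdot> strict ?T (?N' \<odot> P) \<cdot> (\<ii> ?A \<star> (\<ii> ?M \<star> strict ?K P))"
        by (simp only: fc) simp
      also have "\<dots> = ((\<ii> ?M' \<star> strict ?S' P) \<cdot> strict ?F (?C \<odot> (?N' \<odot> P)))
          \<cdot> (\<ii> ?M \<star> (\<ii> ?C \<star> strict ?K P)) \<cdot> strict ?T (?N \<odot> P)"
        using strict_nat[of ?T "strict ?K P"] by simp
      also have "\<dots> = strict ?F (?N' \<odot> (?D \<odot> P))
          \<cdot> (\<ii> ?M \<star> (strict ?S' P \<cdot> (\<ii> ?C \<star> strict ?K P))) \<cdot> strict ?T (?N \<odot> P)"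
        by (simp only: nF) (simp add: whisker_comp)
      also have "\<dots> = strict ?F (?N' \<odot> (?D \<odot> P)) \<cdot> (\<ii> ?M \<star> strict ?K (?D \<odot> P))
          \<cdot> (\<ii> ?M \<star> strict ?S P) \<cdot> strict ?T (?N \<odot> P)"
        using twist_compatible_strict[OF Y Y' k \<open>g \<in> carrier G\<close>, of P] by (simp add: whisker_comp)
      also have "\<dots> = strict ?d' P" by simp
      finally show "strict ?d P = strict ?d' P" .
    qed simp_all
    then show ?thesis by (simp add: snd_twist_comp1 paste_twist_def)
  qed
  then show ?thesis by (simp add: twist_compatible_def Hom_def)
qed

text \<open>
  In strict form both composite twists are the same pasting of three twists, and the associator is
  an identity.
\<close>
lemma twist_compatible_asc:
  assumes X: "X \<in> twist_cells1 B G K" and Y: "Y \<in> twist_cells1 B G K" and Z: "Z \<in> twist_cells1 B G K"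
    and [simp]: "Src B (fst Y) = Trg B (fst X)" "Src B (fst Z) = Trg B (fst Y)"
  shows "twist_compatible B G K (twist_comp1 B G K (twist_comp1 B G K X Y) Z)
    (\<aa> (fst X) (fst Y) (fst Z)) (twist_comp1 B G K X (twist_comp1 B G K Y Z))"
proof -
  note [simp] = twist_cells1D[OF X] twist_cells1D[OF Y] twist_cells1D[OF Z]
  let ?M = "Atom (fst X)" and ?N = "Atom (fst Y)" and ?Q = "Atom (fst Z)"
  let ?a = "Src B (fst X)" and ?b = "Trg B (fst X)" and ?c = "Trg B (fst Y)" and ?d = "Trg B (fst Z)"
  have "snd (twist_comp1 B G K X (twist_comp1 B G K Y Z)) g \<cdot> (\<ii> (\<Theta>\<^bsub>K\<^esub> ?a g) \<star> \<aa> (fst X) (fst Y) (fst Z))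
      = (\<aa> (fst X) (fst Y) (fst Z) \<star> \<ii> (\<Theta>\<^bsub>K\<^esub> ?d g)) \<cdot> snd (twist_comp1 B G K (twist_comp1 B G K X Y) Z) g"
    if [simp]: "g \<in> carrier G" for g
  proof -
    let ?A = "\<Theta>\<^bsub>K\<^esub> ?a g" and ?C = "\<Theta>\<^bsub>K\<^esub> ?b g" and ?D = "\<Theta>\<^bsub>K\<^esub> ?c g" and ?E = "\<Theta>\<^bsub>K\<^esub> ?d g"
    let ?T = "twisted_gen g (fst X) (snd X)" and ?S = "twisted_gen g (fst Y) (snd Y)"
      and ?R = "twisted_gen g (fst Z) (snd Z)"
    let ?d = "paste_diagram ?A ?C ?E ?M (?N \<diamondop> ?Q) ?T (paste_diagram ?C ?D ?E ?N ?Q ?S ?R)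
      \<bullet> Idd (Atom ?A) \<diamond> Asc ?M ?N ?Q"
    let ?d' = "Asc ?M ?N ?Q \<diamond> Idd (Atom ?E)
      \<bullet> paste_diagram ?A ?D ?E (?M \<diamondop> ?N) ?Q (paste_diagram ?A ?C ?D ?M ?N ?T ?S) ?R"
    have "val ?d = val ?d'"
      by (rule strict_faithful) (simp_all add: whisker_comp)
    then show ?thesis by (simp add: snd_twist_comp1 paste_twist_def)
  qed
  then show ?thesis by (simp add: twist_compatible_def Hom_def)
qed

lemma fst_twist_unit [simp]: "fst (twist_unit B G K a) = \<U> a"
  by (simp add: twist_unit_def)

lemma twist_compatible_unitors:
  assumes X: "X \<in> twist_cells1 B G K"
  shows "twist_compatible B G K (twist_comp1 B G K (twist_unit B G K (Src B (fst X))) X) (\<ll> (fst X)) X"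
    "twist_compatible B G K (twist_comp1 B G K X (twist_unit B G K (Trg B (fst X)))) (\<rr> (fst X)) X"
proof -
  note [simp] = twist_cells1D[OF X]
  let ?M = "Atom (fst X)" and ?a = "Src B (fst X)" and ?b = "Trg B (fst X)"
  have "snd X g \<cdot> (\<ii> (\<Theta>\<^bsub>K\<^esub> ?a g) \<star> \<ll> (fst X))
      = (\<ll> (fst X) \<star> \<ii> (\<Theta>\<^bsub>K\<^esub> ?b g)) \<cdot> snd (twist_comp1 B G K (twist_unit B G K ?a) X) g \<and>
    snd X g \<cdot> (\<ii> (\<Theta>\<^bsub>K\<^esub> ?a g) \<star> \<rr> (fst X))
      = (\<rr> (fst X) \<star> \<ii> (\<Theta>\<^bsub>K\<^esub> ?b g)) \<cdot> snd (twist_comp1 B G K X (twist_unit B G K ?b)) g"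
    if [simp]: "g \<in> carrier G" for g
  proof -
    let ?A = "Atom (\<Theta>\<^bsub>K\<^esub> ?a g)" and ?C = "Atom (\<Theta>\<^bsub>K\<^esub> ?b g)"
    let ?T = "twisted_gen g (fst X) (snd X)"
    let ?d = "?T \<bullet> Idd ?A \<diamond> Lun ?a ?M"
    let ?d' = "Lun ?a ?M \<diamond> Idd ?C \<bullet> paste_diagram (cell ?A) (cell ?A) (cell ?C) (Empt ?a) ?M
      (Inv (Lun ?a ?A) \<bullet> Run ?a ?A) ?T"
    let ?e = "?T \<bullet> Idd ?A \<diamond> Run ?b ?M"
    let ?e' = "Run ?b ?M \<diamond> Idd ?C \<bullet> paste_diagram (cell ?A) (cell ?C) (cell ?C) ?M (Empt ?b)
      ?T (Inv (Lun ?b ?C) \<bullet> Run ?b ?C)"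
    have "val ?d = val ?d'" "val ?e = val ?e'"
      by (rule strict_faithful; simp)+
    then show ?thesis by (simp add: snd_twist_comp1 paste_twist_def twist_unit_def)
  qed
  then show "twist_compatible B G K (twist_comp1 B G K (twist_unit B G K ?a) X) (\<ll> (fst X)) X"
    "twist_compatible B G K (twist_comp1 B G K X (twist_unit B G K ?b)) (\<rr> (fst X)) X"
    by (simp_all add: twist_compatible_def Hom_def)
qed

end

section \<open>Duals of twisted 1-cells\<close>

context twisting
begin

lemma Hom_twist_bicat:
  "\<phi> \<in> Hom W X Y \<longleftrightarrow> X \<in> twist_cells1 B G K \<and> Y \<in> twist_cells1 B G K
    \<and> twist_compatible B G K X (fst (snd \<phi>)) Y \<and> \<phi> = (X, fst (snd \<phi>), Y)"
  by (cases \<phi>) (auto simp: Hom_def twist_bicat_simps)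

text \<open>
  An invertible 2-cell compatible with the twists has a compatible inverse, so constraint cells are
  inverted in the bicategory of twists as they are in the underlying bicategory.
\<close>
lemma inv_arr_twist_bicat:
  assumes "X \<in> twist_cells1 B G K" "Y \<in> twist_cells1 B G K"
    and f: "twist_compatible B G K X f Y" and iso: "is_iso B f"
  shows "inv_arr W (X, f, Y) = (Y, inv_arr B f, X)"
  unfolding inv_arr_def[of W]
proof (rule the_equality)
  note [simp] = assms twist_compatible_typing[OF f]
  show "are_inverse W (X, f, Y) (Y, inv_arr B f, X)"
    by (simp add: are_inverse_def twist_bicat_simps Hom_twist_bicat twist_compatible_inv)
  fix \<phi> assume "are_inverse W (X, f, Y) \<phi>"
  then have "\<phi> = (Y, fst (snd \<phi>), X)" "are_inverse B f (fst (snd \<phi>))"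
    by (auto simp: are_inverse_def twist_bicat_simps Hom_twist_bicat Hom_def
        dest: twist_compatible_typing)
  then show "\<phi> = (Y, inv_arr B f, X)" using are_inverse_imp_inv_arr by metis
qed

text \<open>
  A dual pair of twisted 1-cells is a dual pair of underlying 1-cells whose unit and counit are
  compatible with the twists: vertical and horizontal composition act on underlying 2-cells, and
  so the triangle identities are the same.
\<close>
lemma left_dual_twist_bicat:
  "left_dual W a b X X' \<delta> \<epsilon> \<longleftrightarrow>
     X \<in> twist_cells1 B G K \<and> X' \<in> twist_cells1 B G K
     \<and> \<delta> \<in> Hom W (\<U>\<^bsub>W\<^esub> b) (X' \<odot>\<^bsub>W\<^esub> X) \<and> \<epsilon> \<in> Hom W (X \<odot>\<^bsub>W\<^esub> X') (\<U>\<^bsub>W\<^esub> a)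
     \<and> left_dual B a b (fst X) (fst X') (fst (snd \<delta>)) (fst (snd \<epsilon>))" (is "?L \<longleftrightarrow> ?R")
proof -
  have *: "?L \<longleftrightarrow> ?R" if 1: "X \<in> twist_cells1 B G K" "X' \<in> twist_cells1 B G K"
    "Src B (fst X) = a" "Trg B (fst X) = b" "Src B (fst X') = b" "Trg B (fst X') = a"
    and \<delta>: "\<delta> \<in> Hom W (\<U>\<^bsub>W\<^esub> b) (X' \<odot>\<^bsub>W\<^esub> X)" and \<epsilon>: "\<epsilon> \<in> Hom W (X \<odot>\<^bsub>W\<^esub> X') (\<U>\<^bsub>W\<^esub> a)"
  proof -
    note [simp] = 1 twist_cells1D[OF 1(1)] twist_cells1D[OF 1(2)]
    obtain n e where \<delta>_eq: "\<delta> = (\<U>\<^bsub>W\<^esub> b, n, X' \<odot>\<^bsub>W\<^esub> X)" and \<epsilon>_eq: "\<epsilon> = (X \<odot>\<^bsub>W\<^esub> X', e, \<U>\<^bsub>W\<^esub> a)"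
      and n: "twist_compatible B G K (\<U>\<^bsub>W\<^esub> b) n (X' \<odot>\<^bsub>W\<^esub> X)"
      and e: "twist_compatible B G K (X \<odot>\<^bsub>W\<^esub> X') e (\<U>\<^bsub>W\<^esub> a)"
      and U: "\<U>\<^bsub>W\<^esub> a \<in> twist_cells1 B G K" "\<U>\<^bsub>W\<^esub> b \<in> twist_cells1 B G K"
      using \<delta> \<epsilon> unfolding Hom_twist_bicat by metis
    have [simp]: "a \<in> Obj0 B" "b \<in> Obj0 B"
      using Src_Trg_Obj0[of "fst X"] by simp_all
    note [simp] = twist_comp1_cell U[unfolded twist_bicat_simps] twist_compatible_asc
    have inv: "inv_arr W (\<aa>\<^bsub>W\<^esub> X X' X) = (X \<odot>\<^bsub>W\<^esub> (X' \<odot>\<^bsub>W\<^esub> X), inv_arr B (\<aa> (fst X) (fst X') (fst X)), (X \<odot>\<^bsub>W\<^esub> X') \<odot>\<^bsub>W\<^esub> X)"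
      "inv_arr W (\<rr>\<^bsub>W\<^esub> X) = (X, inv_arr B (\<rr> (fst X)), X \<odot>\<^bsub>W\<^esub> \<U>\<^bsub>W\<^esub> b)"
      "inv_arr W (\<ll>\<^bsub>W\<^esub> X') = (X', inv_arr B (\<ll> (fst X')), \<U>\<^bsub>W\<^esub> b \<odot>\<^bsub>W\<^esub> X')"
      using twist_compatible_unitors[OF 1(1)] twist_compatible_unitors[OF 1(2)]
      by (simp_all add: twist_bicat_simps inv_arr_twist_bicat)
    show ?thesis
      unfolding left_dual_def inv
      using \<delta> \<epsilon> twist_compatible_typing[OF n] twist_compatible_typing[OF e]
      by (simp add: \<delta>_eq \<epsilon>_eq cells1_def twist_bicat_simps) (simp add: Hom_def)
  qed
  show ?thesis
  proof
    assume L: ?L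
    then have "X \<in> twist_cells1 B G K" "X' \<in> twist_cells1 B G K"
      "Src B (fst X) = a" "Trg B (fst X) = b" "Src B (fst X') = b" "Trg B (fst X') = a"
      "\<delta> \<in> Hom W (\<U>\<^bsub>W\<^esub> b) (X' \<odot>\<^bsub>W\<^esub> X)" "\<epsilon> \<in> Hom W (X \<odot>\<^bsub>W\<^esub> X') (\<U>\<^bsub>W\<^esub> a)"
      unfolding left_dual_def cells1_def mem_Collect_eq twist_bicat_simps by blast+
    then show ?R by (rule iffD1[OF * L])
  next
    assume R: ?R
    then show ?L using * left_dual_typing[of a b "fst X" "fst X'" "fst (snd \<delta>)" "fst (snd \<epsilon>)"] by simp
  qed
qed

text \<open>
  The unit and counit of the composite are pasted from 2-cells between twisted 1-cells, so their
  compatibility with the twists is checked factor by factor.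
\<close>

lemma left_dual_twist_comp:
  assumes dX: "left_dual W a b X X' \<delta> \<epsilon>" and dY: "left_dual W b c Y Y' \<delta>' \<epsilon>'"
  shows "left_dual W a c (X \<odot>\<^bsub>W\<^esub> Y) (Y' \<odot>\<^bsub>W\<^esub> X')
    (\<U>\<^bsub>W\<^esub> c, comp_coev (fst X) (fst X') (fst Y) (fst Y') (fst (snd \<delta>)) (fst (snd \<delta>')), (Y' \<odot>\<^bsub>W\<^esub> X') \<odot>\<^bsub>W\<^esub> (X \<odot>\<^bsub>W\<^esub> Y))
    ((X \<odot>\<^bsub>W\<^esub> Y) \<odot>\<^bsub>W\<^esub> (Y' \<odot>\<^bsub>W\<^esub> X'), comp_ev (fst X) (fst X') (fst Y) (fst Y') (fst (snd \<epsilon>)) (fst (snd \<epsilon>')), \<U>\<^bsub>W\<^esub> a)"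
proof -
  define n e m f where "n = fst (snd \<delta>)" "e = fst (snd \<epsilon>)" "m = fst (snd \<delta>')" "f = fst (snd \<epsilon>')"
  have [simp]: "X \<in> twist_cells1 B G K" "X' \<in> twist_cells1 B G K" "Y \<in> twist_cells1 B G K"
    "Y' \<in> twist_cells1 B G K"
    and B: "left_dual B a b (fst X) (fst X') n e" "left_dual B b c (fst Y) (fst Y') m f"
    and n: "twist_compatible B G K (twist_unit B G K b) n (twist_comp1 B G K X' X)"
    and e: "twist_compatible B G K (twist_comp1 B G K X X') e (twist_unit B G K a)"
    and m: "twist_compatible B G K (twist_unit B G K c) m (twist_comp1 B G K Y' Y)"
    and f: "twist_compatible B G K (twist_comp1 B G K Y Y') f (twist_unit B G K b)"
    and [simp]: "twist_unit B G K a \<in> twist_cells1 B G K" "twist_unit B G K b \<in> twist_cells1 B G K"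
      "twist_unit B G K c \<in> twist_cells1 B G K"
    using dX dY unfolding left_dual_twist_bicat Hom_twist_bicat n_e_m_f_def twist_bicat_simps by auto
  note [simp] = left_dual_typing[OF B(1)] left_dual_typing[OF B(2)] twist_comp1_cell
  note compat = n e m f twist_compatible_ident twist_compatible_asc
    twist_compatible_unitors(1)[of Y, simplified] twist_compatible_unitors(1)[of X', simplified]
  let ?c = "twist_comp1 B G K" and ?u = "twist_unit B G K"
  let ?i = "\<lambda>Z. \<ii> (fst Z)"
  have s: "twist_compatible B G K (?c Y' Y) (?i Y' \<star> inv_arr B (\<ll> (fst Y))) (?c Y' (?c (?u b) Y))"
    "twist_compatible B G K (?c Y' (?c (?u b) Y)) (?i Y' \<star> (n \<star> ?i Y)) (?c Y' (?c (?c X' X) Y))"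
    "twist_compatible B G K (?c Y' (?c (?c X' X) Y)) (?i Y' \<star> \<aa> (fst X') (fst X) (fst Y)) (?c Y' (?c X' (?c X Y)))"
    "twist_compatible B G K (?c Y' (?c X' (?c X Y))) (inv_arr B (\<aa> (fst Y') (fst X') (fst X \<odot> fst Y)))
      (?c (?c Y' X') (?c X Y))"
    using twist_compatible_asc[of Y' X' "?c X Y"]
    by (auto intro!: twist_compatible_hcomp twist_compatible_inv compat)
  have c1: "twist_compatible B G K (?u c) (comp_coev (fst X) (fst X') (fst Y) (fst Y') n m)
      (?c (?c Y' X') (?c X Y))"
    unfolding comp_coev_def
    by (intro s[THEN twist_compatible_comp[rotated -1]] m) simp_all
  have r: "twist_compatible B G K (?c (?c X Y) (?c Y' X')) (\<aa> (fst X) (fst Y) (fst Y' \<odot> fst X')) (?c X (?c Y (?c Y' X')))"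
    "twist_compatible B G K (?c X (?c Y (?c Y' X'))) (?i X \<star> inv_arr B (\<aa> (fst Y) (fst Y') (fst X'))) (?c X (?c (?c Y Y') X'))"
    "twist_compatible B G K (?c X (?c (?c Y Y') X')) (?i X \<star> (f \<star> ?i X')) (?c X (?c (?u b) X'))"
    "twist_compatible B G K (?c X (?c (?u b) X')) (?i X \<star> \<ll> (fst X')) (?c X X')"
    using twist_compatible_asc[of X Y "?c Y' X'"]
    by (auto intro!: twist_compatible_hcomp twist_compatible_inv compat)
  have c2: "twist_compatible B G K (?c (?c X Y) (?c Y' X')) (comp_ev (fst X) (fst X') (fst Y) (fst Y') e f)
      (?u a)"
    unfolding comp_ev_def
    by (intro r[THEN twist_compatible_comp[rotated -1]] e[THEN twist_compatible_comp[rotated -1]] r(1))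
      simp_all
  show ?thesis
    unfolding left_dual_twist_bicat Hom_twist_bicat
    using c1 c2 left_dual_comp[OF B] by (simp add: twist_bicat_simps n_e_m_f_def)
qed

end

section \<open>Cutting a trace open\<close>

context bicategory
begin

text \<open>
  A trace is a closed loop cut open at one place.  The incoming half creates \<open>X' \<odot> X\<close> on the left of
  the twisting 1-cell \<open>C\<close> and applies the endomorphism; the outgoing half lets the twisting 1-cell pass
  \<open>X\<close>, where it becomes \<open>A\<close>, and contracts \<open>X \<odot> X'\<close>.  Between the halves, \<open>X'\<close> is rotated past \<open>X \<odot> C\<close>.
\<close>
definition trace_in :: "'m \<Rightarrow> 'm \<Rightarrow> 'm \<Rightarrow> 'c \<Rightarrow> 'c \<Rightarrow> 'c" where
  "trace_in C X X' n f = \<aa> X' X C \<cdot> (((\<ii> X' \<star> f) \<cdot> n) \<star> \<ii> C) \<cdot> inv_arr B (\<ll> C)"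

definition trace_out :: "'m \<Rightarrow> 'm \<Rightarrow> 'm \<Rightarrow> 'c \<Rightarrow> 'c \<Rightarrow> 'c" where
  "trace_out A X X' t e = (\<ii> A \<star> e) \<cdot> \<aa> A X X' \<cdot> (t \<star> \<ii> X')"

text \<open>
  Transport runs against the twist, so the twisting 1-cell passes \<open>Y\<close> before \<open>X\<close>.
\<close>
definition paste_transport :: "'m \<Rightarrow> 'm \<Rightarrow> 'm \<Rightarrow> 'm \<Rightarrow> 'm \<Rightarrow> 'c \<Rightarrow> 'c \<Rightarrow> 'c" where
  "paste_transport A C D X Y t u
     = \<aa> A X Y \<cdot> (t \<star> \<ii> Y) \<cdot> inv_arr B (\<aa> X C Y) \<cdot> (\<ii> X \<star> u) \<cdot> \<aa> X Y D"

lemma inv_paste_twist: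
  assumes [simp]: "A \<in> Ob B" "C \<in> Ob B" "D \<in> Ob B" "M \<in> Ob B" "N \<in> Ob B"
    "Src B A = Src B M" "Trg B A = Src B M" "Src B C = Trg B M" "Trg B C = Trg B M"
    "Src B D = Trg B N" "Trg B D = Trg B N" "Src B N = Trg B M"
    and [simp]: "is_iso B t" "Dom B t = A \<odot> M" "Cod B t = M \<odot> C"
    and [simp]: "is_iso B u" "Dom B u = C \<odot> N" "Cod B u = N \<odot> D"
  shows "inv_arr B (paste_twist A C D M N t u)
    = paste_transport A C D M N (inv_arr B t) (inv_arr B u)"
proof -
  have [simp]: "inv_arr B (inv_arr B f) = f" if "is_iso B f" for f
    using that by (intro inv_arrI(2)) (simp_all add: is_iso_Ar)
  have [simp]: "t \<in> Ar B" "u \<in> Ar B" by (simp_all add: is_iso_Ar)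
  show ?thesis
    by (simp add: paste_twist_def paste_transport_def is_iso_comp is_iso_hcomp2 iso_inv_arr)
qed

end

text \<open>
  The data for tracing a composite: 1-cells \<open>X\<close> from \<open>a\<close> to \<open>b\<close> and \<open>Y\<close> from \<open>b\<close> to \<open>c\<close> with duals and
  endomorphisms \<open>f\<close> and \<open>h\<close>, and transports \<open>t\<close> and \<open>u\<close> past them between arbitrary 1-cells \<open>A\<close>, \<open>C\<close> and
  \<open>D\<close> in the role of the twisting 1-cells at \<open>a\<close>, \<open>b\<close> and \<open>c\<close>.
\<close>
locale composite_trace = shadowed_bicategory B T S
  for B :: "('o, 'm, 'c, 'z) bicat_scheme" (structure)
    and T :: "('x, 'f, 'y) cat_scheme" and S :: "('m, 'c, 'x, 'f) shadow_data" +
  fixes a b c :: 'o and A C D :: 'm and X X' n e f t and Y Y' m k h u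
  assumes dX: "left_dual B a b X X' n e"
    and dY: "left_dual B b c Y Y' m k"
    and Ob [simp]: "A \<in> Ob B" "C \<in> Ob B" "D \<in> Ob B" "Src B A = a" "Trg B A = a"
      "Src B C = b" "Trg B C = b" "Src B D = c" "Trg B D = c"
    and f [simp]: "f \<in> Ar B" "Dom B f = X" "Cod B f = X"
    and h [simp]: "h \<in> Ar B" "Dom B h = Y" "Cod B h = Y"
    and t [simp]: "t \<in> Ar B" "Dom B t = X \<odot> C" "Cod B t = A \<odot> X"
    and u [simp]: "u \<in> Ar B" "Dom B u = Y \<odot> D" "Cod B u = C \<odot> Y"
begin

lemmas dual_typing [simp] = left_dual_typing[OF dX] left_dual_typing[OF dY]

text \<open>
  What remains of the loop of \<open>Y\<close> inside the loop of \<open>X\<close> once \<open>X\<close> and \<open>X'\<close> are split off: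
  \<open>inner_out\<close> is the outgoing half of the trace of \<open>Y\<close> next to \<open>X\<close>, and \<open>inner_in\<close> creates the pair
  \<open>X' \<odot> X\<close> next to \<open>Y \<odot> D\<close>.
\<close>
definition inner_out where
  "inner_out = (\<ii> X \<star> (\<rr> C \<cdot> trace_out C Y Y' u k)) \<cdot> \<aa> X (Y \<odot> D) Y' \<cdot> (\<aa> X Y D \<star> \<ii> Y')"

definition inner_in where
  "inner_in = (\<ii> X' \<star> inv_arr B (\<aa> X Y D)) \<cdot> \<aa> X' X (Y \<odot> D) \<cdot> (((\<ii> X' \<star> f) \<cdot> n) \<star> \<ii> (Y \<odot> D))
     \<cdot> inv_arr B (\<ll> (Y \<odot> D))"

abbreviation "nZ \<equiv> comp_coev X X' Y Y' n m"
abbreviation "eZ \<equiv> comp_ev X X' Y Y' e k"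
abbreviation "tZ \<equiv> paste_transport A C D X Y t u"

text \<open>
  Words and diagrams naming the cells of this situation, for use with strict forms: letters,
  generators, and then the pasted diagrams whose values are the 2-cells defined above.
\<close>
abbreviation "AX \<equiv> Atom X" abbreviation "AX' \<equiv> Atom X'" abbreviation "AY \<equiv> Atom Y"
abbreviation "AY' \<equiv> Atom Y'" abbreviation "AA \<equiv> Atom A" abbreviation "AC \<equiv> Atom C"
abbreviation "AD \<equiv> Atom D"

abbreviation "gn \<equiv> Gen (Empt b) n (AX' \<diamondop> AX)"
abbreviation "ge \<equiv> Gen (AX \<diamondop> AX') e (Empt a)"
abbreviation "gm \<equiv> Gen (Empt c) m (AY' \<diamondop> AY)"
abbreviation "gk \<equiv> Gen (AY \<diamondop> AY') k (Empt b)"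
abbreviation "gf \<equiv> Gen AX f AX"
abbreviation "gh \<equiv> Gen AY h AY"
abbreviation "gt \<equiv> Gen (AX \<diamondop> AC) t (AA \<diamondop> AX)"
abbreviation "gu \<equiv> Gen (AY \<diamondop> AD) u (AC \<diamondop> AY)"
abbreviation "dN \<equiv> Inv (Asc AY' AX' (AX \<diamondop> AY)) \<bullet> Idd AY' \<diamond> Asc AX' AX AY
     \<bullet> Idd AY' \<diamond> (gn \<diamond> Idd AY) \<bullet> Idd AY' \<diamond> Inv (Lun b AY) \<bullet> gm"
abbreviation "dE \<equiv> ge \<bullet> Idd AX \<diamond> Lun b AX' \<bullet> Idd AX \<diamond> (gk \<diamond> Idd AX')
     \<bullet> Idd AX \<diamond> Inv (Asc AY AY' AX') \<bullet> Asc AX AY (AY' \<diamondop> AX')"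
abbreviation "dT \<equiv> Asc AA AX AY \<bullet> gt \<diamond> Idd AY \<bullet> Inv (Asc AX AC AY) \<bullet> Idd AX \<diamond> gu \<bullet> Asc AX AY AD"
abbreviation "out \<equiv> \<lambda>A x x' t e. Idd A \<diamond> e \<bullet> Asc A x x' \<bullet> t \<diamond> Idd x'"
abbreviation "inn \<equiv> \<lambda>C p x x' n f. Asc x' x C \<bullet> (Idd x' \<diamond> f \<bullet> n) \<diamond> Idd C \<bullet> Inv (Lun p C)"
abbreviation "dv \<equiv> Idd AX \<diamond> (Run b AC \<bullet> out AC AY AY' gu gk) \<bullet> Asc AX (AY \<diamondop> AD) AY' \<bullet> Asc AX AY AD \<diamond> Idd AY'"
abbreviation "dw \<equiv> Idd AX' \<diamond> Inv (Asc AX AY AD) \<bullet> Asc AX' AX (AY \<diamondop> AD) \<bullet> (Idd AX' \<diamond> gf \<bullet> gn) \<diamond> Idd (AY \<diamondop> AD)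
   \<bullet> Inv (Lun b (AY \<diamondop> AD))"

lemmas unfolds = comp_coev_def comp_ev_def paste_transport_def trace_in_def trace_out_def inner_out_def inner_in_def

lemma inner_out_typing [simp]: "inner_out \<in> Ar B" "Dom B inner_out = X \<odot> Y \<odot> D \<odot> Y'" "Cod B inner_out = X \<odot> C"
  by (simp_all add: inner_out_def trace_out_def)

lemma inner_in_typing [simp]: "inner_in \<in> Ar B" "Dom B inner_in = Y \<odot> D" "Cod B inner_in = X' \<odot> (X \<odot> Y \<odot> D)"
  by (simp_all add: inner_in_def)

text \<open>
  Contracting \<open>Y \<odot> Y'\<close> commutes with the transport \<open>t\<close> past \<open>X\<close>, which stands to its left.
\<close>
lemma out_composite:
  "trace_out A (X \<odot> Y) (Y' \<odot> X') tZ eZ \<cdot> \<aa> (X \<odot> Y \<odot> D) Y' X' = trace_out A X X' t e \<cdot> (inner_out \<star> \<ii> X')"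
proof -
  let ?d = "out AA (AX \<diamondop> AY) (AY' \<diamondop> AX') dT dE \<bullet> Asc (AX \<diamondop> AY \<diamondop> AD) AY' AX'"
  let ?d' = "out AA AX AX' gt ge \<bullet> dv \<diamond> Idd AX'"
  have "val ?d = val ?d'"
  proof (rule strict_faithful)
    fix P assume "P \<in> Ob B" "Src B P = Trg B (cell (src_word ?d))"
    then have P [simp]: "P \<in> Ob B" "Src B P = a" by simp_all
    have nat: "strict gt (X' \<odot> P) \<cdot> (\<ii> X \<star> (\<ii> C \<star> strict gk (X' \<odot> P)))
        = (\<ii> A \<star> (\<ii> X \<star> strict gk (X' \<odot> P))) \<cdot> strict gt (Y \<odot> (Y' \<odot> (X' \<odot> P)))"
      using strict_nat[of gt "strict gk (X' \<odot> P)"] by simp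
    have "strict ?d' P = (\<ii> A \<star> strict ge P)
        \<cdot> (strict gt (X' \<odot> P) \<cdot> (\<ii> X \<star> (\<ii> C \<star> strict gk (X' \<odot> P))))
        \<cdot> (\<ii> X \<star> strict gu (Y' \<odot> (X' \<odot> P)))"
      by (simp add: whisker_comp)
    also have "\<dots> = strict ?d P" unfolding nat by (simp add: whisker_comp)
    finally show "strict ?d P = strict ?d' P" by (rule sym)
  qed simp_all
  then show ?thesis by (simp add: unfolds)
qed

text \<open>
  The endomorphism \<open>h\<close> of \<open>Y\<close> may be applied before or after the pair \<open>X' \<odot> X\<close> is created on its left.
\<close>
lemma in_composite:
  "\<aa> Y' X' (X \<odot> Y \<odot> D) \<cdot> trace_in D (X \<odot> Y) (Y' \<odot> X') nZ (f \<star> h) = (\<ii> Y' \<star> inner_in) \<cdot> trace_in D Y Y' m h"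
proof -
  let ?d = "Asc AY' AX' (AX \<diamondop> AY \<diamondop> AD) \<bullet> inn AD c (AX \<diamondop> AY) (AY' \<diamondop> AX') dN (gf \<diamond> gh)"
  let ?d' = "Idd AY' \<diamond> dw \<bullet> inn AD c AY AY' gm gh"
  have "val ?d = val ?d'"
  proof (rule strict_faithful)
    fix P assume "P \<in> Ob B" "Src B P = Trg B (cell (src_word ?d))"
    then have P [simp]: "P \<in> Ob B" "Src B P = c" by simp_all
    have nat: "(\<ii> X' \<star> (\<ii> X \<star> strict gh (D \<odot> P))) \<cdot> strict gn (Y \<odot> (D \<odot> P))
        = strict gn (Y \<odot> (D \<odot> P)) \<cdot> strict gh (D \<odot> P)"
      using strict_nat[of gn "strict gh (D \<odot> P)"] by simp
    have "strict ?d P = (\<ii> Y' \<star> (\<ii> X' \<star> strict gf (Y \<odot> (D \<odot> P))))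
        \<cdot> (\<ii> Y' \<star> ((\<ii> X' \<star> (\<ii> X \<star> strict gh (D \<odot> P))) \<cdot> strict gn (Y \<odot> (D \<odot> P)))) \<cdot> strict gm (D \<odot> P)"
      by (simp add: whisker_comp)
    also have "\<dots> = strict ?d' P" unfolding nat by (simp add: whisker_comp)
    finally show "strict ?d P = strict ?d' P" .
  qed simp_all
  then show ?thesis by (simp add: unfolds)
qed

text \<open>
  This equation separates the two loops: creating \<open>X' \<odot> X\<close> and contracting \<open>Y \<odot> Y'\<close> happen in different
  parts of the word, so the loop of \<open>Y\<close> can be closed before that of \<open>X\<close> is opened.
\<close>
lemma middle_composite:
  "(\<ii> X' \<star> inner_out) \<cdot> \<aa> X' (X \<odot> Y \<odot> D) Y' \<cdot> (inner_in \<star> \<ii> Y') = trace_in C X X' n f \<cdot> \<rr> C \<cdot> trace_out C Y Y' u k"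
proof -
  let ?d = "Idd AX' \<diamond> dv \<bullet> Asc AX' (AX \<diamondop> AY \<diamondop> AD) AY' \<bullet> dw \<diamond> Idd AY'"
  let ?d' = "inn AC b AX AX' gn gf \<bullet> Run b AC \<bullet> out AC AY AY' gu gk"
  have "val ?d = val ?d'"
  proof (rule strict_faithful)
    fix P assume "P \<in> Ob B" "Src B P = Trg B (cell (src_word ?d))"
    then have P [simp]: "P \<in> Ob B" "Src B P = b" by simp_all
    \<comment> \<open>The outgoing half of the loop of \<open>Y\<close>, which is slid as a whole past the cells concerning \<open>X\<close>.\<close>
    define q where "q = (\<ii> C \<star> strict gk P) \<cdot> strict gu (Y' \<odot> P)"
    have q [simp]: "q \<in> Ar B" "Dom B q = Y \<odot> (D \<odot> (Y' \<odot> P))" "Cod B q = C \<odot> P"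
      by (simp_all add: q_def)
    have natf: "(\<ii> X \<star> q) \<cdot> strict gf (Y \<odot> (D \<odot> (Y' \<odot> P))) = strict gf (C \<odot> P) \<cdot> (\<ii> X \<star> q)"
      using strict_nat[of gf q] by simp
    have natn: "(\<ii> X' \<star> (\<ii> X \<star> q)) \<cdot> strict gn (Y \<odot> (D \<odot> (Y' \<odot> P))) = strict gn (C \<odot> P) \<cdot> q"
      using strict_nat[of gn q] by simp
    have "strict ?d P = (\<ii> X' \<star> ((\<ii> X \<star> q) \<cdot> strict gf (Y \<odot> (D \<odot> (Y' \<odot> P)))))
        \<cdot> strict gn (Y \<odot> (D \<odot> (Y' \<odot> P)))"
      by (simp add: whisker_comp q_def)
    also have "\<dots> = (\<ii> X' \<star> strict gf (C \<odot> P)) \<cdot> (\<ii> X' \<star> (\<ii> X \<star> q)) \<cdot> strict gn (Y \<odot> (D \<odot> (Y' \<odot> P)))"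
      unfolding natf by (simp add: whisker_comp)
    also have "\<dots> = strict ?d' P" unfolding natn by (simp add: q_def)
    finally show "strict ?d P = strict ?d' P" .
  qed simp_all
  then show ?thesis by (simp add: unfolds)
qed

end

section \<open>Multiplicativity of the trace\<close>

context shadowed_bicategory
begin

lemma shm_typing [simp]:
  assumes "f \<in> Ar B" "Trg B (Dom B f) = Src B (Dom B f)"
  shows "shm S f \<in> Ar T" "Dom T (shm S f) = sh S (Dom B f)" "Cod T (shm S f) = sh S (Cod B f)"
  using shm_Hom[of "Dom B f" "Src B (Dom B f)" f "Cod B f"] assms
  by (auto simp: Hom_def cells1_def)

lemma shm_comp_composable:
  assumes "f \<in> Ar B" "k \<in> Ar B" "Dom B k = Cod B f" "Trg B (Dom B f) = Src B (Dom B f)"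
  shows "shm S (k \<cdot> f) = shm S k \<cdot>\<^bsub>T\<^esub> shm S f"
  by (rule shm_comp[of "Dom B f" "Src B (Dom B f)" f "Cod B f" k "Cod B k"])
    (use assms in \<open>auto simp: Hom_def cells1_def\<close>)

lemma sh_Ob_simp [simp]: "M \<in> Ob B \<Longrightarrow> Trg B M = Src B M \<Longrightarrow> sh S M \<in> Ob T"
  by (rule sh_Ob[of M "Src B M"]) (auto simp: cells1_def)

lemma shm_ident_simp [simp]:
  "M \<in> Ob B \<Longrightarrow> Trg B M = Src B M \<Longrightarrow> shm S (\<ii> M) = \<ii>\<^bsub>T\<^esub> (sh S M)"
  by (rule shm_ident[of M "Src B M"]) (auto simp: cells1_def)

lemma cyc_typing [simp]:
  assumes "M \<in> Ob B" "N \<in> Ob B" "Trg B M = Src B N" "Trg B N = Src B M"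
  shows "\<theta>\<^bsub>S\<^esub> M N \<in> Ar T" "Dom T (\<theta>\<^bsub>S\<^esub> M N) = sh S (M \<odot> N)" "Cod T (\<theta>\<^bsub>S\<^esub> M N) = sh S (N \<odot> M)"
  using cyc_Hom[of M "Src B M" "Trg B M" N] assms by (auto simp: Hom_def cells1_def)

lemma cyc_nat:
  assumes "f \<in> Ar B" "k \<in> Ar B" "Trg B (Dom B f) = Src B (Dom B k)" "Trg B (Dom B k) = Src B (Dom B f)"
  shows "\<theta>\<^bsub>S\<^esub> (Cod B f) (Cod B k) \<cdot>\<^bsub>T\<^esub> shm S (f \<star> k)
    = shm S (k \<star> f) \<cdot>\<^bsub>T\<^esub> \<theta>\<^bsub>S\<^esub> (Dom B f) (Dom B k)"
  by (rule cyc_natural[of "Dom B f" "Src B (Dom B f)" "Trg B (Dom B f)"])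
    (use assms in \<open>auto simp: Hom_def cells1_def\<close>)

lemma cyc_hexagon_Ob:
  assumes "M \<in> Ob B" "N \<in> Ob B" "P \<in> Ob B"
    "Trg B M = Src B N" "Trg B N = Src B P" "Trg B P = Src B M"
  shows "\<theta>\<^bsub>S\<^esub> (M \<odot> N) P
         = shm S (\<aa> P M N) \<cdot>\<^bsub>T\<^esub> \<theta>\<^bsub>S\<^esub> N (P \<odot> M) \<cdot>\<^bsub>T\<^esub> shm S (\<aa> N P M)
           \<cdot>\<^bsub>T\<^esub> \<theta>\<^bsub>S\<^esub> M (N \<odot> P) \<cdot>\<^bsub>T\<^esub> shm S (\<aa> M N P)"
  by (rule cyc_hexagon[of M "Src B M" "Trg B M" N "Trg B N"]) (use assms in \<open>auto simp: cells1_def\<close>)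

text \<open>
  Rotating a 1-cell past a unit is no more than a change of unitor.
\<close>
lemma cyc_unit:
  assumes [simp]: "M \<in> Ob B" "Src B M = r" "Trg B M = r"
  shows "\<theta>\<^bsub>S\<^esub> M (\<U> r) = shm S (inv_arr B (\<ll> M)) \<cdot>\<^bsub>T\<^esub> shm S (\<rr> M)"
proof -
  have [simp]: "r \<in> Obj0 B" using Src_Trg_Obj0[of M] by simp
  have "shm S (inv_arr B (\<ll> M)) \<cdot>\<^bsub>T\<^esub> shm S (\<rr> M)
      = (shm S (inv_arr B (\<ll> M)) \<cdot>\<^bsub>T\<^esub> shm S (\<ll> M)) \<cdot>\<^bsub>T\<^esub> \<theta>\<^bsub>S\<^esub> M (\<U> r)"
    using cyc_unit_right[of M r] by (simp add: cells1_def)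
  also have "\<dots> = \<theta>\<^bsub>S\<^esub> M (\<U> r)" by (simp flip: shm_comp_composable)
  finally show ?thesis by (rule sym)
qed

text \<open>
  The trace in an untwisted shadow of an endomorphism \<open>f\<close> of \<open>X\<close>, with a transport \<open>t\<close> from \<open>X \<odot> C\<close> to
  \<open>A \<odot> X\<close>.  The cyclicity isomorphism carries \<open>X\<close> round past \<open>C \<odot> X'\<close>.  The grouping follows the
  twisted cyclicity.
\<close>
definition shadow_trace :: "'m \<Rightarrow> 'm \<Rightarrow> 'm \<Rightarrow> 'm \<Rightarrow> 'c \<Rightarrow> 'c \<Rightarrow> 'c \<Rightarrow> 'c \<Rightarrow> 'f" where
  "shadow_trace A C X X' t n e f =
     shm S (\<ii> A \<star> e)
     \<cdot>\<^bsub>T\<^esub> (shm S (\<aa> A X X') \<cdot>\<^bsub>T\<^esub> shm S (t \<star> \<ii> X') \<cdot>\<^bsub>T\<^esub> shm S (inv_arr B (\<aa> X C X'))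
        \<cdot>\<^bsub>T\<^esub> \<theta>\<^bsub>S\<^esub> (C \<odot> X') X \<cdot>\<^bsub>T\<^esub> shm S (inv_arr B (\<aa> C X' X)))
     \<cdot>\<^bsub>T\<^esub> shm S (\<ii> C \<star> (\<ii> X' \<star> f)) \<cdot>\<^bsub>T\<^esub> shm S (\<ii> C \<star> n)"

lemma shadow_trace_Hom:
  assumes d: "left_dual B a b X X' n e"
    and [simp]: "A \<in> Ob B" "C \<in> Ob B" "Src B A = a" "Trg B A = a" "Src B C = b" "Trg B C = b"
    and [simp]: "t \<in> Ar B" "Dom B t = X \<odot> C" "Cod B t = A \<odot> X" "f \<in> Ar B" "Dom B f = X" "Cod B f = X"
  shows "shadow_trace A C X X' t n e f \<in> Hom T (sh S (C \<odot> \<U> b)) (sh S (A \<odot> \<U> a))"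
proof -
  note [simp] = left_dual_typing[OF d]
  show ?thesis by (simp add: shadow_trace_def Hom_def)
qed

text \<open>
  The hexagon splits the rotation of \<open>C \<odot> X'\<close> into that of \<open>C\<close> followed by that of \<open>X'\<close>.  The former is
  natural in the pair \<open>X' \<odot> X\<close>, which has just been created from a unit 1-cell, and rotating \<open>C\<close> past
  a unit is trivial.  So only \<open>X'\<close> is rotated, and \<open>C\<close> stays where it is throughout.
\<close>
lemma shadow_trace_eq:
  assumes d: "left_dual B a b X X' n e"
    and [simp]: "A \<in> Ob B" "C \<in> Ob B" "Src B A = a" "Trg B A = a" "Src B C = b" "Trg B C = b"
    and [simp]: "t \<in> Ar B" "Dom B t = X \<odot> C" "Cod B t = A \<odot> X" "f \<in> Ar B" "Dom B f = X" "Cod B f = X"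
  shows "shadow_trace A C X X' t n e f
    = shm S (trace_out A X X' t e) \<cdot>\<^bsub>T\<^esub> \<theta>\<^bsub>S\<^esub> X' (X \<odot> C) \<cdot>\<^bsub>T\<^esub> shm S (trace_in C X X' n f)
        \<cdot>\<^bsub>T\<^esub> shm S (\<rr> C)"
proof -
  note [simp] = left_dual_typing[OF d]
  define u where "u = (\<ii> X' \<star> f) \<cdot> n"
  have u [simp]: "u \<in> Ar B" "Dom B u = \<U> b" "Cod B u = X' \<odot> X" by (simp_all add: u_def)
  have hex: "\<theta>\<^bsub>S\<^esub> (C \<odot> X') X \<cdot>\<^bsub>T\<^esub> shm S (inv_arr B (\<aa> C X' X))
      = shm S (\<aa> X C X') \<cdot>\<^bsub>T\<^esub> \<theta>\<^bsub>S\<^esub> X' (X \<odot> C) \<cdot>\<^bsub>T\<^esub> shm S (\<aa> X' X C) \<cdot>\<^bsub>T\<^esub> \<theta>\<^bsub>S\<^esub> C (X' \<odot> X)"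
    by (simp add: cyc_hexagon_Ob flip: shm_comp_composable)
  have nat: "\<theta>\<^bsub>S\<^esub> C (X' \<odot> X) \<cdot>\<^bsub>T\<^esub> shm S (\<ii> C \<star> u) = shm S (u \<star> \<ii> C) \<cdot>\<^bsub>T\<^esub> \<theta>\<^bsub>S\<^esub> C (\<U> b)"
    using cyc_nat[of "\<ii> C" u] by simp
  have U: "shm S (\<ii> C \<star> (\<ii> X' \<star> f)) \<cdot>\<^bsub>T\<^esub> shm S (\<ii> C \<star> n) = shm S (\<ii> C \<star> u)"
    unfolding u_def by (simp add: whisker_comp flip: shm_comp_composable)
  have "shadow_trace A C X X' t n e f
      = shm S (\<ii> A \<star> e) \<cdot>\<^bsub>T\<^esub> shm S (\<aa> A X X') \<cdot>\<^bsub>T\<^esub> shm S (t \<star> \<ii> X') \<cdot>\<^bsub>T\<^esub> shm S (inv_arr B (\<aa> X C X'))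
        \<cdot>\<^bsub>T\<^esub> (\<theta>\<^bsub>S\<^esub> (C \<odot> X') X \<cdot>\<^bsub>T\<^esub> shm S (inv_arr B (\<aa> C X' X))) \<cdot>\<^bsub>T\<^esub> shm S (\<ii> C \<star> u)"
    by (simp add: shadow_trace_def U)
  also have "\<dots> = shm S (\<ii> A \<star> e) \<cdot>\<^bsub>T\<^esub> shm S (\<aa> A X X') \<cdot>\<^bsub>T\<^esub> shm S (t \<star> \<ii> X')
        \<cdot>\<^bsub>T\<^esub> (shm S (inv_arr B (\<aa> X C X')) \<cdot>\<^bsub>T\<^esub> shm S (\<aa> X C X'))
        \<cdot>\<^bsub>T\<^esub> \<theta>\<^bsub>S\<^esub> X' (X \<odot> C) \<cdot>\<^bsub>T\<^esub> shm S (\<aa> X' X C) \<cdot>\<^bsub>T\<^esub> (\<theta>\<^bsub>S\<^esub> C (X' \<odot> X) \<cdot>\<^bsub>T\<^esub> shm S (\<ii> C \<star> u))"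
    unfolding hex by simp
  also have "shm S (inv_arr B (\<aa> X C X')) \<cdot>\<^bsub>T\<^esub> shm S (\<aa> X C X') = \<ii>\<^bsub>T\<^esub> (sh S (X \<odot> C \<odot> X'))"
    by (simp flip: shm_comp_composable)
  also have "shm S (\<ii> A \<star> e) \<cdot>\<^bsub>T\<^esub> shm S (\<aa> A X X') \<cdot>\<^bsub>T\<^esub> shm S (t \<star> \<ii> X')
        \<cdot>\<^bsub>T\<^esub> \<ii>\<^bsub>T\<^esub> (sh S (X \<odot> C \<odot> X'))
        \<cdot>\<^bsub>T\<^esub> \<theta>\<^bsub>S\<^esub> X' (X \<odot> C) \<cdot>\<^bsub>T\<^esub> shm S (\<aa> X' X C) \<cdot>\<^bsub>T\<^esub> (\<theta>\<^bsub>S\<^esub> C (X' \<odot> X) \<cdot>\<^bsub>T\<^esub> shm S (\<ii> C \<star> u))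
      = shm S (trace_out A X X' t e) \<cdot>\<^bsub>T\<^esub> \<theta>\<^bsub>S\<^esub> X' (X \<odot> C) \<cdot>\<^bsub>T\<^esub> shm S (trace_in C X X' n f)
        \<cdot>\<^bsub>T\<^esub> shm S (\<rr> C)"
    unfolding nat trace_in_def trace_out_def u_def[symmetric]
    by (simp add: cyc_unit shm_comp_composable)
  finally show ?thesis .
qed

text \<open>
  The comparison of the two duals is created with the incoming half, carried through the rotation by
  naturality, and absorbed by the outgoing half.
\<close>
lemma shadow_trace_dual_unique:
  assumes d: "left_dual B a b X X' n e" and d': "left_dual B a b X X'' n' e'"
    and [simp]: "A \<in> Ob B" "C \<in> Ob B" "Src B A = a" "Trg B A = a" "Src B C = b" "Trg B C = b"
    and [simp]: "t \<in> Ar B" "Dom B t = X \<odot> C" "Cod B t = A \<odot> X" "f \<in> Ar B" "Dom B f = X" "Cod B f = X"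
  shows "shadow_trace A C X X' t n e f = shadow_trace A C X X'' t n' e' f"
proof -
  note [simp] = left_dual_typing[OF d] left_dual_typing[OF d']
  obtain \<phi> where "\<phi> \<in> Hom B X' X''" and n': "(\<phi> \<star> \<ii> X) \<cdot> n = n'" and e: "e' \<cdot> (\<ii> X \<star> \<phi>) = e"
    using left_dual_unique[OF d d'] by metis
  then have \<phi> [simp]: "\<phi> \<in> Ar B" "Dom B \<phi> = X'" "Cod B \<phi> = X''" by (auto simp: Hom_def)
  have out: "trace_out A X X' t e = trace_out A X X'' t e' \<cdot> (\<ii> (X \<odot> C) \<star> \<phi>)"
  proof -
    have "trace_out A X X' t e = (\<ii> A \<star> e') \<cdot> ((\<ii> A \<star> (\<ii> X \<star> \<phi>)) \<cdot> \<aa> A X X') \<cdot> (t \<star> \<ii> X')"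
      by (simp add: trace_out_def whisker_comp flip: e)
    also have "(\<ii> A \<star> (\<ii> X \<star> \<phi>)) \<cdot> \<aa> A X X' = \<aa> A X X'' \<cdot> (\<ii> (A \<odot> X) \<star> \<phi>)"
      using asc_nat[of "\<ii> A" "\<ii> X" \<phi>] by simp
    finally show ?thesis by (simp add: trace_out_def comp_hcomp2_comp)
  qed
  have inn: "(\<phi> \<star> \<ii> (X \<odot> C)) \<cdot> trace_in C X X' n f = trace_in C X X'' n' f"
  proof -
    have "trace_in C X X'' n' f = \<aa> X'' X C \<cdot> (((\<phi> \<star> \<ii> X) \<cdot> (\<ii> X' \<star> f) \<cdot> n) \<star> \<ii> C) \<cdot> inv_arr B (\<ll> C)"
      by (simp add: trace_in_def comp_hcomp2_comp_rest flip: n')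
    also have "\<dots> = (\<aa> X'' X C \<cdot> ((\<phi> \<star> \<ii> X) \<star> \<ii> C)) \<cdot> (((\<ii> X' \<star> f) \<cdot> n) \<star> \<ii> C) \<cdot> inv_arr B (\<ll> C)"
      by (simp add: whisker_comp)
    also have "\<aa> X'' X C \<cdot> ((\<phi> \<star> \<ii> X) \<star> \<ii> C) = (\<phi> \<star> \<ii> (X \<odot> C)) \<cdot> \<aa> X' X C"
      using asc_nat[of \<phi> "\<ii> X" "\<ii> C"] by simp
    finally show ?thesis by (simp add: trace_in_def)
  qed
  have [simp]: "trace_out A X X'' t e' \<in> Ar B" "Dom B (trace_out A X X'' t e') = X \<odot> C \<odot> X''"
    "trace_in C X X' n f \<in> Ar B" "Cod B (trace_in C X X' n f) = X' \<odot> (X \<odot> C)"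
    "Dom B (trace_in C X X' n f) = C"
    by (simp_all add: trace_out_def trace_in_def)
  have "shadow_trace A C X X' t n e f = shm S (trace_out A X X'' t e')
      \<cdot>\<^bsub>T\<^esub> (shm S (\<ii> (X \<odot> C) \<star> \<phi>) \<cdot>\<^bsub>T\<^esub> \<theta>\<^bsub>S\<^esub> X' (X \<odot> C)) \<cdot>\<^bsub>T\<^esub> shm S (trace_in C X X' n f) \<cdot>\<^bsub>T\<^esub> shm S (\<rr> C)"
    by (simp add: shadow_trace_eq[OF d] out shm_comp_composable)
  also have "shm S (\<ii> (X \<odot> C) \<star> \<phi>) \<cdot>\<^bsub>T\<^esub> \<theta>\<^bsub>S\<^esub> X' (X \<odot> C) = \<theta>\<^bsub>S\<^esub> X'' (X \<odot> C) \<cdot>\<^bsub>T\<^esub> shm S (\<phi> \<star> \<ii> (X \<odot> C))"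
    using cyc_nat[of \<phi> "\<ii> (X \<odot> C)"] by simp
  finally show ?thesis
    by (simp add: shadow_trace_eq[OF d'] shm_comp_composable flip: inn)
qed

end

context composite_trace
begin

text \<open>
  The hexagon splits the rotation of \<open>Y' \<odot> X'\<close> into that of \<open>Y'\<close> followed by that of \<open>X'\<close>.  By naturality
  of these rotations, the creation of \<open>X' \<odot> X\<close> moves after the first and the contraction of \<open>Y \<odot> Y'\<close>
  before the second; between the two rotations the loops then separate.
\<close>
lemma shadow_trace_composite:
  "shadow_trace A D (X \<odot> Y) (Y' \<odot> X') tZ nZ eZ (f \<star> h)
    = shadow_trace A C X X' t n e f \<cdot>\<^bsub>T\<^esub> shadow_trace C D Y Y' u m k h"
proof -
  note dZ = left_dual_comp[OF dX dY]
  note [simp] = left_dual_typing[OF dZ]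
  let ?P = "X \<odot> Y \<odot> D"
  have tZ [simp]: "tZ \<in> Ar B" "Dom B tZ = ?P" "Cod B tZ = A \<odot> (X \<odot> Y)"
    by (simp_all add: paste_transport_def)
  have [simp]: "trace_out A (X \<odot> Y) (Y' \<odot> X') tZ eZ \<in> Ar B"
    "Dom B (trace_out A (X \<odot> Y) (Y' \<odot> X') tZ eZ) = ?P \<odot> (Y' \<odot> X')"
    "Cod B (trace_out A (X \<odot> Y) (Y' \<odot> X') tZ eZ) = A \<odot> \<U> a"
    "trace_in D (X \<odot> Y) (Y' \<odot> X') nZ (f \<star> h) \<in> Ar B"
    "Dom B (trace_in D (X \<odot> Y) (Y' \<odot> X') nZ (f \<star> h)) = D"
    "Cod B (trace_in D (X \<odot> Y) (Y' \<odot> X') nZ (f \<star> h)) = Y' \<odot> X' \<odot> ?P"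
    "trace_out A X X' t e \<in> Ar B" "Dom B (trace_out A X X' t e) = X \<odot> C \<odot> X'"
    "trace_in C X X' n f \<in> Ar B" "Dom B (trace_in C X X' n f) = C"
    "Cod B (trace_in C X X' n f) = X' \<odot> (X \<odot> C)"
    "trace_out C Y Y' u k \<in> Ar B" "Dom B (trace_out C Y Y' u k) = Y \<odot> D \<odot> Y'"
    "Cod B (trace_out C Y Y' u k) = C \<odot> \<U> b"
    "trace_in D Y Y' m h \<in> Ar B" "Dom B (trace_in D Y Y' m h) = D"
    "Cod B (trace_in D Y Y' m h) = Y' \<odot> (Y \<odot> D)"
    by (simp_all add: trace_out_def trace_in_def)
  have "shadow_trace A D (X \<odot> Y) (Y' \<odot> X') tZ nZ eZ (f \<star> h)
      = shm S (trace_out A (X \<odot> Y) (Y' \<odot> X') tZ eZ) \<cdot>\<^bsub>T\<^esub> \<theta>\<^bsub>S\<^esub> (Y' \<odot> X') ?P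
        \<cdot>\<^bsub>T\<^esub> shm S (trace_in D (X \<odot> Y) (Y' \<odot> X') nZ (f \<star> h)) \<cdot>\<^bsub>T\<^esub> shm S (\<rr> D)"
    by (simp add: shadow_trace_eq[OF dZ])
  also have "\<dots> = shm S (trace_out A (X \<odot> Y) (Y' \<odot> X') tZ eZ \<cdot> \<aa> ?P Y' X')
        \<cdot>\<^bsub>T\<^esub> \<theta>\<^bsub>S\<^esub> X' (?P \<odot> Y') \<cdot>\<^bsub>T\<^esub> shm S (\<aa> X' ?P Y') \<cdot>\<^bsub>T\<^esub> \<theta>\<^bsub>S\<^esub> Y' (X' \<odot> ?P)
        \<cdot>\<^bsub>T\<^esub> shm S (\<aa> Y' X' ?P \<cdot> trace_in D (X \<odot> Y) (Y' \<odot> X') nZ (f \<star> h)) \<cdot>\<^bsub>T\<^esub> shm S (\<rr> D)"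
    by (simp add: cyc_hexagon_Ob shm_comp_composable)
  also have "\<dots> = shm S (trace_out A X X' t e)
        \<cdot>\<^bsub>T\<^esub> (shm S (inner_out \<star> \<ii> X') \<cdot>\<^bsub>T\<^esub> \<theta>\<^bsub>S\<^esub> X' (?P \<odot> Y')) \<cdot>\<^bsub>T\<^esub> shm S (\<aa> X' ?P Y')
        \<cdot>\<^bsub>T\<^esub> (\<theta>\<^bsub>S\<^esub> Y' (X' \<odot> ?P) \<cdot>\<^bsub>T\<^esub> shm S (\<ii> Y' \<star> inner_in)) \<cdot>\<^bsub>T\<^esub> shm S (trace_in D Y Y' m h) \<cdot>\<^bsub>T\<^esub> shm S (\<rr> D)"
    unfolding out_composite in_composite by (simp add: shm_comp_composable)
  also have "shm S (inner_out \<star> \<ii> X') \<cdot>\<^bsub>T\<^esub> \<theta>\<^bsub>S\<^esub> X' (?P \<odot> Y') = \<theta>\<^bsub>S\<^esub> X' (X \<odot> C) \<cdot>\<^bsub>T\<^esub> shm S (\<ii> X' \<star> inner_out)"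
    using cyc_nat[of "\<ii> X'" inner_out] by simp
  also have "\<theta>\<^bsub>S\<^esub> Y' (X' \<odot> ?P) \<cdot>\<^bsub>T\<^esub> shm S (\<ii> Y' \<star> inner_in) = shm S (inner_in \<star> \<ii> Y') \<cdot>\<^bsub>T\<^esub> \<theta>\<^bsub>S\<^esub> Y' (Y \<odot> D)"
    using cyc_nat[of "\<ii> Y'" inner_in] by simp
  also have "shm S (trace_out A X X' t e)
        \<cdot>\<^bsub>T\<^esub> (\<theta>\<^bsub>S\<^esub> X' (X \<odot> C) \<cdot>\<^bsub>T\<^esub> shm S (\<ii> X' \<star> inner_out)) \<cdot>\<^bsub>T\<^esub> shm S (\<aa> X' ?P Y')
        \<cdot>\<^bsub>T\<^esub> (shm S (inner_in \<star> \<ii> Y') \<cdot>\<^bsub>T\<^esub> \<theta>\<^bsub>S\<^esub> Y' (Y \<odot> D)) \<cdot>\<^bsub>T\<^esub> shm S (trace_in D Y Y' m h) \<cdot>\<^bsub>T\<^esub> shm S (\<rr> D)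
      = shm S (trace_out A X X' t e) \<cdot>\<^bsub>T\<^esub> \<theta>\<^bsub>S\<^esub> X' (X \<odot> C)
        \<cdot>\<^bsub>T\<^esub> shm S ((\<ii> X' \<star> inner_out) \<cdot> \<aa> X' ?P Y' \<cdot> (inner_in \<star> \<ii> Y'))
        \<cdot>\<^bsub>T\<^esub> \<theta>\<^bsub>S\<^esub> Y' (Y \<odot> D) \<cdot>\<^bsub>T\<^esub> shm S (trace_in D Y Y' m h) \<cdot>\<^bsub>T\<^esub> shm S (\<rr> D)"
    by (simp add: shm_comp_composable)
  also have "\<dots> = shadow_trace A C X X' t n e f \<cdot>\<^bsub>T\<^esub> shadow_trace C D Y Y' u m k h"
    unfolding middle_composite by (simp add: shm_comp_composable shadow_trace_eq[OF dX] shadow_trace_eq[OF dY])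
  finally show ?thesis .
qed

end

text \<open>
  Composing with the twisting 1-cell is all that the twisted shadow adds, and the source 0-cells of
  the cells involved determine which twisting 1-cell it is; so the trace is a trace of underlying
  2-cells.
\<close>

lemma twisted_trace_eq:
  assumes "shadowed_bicategory B T S" "twisting B G K" "g \<in> carrier G"
    and d: "left_dual (twist_bicat B G K) a b X X' \<delta> \<epsilon>"
    and \<phi>: "\<phi> \<in> Hom (twist_bicat B G K) X X"
  shows "twisted_trace B G K T S g X X' \<delta> \<epsilon> \<phi>
    = shadowed_bicategory.shadow_trace B T S (\<Theta>\<^bsub>K\<^esub> a (inv\<^bsub>G\<^esub> g)) (\<Theta>\<^bsub>K\<^esub> b (inv\<^bsub>G\<^esub> g)) (fst X) (fst X')
        (inv_arr B (snd X (inv\<^bsub>G\<^esub> g))) (fst (snd \<delta>)) (fst (snd \<epsilon>)) (fst (snd \<phi>))"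
proof -
  interpret shadowed_bicategory B T S by fact
  interpret twisting B G K by fact
  have B: "left_dual B a b (fst X) (fst X') (fst (snd \<delta>)) (fst (snd \<epsilon>))"
    and fst: "fst \<delta> = \<U>\<^bsub>W\<^esub> b" "fst \<epsilon> = X \<odot>\<^bsub>W\<^esub> X'" "fst \<phi> = X"
    using d \<phi> unfolding left_dual_twist_bicat Hom_twist_bicat by (metis fst_conv)+
  note [simp] = left_dual_typing[OF B]
  show ?thesis
    by (simp add: twisted_trace_def twisted_shm_def twisted_cyc_def transport_def shadow_trace_def
        Let_def fst twist_bicat_simps)
qed

theorem proposition6p9:
  fixes B :: "('o, 'm, 'c) bicat"
    and G :: "'g monoid"
    and K :: "('g, 'o, 'm, 'c) twist_data"
    and T :: "('x, 'f) cat"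
    and S :: "('m, 'c, 'x, 'f) shadow_data"
  assumes "group G" and "g \<in> carrier G"
    and "shadowed_bicategory B T S"
    and "twisting B G K"
    and W: "W = twist_bicat B G K"
    and "a \<in> Obj0 B" and "b \<in> Obj0 B" and "c \<in> Obj0 B"
    and "X \<in> cells1 W a b" and "Y \<in> cells1 W b c"
    and "left_dualizable W a b X" and "left_dualizable W b c Y"
    and "f\<^sub>X \<in> Hom W X X" and "f\<^sub>Y \<in> Hom W Y Y"
  shows "left_dualizable W a c (X \<odot>\<^bsub>W\<^esub> Y) \<and>
    (\<forall>X' \<eta>\<^sub>X \<epsilon>\<^sub>X Y' \<eta>\<^sub>Y \<epsilon>\<^sub>Y Z' \<eta>\<^sub>Z \<epsilon>\<^sub>Z.
       left_dual W a b X X' \<eta>\<^sub>X \<epsilon>\<^sub>X \<longrightarrow>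
       left_dual W b c Y Y' \<eta>\<^sub>Y \<epsilon>\<^sub>Y \<longrightarrow>
       left_dual W a c (X \<odot>\<^bsub>W\<^esub> Y) Z' \<eta>\<^sub>Z \<epsilon>\<^sub>Z \<longrightarrow>
       twisted_trace B G K T S g (X \<odot>\<^bsub>W\<^esub> Y) Z' \<eta>\<^sub>Z \<epsilon>\<^sub>Z (f\<^sub>X \<star>\<^bsub>W\<^esub> f\<^sub>Y)
         \<in> Hom T (twisted_sh B G K S g (\<U>\<^bsub>W\<^esub> c)) (twisted_sh B G K S g (\<U>\<^bsub>W\<^esub> a)) \<and>
       twisted_trace B G K T S g (X \<odot>\<^bsub>W\<^esub> Y) Z' \<eta>\<^sub>Z \<epsilon>\<^sub>Z (f\<^sub>X \<star>\<^bsub>W\<^esub> f\<^sub>Y)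
         = twisted_trace B G K T S g X X' \<eta>\<^sub>X \<epsilon>\<^sub>X f\<^sub>X
           \<cdot>\<^bsub>T\<^esub> twisted_trace B G K T S g Y Y' \<eta>\<^sub>Y \<epsilon>\<^sub>Y f\<^sub>Y)"
proof -
  interpret shadowed_bicategory B T S by fact
  interpret twisting B G K by fact
  let ?W = "twist_bicat B G K" and ?g = "inv\<^bsub>G\<^esub> g"
  note hyps = assms(6-)[unfolded W]
  have g [simp]: "?g \<in> carrier G" using \<open>g \<in> carrier G\<close> by simp
  show ?thesis
    unfolding W
  proof (intro conjI allI impI)
    show "left_dualizable ?W a c (X \<odot>\<^bsub>?W\<^esub> Y)"
      using hyps(6,7) left_dual_twist_comp unfolding left_dualizable_def by metis
  next
    fix X' \<eta>\<^sub>X \<epsilon>\<^sub>X Y' \<eta>\<^sub>Y \<epsilon>\<^sub>Y Z' \<eta>\<^sub>Z \<epsilon>\<^sub>Z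
    assume dualX: "left_dual ?W a b X X' \<eta>\<^sub>X \<epsilon>\<^sub>X" and dualY: "left_dual ?W b c Y Y' \<eta>\<^sub>Y \<epsilon>\<^sub>Y"
      and dualZ: "left_dual ?W a c (X \<odot>\<^bsub>?W\<^esub> Y) Z' \<eta>\<^sub>Z \<epsilon>\<^sub>Z"
    define M N P where "M = fst X" "N = fst Y" "P = fst Z'"
    define t u where "t = inv_arr B (snd X ?g)" "u = inv_arr B (snd Y ?g)"
    define p q where "p = fst (snd f\<^sub>X)" "q = fst (snd f\<^sub>Y)"
    have X: "X \<in> twist_cells1 B G K" and Y: "Y \<in> twist_cells1 B G K"
      and bX: "left_dual B a b M (fst X') (fst (snd \<eta>\<^sub>X)) (fst (snd \<epsilon>\<^sub>X))"
      and bY: "left_dual B b c N (fst Y') (fst (snd \<eta>\<^sub>Y)) (fst (snd \<epsilon>\<^sub>Y))"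
      and bZ: "left_dual B a c (M \<odot>\<^bsub>B\<^esub> N) P (fst (snd \<eta>\<^sub>Z)) (fst (snd \<epsilon>\<^sub>Z))"
      using dualX dualY dualZ unfolding left_dual_twist_bicat M_N_P_def by (simp_all add: twist_bicat_simps)
    note [simp] = left_dual_typing[OF bX] left_dual_typing[OF bY] left_dual_typing[OF bZ]
      twist_cells1D[OF X, folded M_N_P_def] twist_cells1D[OF Y, folded M_N_P_def]
    have p: "twist_compatible B G K X p X" and q: "twist_compatible B G K Y q Y"
      and f_eq: "f\<^sub>X = (X, p, X)" "f\<^sub>Y = (Y, q, Y)"
      using hyps(8,9) unfolding Hom_twist_bicat p_q_def by metis+
    note [simp] = twist_compatible_typing[OF p, folded M_N_P_def]
      twist_compatible_typing[OF q, folded M_N_P_def]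
    have fZ: "f\<^sub>X \<star>\<^bsub>?W\<^esub> f\<^sub>Y \<in> Hom ?W (X \<odot>\<^bsub>?W\<^esub> Y) (X \<odot>\<^bsub>?W\<^esub> Y)"
      unfolding Hom_twist_bicat using twist_compatible_hcomp[OF X Y X Y p q] twist_comp1_cell[OF X Y]
      by (simp add: f_eq twist_bicat_simps flip: M_N_P_def)
    interpret composite_trace B T S a b c "\<Theta>\<^bsub>K\<^esub> a ?g" "\<Theta>\<^bsub>K\<^esub> b ?g" "\<Theta>\<^bsub>K\<^esub> c ?g"
      M "fst X'" "fst (snd \<eta>\<^sub>X)" "fst (snd \<epsilon>\<^sub>X)" p t
      N "fst Y'" "fst (snd \<eta>\<^sub>Y)" "fst (snd \<epsilon>\<^sub>Y)" q u
      by unfold_locales (use bX bY in \<open>simp_all add: t_u_def\<close>)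
    have tZ: "inv_arr B (snd (X \<odot>\<^bsub>?W\<^esub> Y) ?g) = tZ"
      by (simp add: twist_bicat_simps snd_twist_comp1 inv_paste_twist t_u_def flip: M_N_P_def)
    have tZ_typing: "tZ \<in> Ar B" "Dom B tZ = M \<odot>\<^bsub>B\<^esub> N \<odot>\<^bsub>B\<^esub> \<Theta>\<^bsub>K\<^esub> c ?g" "Cod B tZ = \<Theta>\<^bsub>K\<^esub> a ?g \<odot>\<^bsub>B\<^esub> (M \<odot>\<^bsub>B\<^esub> N)"
      by (simp_all add: paste_transport_def)
    have trZ: "twisted_trace B G K T S g (X \<odot>\<^bsub>?W\<^esub> Y) Z' \<eta>\<^sub>Z \<epsilon>\<^sub>Z (f\<^sub>X \<star>\<^bsub>?W\<^esub> f\<^sub>Y)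
        = shadow_trace (\<Theta>\<^bsub>K\<^esub> a ?g) (\<Theta>\<^bsub>K\<^esub> c ?g) (M \<odot>\<^bsub>B\<^esub> N) P tZ (fst (snd \<eta>\<^sub>Z)) (fst (snd \<epsilon>\<^sub>Z)) (p \<star>\<^bsub>B\<^esub> q)"
      using twisted_trace_eq[OF assms(3,4,2) dualZ fZ] unfolding tZ
      by (simp add: f_eq twist_bicat_simps flip: M_N_P_def)
    show "twisted_trace B G K T S g (X \<odot>\<^bsub>?W\<^esub> Y) Z' \<eta>\<^sub>Z \<epsilon>\<^sub>Z (f\<^sub>X \<star>\<^bsub>?W\<^esub> f\<^sub>Y)
        \<in> Hom T (twisted_sh B G K S g (\<U>\<^bsub>?W\<^esub> c)) (twisted_sh B G K S g (\<U>\<^bsub>?W\<^esub> a))"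
      unfolding trZ using shadow_trace_Hom[OF bZ] tZ_typing
      by (simp add: twisted_sh_def twist_bicat_simps)
    have "shadow_trace (\<Theta>\<^bsub>K\<^esub> a ?g) (\<Theta>\<^bsub>K\<^esub> c ?g) (M \<odot>\<^bsub>B\<^esub> N) P tZ (fst (snd \<eta>\<^sub>Z)) (fst (snd \<epsilon>\<^sub>Z)) (p \<star>\<^bsub>B\<^esub> q)
        = shadow_trace (\<Theta>\<^bsub>K\<^esub> a ?g) (\<Theta>\<^bsub>K\<^esub> c ?g) (M \<odot>\<^bsub>B\<^esub> N) (fst Y' \<odot>\<^bsub>B\<^esub> fst X') tZ nZ eZ (p \<star>\<^bsub>B\<^esub> q)"
      using tZ_typing by (intro shadow_trace_dual_unique[OF bZ left_dual_comp[OF bX bY]]) simp_all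
    then show "twisted_trace B G K T S g (X \<odot>\<^bsub>?W\<^esub> Y) Z' \<eta>\<^sub>Z \<epsilon>\<^sub>Z (f\<^sub>X \<star>\<^bsub>?W\<^esub> f\<^sub>Y)
        = twisted_trace B G K T S g X X' \<eta>\<^sub>X \<epsilon>\<^sub>X f\<^sub>X
           \<cdot>\<^bsub>T\<^esub> twisted_trace B G K T S g Y Y' \<eta>\<^sub>Y \<epsilon>\<^sub>Y f\<^sub>Y"
      unfolding trZ twisted_trace_eq[OF assms(3,4,2) dualX hyps(8)] twisted_trace_eq[OF assms(3,4,2) dualY hyps(9)]
      by (simp add: shadow_trace_composite flip: t_u_def p_q_def M_N_P_def)
  qed
qed

end
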